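(* For online two-sided selfish scheduling on related machines with the makespan objective, there exists a randomized polynomial-time mechanism that is two-sided truthful and whose competitive ratio is $O(\log m)$, both in expectation and with high probability.
   Context: Online two-sided selfish scheduling: there are $m$ machines, machine $i$ having a private speed $s_i>0$, and $n$ jobs, job $j$ having a private size $p_j>0$. Initially every machine reports a speed. Then jobs arrive one by one; upon arrival job $j$ reports a size, and the mechanism must immediately and irrevocably assign it (possibly at random) to a machine and charge it a fee $Q_j$. When a job arrives it can observe the reported speeds, the current loads of the machines and the outcomes of previous random assignments. After all jobs are processed, the mechanism pays each machine $i$ an amount $P_i$. If $L_i$ is the total size of jobs assigned to machine $i$, its completion time is $C_i=L_i/s_i$; machine $i$'s utility is $P_i-C_i$. A job's cost is its completion time $F_j$ plus its fee $Q_j$ (its utility is $-(F_j+Q_j)$). A mechanism is machine-side truthful if for every machine, reporting its true speed maximizes its expected utility $\mathbb{E}[P_i-C_i]$; it is job-side truthful if for every job, reporting its true size maximizes its expected utility $-\mathbb{E}[F_j+Q_j]$; it is two-sided truthful if both hold. The makespan of an assignment is $\max_i C_i$; the competitive ratio compares the makespan produced by the mechanism (under truthful reports) with the optimal offline makespan $\mathrm{OPT}$ of the instance. *)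

theory Defs
  imports
    "HOL-Probability.Probability"
    "HOL-Library.Landau_Symbols"
    "HOL-Computational_Algebra.Polynomial"
begin

section \<open>Scheduling on related machines\<close>

text \<open>
  An instance is a list \<open>s\<close> of machine speeds together with a list \<open>ps\<close> of job sizes in order of
  arrival; machines and jobs are numbered from 0. An assignment is a list \<open>a\<close> of machine numbers,
  \<open>a ! j\<close> being the machine of job \<open>j\<close>; a list shorter than \<open>ps\<close> assigns an initial segment of
  the jobs.
\<close>

definition positive :: "real list \<Rightarrow> bool" where
  "positive xs \<longleftrightarrow> (\<forall>x \<in> set xs. 0 < x)"

definition assignments :: "nat \<Rightarrow> nat \<Rightarrow> nat list set" where
  "assignments m n = {a. set a \<subseteq> {..<m} \<and> length a = n}"

definition load :: "real list \<Rightarrow> nat list \<Rightarrow> nat \<Rightarrow> real" where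
  "load ps a i = (\<Sum>j | j < length a \<and> a ! j = i. ps ! j)"

definition makespan :: "real list \<Rightarrow> real list \<Rightarrow> nat list \<Rightarrow> real" where
  "makespan s ps a = Max ((\<lambda>i. load ps a i / s ! i) ` {..<length s})"

definition OPT :: "real list \<Rightarrow> real list \<Rightarrow> real" where
  "OPT s ps = Min (makespan s ps ` assignments (length s) (length ps))"


section \<open>Online randomized mechanisms\<close>

text \<open>
  A random tape is a sequence of independent random numbers, uniform on the unit interval. Every
  job, and the final payment phase, gets a tape of its own, so an assignment is random also
  conditionally on the outcomes of the earlier ones.
\<close>

type_synonym tape = "nat \<Rightarrow> real"

definition tape_space :: "tape measure" where
  "tape_space = PiM UNIV (\<lambda>_. uniform_measure lborel {0..1})"

definition run_space :: "(nat \<Rightarrow> tape) measure" where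
  "run_space = PiM UNIV (\<lambda>_. tape_space)"

text \<open>
  \<open>alloc M s ps a r \<omega>\<close> is the machine assigned to a job reporting size \<open>r\<close> and the fee charged to it,
  where \<open>s\<close> are the reported speeds and \<open>ps\<close>, \<open>a\<close> the reported sizes and the machines of the
  jobs that arrived before. \<open>pay M s ps a \<omega> i\<close> is the amount paid to machine \<open>i\<close> at the end.
\<close>

record mechanism =
  alloc :: "real list \<Rightarrow> real list \<Rightarrow> nat list \<Rightarrow> real \<Rightarrow> tape \<Rightarrow> nat \<times> real"
  pay :: "real list \<Rightarrow> real list \<Rightarrow> nat list \<Rightarrow> tape \<Rightarrow> nat \<Rightarrow> real"

text \<open>Reported speeds, and reported sizes and machines of the jobs that have arrived so far.\<close>

definition history :: "real list \<Rightarrow> real list \<Rightarrow> nat list \<Rightarrow> bool" where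
  "history s ps a \<longleftrightarrow>
     s \<noteq> [] \<and> positive s \<and> positive ps \<and> a \<in> assignments (length s) (length ps)"

definition valid_mechanism :: "mechanism \<Rightarrow> bool" where
  "valid_mechanism M \<longleftrightarrow>
     (\<forall>s ps a. history s ps a \<longrightarrow>
        (\<forall>r>0. (\<forall>\<omega>. fst (alloc M s ps a r \<omega>) < length s) \<and>
               alloc M s ps a r \<in> tape_space \<rightarrow>\<^sub>M (count_space UNIV \<Otimes>\<^sub>M borel)) \<and>
        (\<forall>i<length s. (\<lambda>\<omega>. pay M s ps a \<omega> i) \<in> borel_measurable tape_space))"

fun run_upto :: "mechanism \<Rightarrow> real list \<Rightarrow> real list \<Rightarrow> (nat \<Rightarrow> tape) \<Rightarrow> nat \<Rightarrow> nat list" where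
  "run_upto M s ps \<omega> 0 = []"
| "run_upto M s ps \<omega> (Suc j) =
     (let a = run_upto M s ps \<omega> j in a @ [fst (alloc M s (take j ps) a (ps ! j) (\<omega> j))])"

definition run :: "mechanism \<Rightarrow> real list \<Rightarrow> real list \<Rightarrow> (nat \<Rightarrow> tape) \<Rightarrow> nat list" where
  "run M s ps \<omega> = run_upto M s ps \<omega> (length ps)"


section \<open>Truthfulness\<close>

text \<open>Utility of machine \<open>i\<close> of true speed \<open>v\<close> when the reported speeds are \<open>s\<close>.\<close>

definition machine_utility ::
  "mechanism \<Rightarrow> nat \<Rightarrow> real \<Rightarrow> real list \<Rightarrow> real list \<Rightarrow> (nat \<Rightarrow> tape) \<Rightarrow> real" where
  "machine_utility M i v s ps \<omega> =
     (let a = run M s ps \<omega> in pay M s ps a (\<omega> (length ps)) i - load ps a i / v)"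

text \<open>
  The Bochner integral of a non-integrable function is 0, so integrability, i.e. that all the
  expectations exist, is required explicitly here and below.
\<close>

definition machine_truthful :: "mechanism \<Rightarrow> bool" where
  "machine_truthful M \<longleftrightarrow>
     (\<forall>s ps i r. positive s \<and> positive ps \<and> i < length s \<and> r > 0 \<longrightarrow>
        integrable run_space (machine_utility M i (s ! i) s ps) \<and>
        integrable run_space (machine_utility M i (s ! i) (s[i := r]) ps) \<and>
        integral\<^sup>L run_space (machine_utility M i (s ! i) (s[i := r]) ps)
          \<le> integral\<^sup>L run_space (machine_utility M i (s ! i) s ps))"

text \<open>
  Utility of a job of true size \<open>p\<close> that reports \<open>r\<close>. Machines process their jobs in order of
  arrival, so the job completes when its machine has finished the current load and the job itself.
\<close>

definition job_utility ::
  "mechanism \<Rightarrow> real list \<Rightarrow> real list \<Rightarrow> nat list \<Rightarrow> real \<Rightarrow> real \<Rightarrow> tape \<Rightarrow> real" where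
  "job_utility M s ps a p r \<omega> =
     (let (i, Q) = alloc M s ps a r \<omega>; F = (load ps a i + p) / s ! i in - (F + Q))"

definition job_truthful :: "mechanism \<Rightarrow> bool" where
  "job_truthful M \<longleftrightarrow>
     (\<forall>s ps a p r. history s ps a \<and> p > 0 \<and> r > 0 \<longrightarrow>
        integrable tape_space (job_utility M s ps a p p) \<and>
        integrable tape_space (job_utility M s ps a p r) \<and>
        integral\<^sup>L tape_space (job_utility M s ps a p r)
          \<le> integral\<^sup>L tape_space (job_utility M s ps a p p))"

definition two_sided_truthful :: "mechanism \<Rightarrow> bool" where
  "two_sided_truthful M \<longleftrightarrow> machine_truthful M \<and> job_truthful M"


section \<open>Competitive ratio\<close>

definition competitive_in_expectation :: "mechanism \<Rightarrow> nat \<Rightarrow> real \<Rightarrow> bool" where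
  "competitive_in_expectation M m c \<longleftrightarrow>
     (\<forall>s ps. length s = m \<and> positive s \<and> positive ps \<longrightarrow>
        integrable run_space (\<lambda>\<omega>. makespan s ps (run M s ps \<omega>)) \<and>
        (LINT \<omega>|run_space. makespan s ps (run M s ps \<omega>)) \<le> c * OPT s ps)"

definition competitive_with_prob :: "mechanism \<Rightarrow> nat \<Rightarrow> real \<Rightarrow> real \<Rightarrow> bool" where
  "competitive_with_prob M m c q \<longleftrightarrow>
     (\<forall>s ps. length s = m \<and> positive s \<and> positive ps \<longrightarrow>
        \<P>(\<omega> in run_space. makespan s ps (run M s ps \<omega>) \<le> c * OPT s ps) \<ge> q)"


section \<open>Randomized polynomial time\<close>

text \<open>
  Speeds and sizes are real, so running times are measured on a randomized real RAM: unit-cost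
  field operations and comparisons on reals with rational constants, a unit-cost instruction that
  draws a fresh uniform random number, and arrays with indirect addressing. Natural numbers are
  used as array indices only; they can be incremented and compared. There are no conversions
  between the two sorts; in particular there is no rounding, which would make the unit-cost measure
  unreasonably permissive. Expressions are part of the fixed program, so
  evaluating one takes constant time and is charged as part of its command.
\<close>

datatype iexp =
    INum nat
  | ICell string iexp
  | ISuc iexp

datatype rexp =
    RNum rat
  | RCell string iexp
  | RAdd rexp rexp
  | RSub rexp rexp
  | RMul rexp rexp
  | RDiv rexp rexp

datatype bexp =
    ILess iexp iexp
  | RLess rexp rexp
  | BNot bexp
  | BAnd bexp bexp

datatype com =
    Skip
  | IAssign string iexp iexp
  | RAssign string iexp rexp
  | Sample string iexp
  | Seq com com
  | Cond bexp com com
  | While bexp com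

record state =
  ints :: "string \<Rightarrow> nat \<Rightarrow> nat"
  reals :: "string \<Rightarrow> nat \<Rightarrow> real"
  rands :: tape  \<comment> \<open>the part of the random tape not yet consumed\<close>

fun ival :: "iexp \<Rightarrow> state \<Rightarrow> nat" where
  "ival (INum n) st = n"
| "ival (ICell x e) st = ints st x (ival e st)"
| "ival (ISuc e) st = Suc (ival e st)"

fun rval :: "rexp \<Rightarrow> state \<Rightarrow> real" where
  "rval (RNum q) st = of_rat q"
| "rval (RCell x e) st = reals st x (ival e st)"
| "rval (RAdd e f) st = rval e st + rval f st"
| "rval (RSub e f) st = rval e st - rval f st"
| "rval (RMul e f) st = rval e st * rval f st"
| "rval (RDiv e f) st = rval e st / rval f st"

fun bval :: "bexp \<Rightarrow> state \<Rightarrow> bool" where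
  "bval (ILess e f) st \<longleftrightarrow> ival e st < ival f st"
| "bval (RLess e f) st \<longleftrightarrow> rval e st < rval f st"
| "bval (BNot b) st \<longleftrightarrow> \<not> bval b st"
| "bval (BAnd b c) st \<longleftrightarrow> bval b st \<and> bval c st"

definition set_cell :: "(string \<Rightarrow> nat \<Rightarrow> 'a) \<Rightarrow> string \<Rightarrow> nat \<Rightarrow> 'a \<Rightarrow> string \<Rightarrow> nat \<Rightarrow> 'a" where
  "set_cell f x k v = f(x := (f x)(k := v))"

text \<open>\<open>exec c st t st'\<close>: started in \<open>st\<close>, \<open>c\<close> halts in \<open>st'\<close> after exactly \<open>t\<close> steps.\<close>

inductive exec :: "com \<Rightarrow> state \<Rightarrow> nat \<Rightarrow> state \<Rightarrow> bool" where
  Skip: "exec Skip st 1 st"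
| IAssign: "exec (IAssign x k e) st 1
     (st\<lparr>ints := set_cell (ints st) x (ival k st) (ival e st)\<rparr>)"
| RAssign: "exec (RAssign x k e) st 1
     (st\<lparr>reals := set_cell (reals st) x (ival k st) (rval e st)\<rparr>)"
| Sample: "exec (Sample x k) st 1
     (st\<lparr>reals := set_cell (reals st) x (ival k st) (rands st 0),
         rands := (\<lambda>l. rands st (Suc l))\<rparr>)"
| Seq: "exec c st t st' \<Longrightarrow> exec d st' u st'' \<Longrightarrow> exec (Seq c d) st (t + u) st''"
| CondTrue: "bval b st \<Longrightarrow> exec c st t st' \<Longrightarrow> exec (Cond b c d) st (Suc t) st'"
| CondFalse: "\<not> bval b st \<Longrightarrow> exec d st t st' \<Longrightarrow> exec (Cond b c d) st (Suc t) st'"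
| WhileFalse: "\<not> bval b st \<Longrightarrow> exec (While b c) st 1 st"
| WhileTrue: "bval b st \<Longrightarrow> exec c st t st' \<Longrightarrow> exec (While b c) st' u st'' \<Longrightarrow>
     exec (While b c) st (Suc (t + u)) st''"

text \<open>
  On input, the arrays \<open>s\<close>, \<open>p\<close>, \<open>a\<close> hold speeds, sizes and machines, the cells 0 of \<open>m\<close>, \<open>n\<close>
  hold the numbers of machines and jobs, and everything else is 0.
\<close>

definition input :: "real list \<Rightarrow> real list \<Rightarrow> nat list \<Rightarrow> tape \<Rightarrow> state" where
  "input s ps a \<omega> =
     \<lparr>ints = (\<lambda>x k. if x = ''m'' \<and> k = 0 then length s
                   else if x = ''n'' \<and> k = 0 then length ps
                   else if x = ''a'' \<and> k < length a then a ! k else 0),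
      reals = (\<lambda>x k. if x = ''s'' \<and> k < length s then s ! k
                    else if x = ''p'' \<and> k < length ps then ps ! k else 0),
      rands = \<omega>\<rparr>"

text \<open>
  The size of an input is the number of machines and jobs present, including the job being
  assigned. This job's report is the last entry of the array \<open>p\<close>.
\<close>

definition computes_alloc :: "com \<Rightarrow> mechanism \<Rightarrow> nat poly \<Rightarrow> bool" where
  "computes_alloc c M T \<longleftrightarrow>
     (\<forall>s ps a r \<omega>. history s ps a \<and> r > 0 \<longrightarrow>
        (\<exists>t st. exec c (input s (ps @ [r]) a \<omega>) t st \<and>
                t \<le> poly T (length s + length ps + 1) \<and>
                alloc M s ps a r \<omega> = (ints st ''out'' 0, reals st ''out'' 0)))"

definition computes_pay :: "com \<Rightarrow> mechanism \<Rightarrow> nat poly \<Rightarrow> bool" where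
  "computes_pay c M T \<longleftrightarrow>
     (\<forall>s ps a \<omega>. history s ps a \<longrightarrow>
        (\<exists>t st. exec c (input s ps a \<omega>) t st \<and>
                t \<le> poly T (length s + length ps) \<and>
                (\<forall>i<length s. pay M s ps a \<omega> i = reals st ''out'' i)))"

definition polynomial_time :: "mechanism \<Rightarrow> bool" where
  "polynomial_time M \<longleftrightarrow>
     (\<exists>c T. computes_alloc c M T) \<and> (\<exists>c T. computes_pay c M T)"

end

theory Submission
  imports Defs
begin

text \<open>
  The jobs of size at least \<open>y\<close> can only use machines of speed at least \<open>y / T\<close> in a schedule of
  makespan \<open>T\<close>, so \<open>tail_sum p n y \<le> T * tail_sum s m (y / T)\<close> for all \<open>y > 0\<close> if \<open>T \<ge> OPT\<close>. The least
  such \<open>T\<close> is homogeneous and monotone in sizes and speeds. Job \<open>l\<close> goes to machine \<open>i\<close> with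
  probability proportional to \<open>s\<^sub>i\<close> among the machines with \<open>p\<^sub>l \<le> 2 T\<^sub>l s\<^sub>i\<close>, where \<open>T\<^sub>l\<close> is this bound
  for the jobs up to \<open>l\<close>; earlier assignments are ignored. Homogeneity and monotonicity imply that
  larger jobs get faster machines in expectation and that a faster machine gets a larger expected
  load, so Myerson payments make the mechanism truthful. Their integrals are estimated
  at a uniformly random report. Expected completion times are \<open>O(log m) T\<close>, and as a
  single job takes time at most \<open>2 T\<close> on its machine, Chernoff's bound gives the same order for the makespan.
\<close>

section \<open>A monotone lower bound on the optimal makespan\<close>

text \<open>A job's level is the slowest speed open to it. That \<open>T\<close> is homogeneous
  makes one rule monotone on both sides: a report multiplied by c > 1 multiplies \<open>T\<close> by
  at most c, so the level cannot fall; a speed multiplied by c divides \<open>T\<close> by at most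
  c, so its machine stays eligible, while the level does not fall and competitors can only drop out.
  A rule reacting to loads would let a changed report influence later choices; ignoring them avoids
  this and also makes the draws independent, as the moment bound requires. The factor 2 is the price
  of not knowing the final \<open>T\<close>: it absorbs growth of \<open>T\<close> by a factor below
  2, and what was assigned before that contributes a geometric series. The logarithm comes from
  integrating 1 / W from the largest speed up to the total speed, at most m times as large.
  Myerson's integral runs over costs below the reported one: over the costs above, it would diverge
  for a single machine, whose load is the same for every report. One random evaluation suffices
  because truthfulness is required in expectation only.\<close>

definition tail_sum :: "(nat \<Rightarrow> real) \<Rightarrow> nat \<Rightarrow> real \<Rightarrow> real" where
  "tail_sum f n y = (\<Sum>j<n. if y \<le> f j then f j else 0)"

text \<open>The least \<open>T\<close> satisfying the capacity condition at \<open>y = p q\<close>; it suffices to check these \<open>y\<close>.\<close>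

definition crit :: "(nat \<Rightarrow> real) \<Rightarrow> nat \<Rightarrow> (nat \<Rightarrow> real) \<Rightarrow> nat \<Rightarrow> nat \<Rightarrow> real" where
  "crit s m p n q = Min ((\<lambda>i. max (p q / s i) (tail_sum p n (p q) / tail_sum s m (s i))) ` {..<m})"

text \<open>The inserted 0 is the value for an empty set of jobs.\<close>

definition lower_bound :: "(nat \<Rightarrow> real) \<Rightarrow> nat \<Rightarrow> (nat \<Rightarrow> real) \<Rightarrow> nat \<Rightarrow> real" where
  "lower_bound s m p n = Max (insert 0 (crit s m p n ` {..<n}))"

text \<open>A threshold for speeds: machine \<open>i\<close> is eligible for job \<open>l\<close>
  iff \<open>level s m p l \<le> s i\<close>. The arriving job counts in its own bound, hence
  \<open>Suc l\<close>.\<close>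

definition level :: "(nat \<Rightarrow> real) \<Rightarrow> nat \<Rightarrow> (nat \<Rightarrow> real) \<Rightarrow> nat \<Rightarrow> real" where
  "level s m p l = p l / (2 * lower_bound s m p (Suc l))"

definition share :: "(nat \<Rightarrow> real) \<Rightarrow> nat \<Rightarrow> real \<Rightarrow> nat \<Rightarrow> real" where
  "share s m y i = (if y \<le> s i then s i else 0) / tail_sum s m y"

text \<open>The expected inverse speed under \<open>share\<close>: an eligible machine contributes
  \<open>1 / s i * s i\<close>, so the numerator merely counts them.\<close>

definition mean_inv :: "(nat \<Rightarrow> real) \<Rightarrow> nat \<Rightarrow> real \<Rightarrow> real" where
  "mean_inv s m y = (\<Sum>i<m. if y \<le> s i then 1 else 0) / tail_sum s m y"

text \<open>Speeds and sizes are functions with a separate length, so that a report is varied by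
  function update and an array of a program state can be used directly; entries beyond the length
  are arbitrary.\<close>

definition pos_upto :: "(nat \<Rightarrow> real) \<Rightarrow> nat \<Rightarrow> bool" where
  "pos_upto f n \<longleftrightarrow> (\<forall>j<n. 0 < f j)"

section \<open>Dependence on the entries below the length only\<close>

lemma tail_sum_cong: "(\<And>j. j < n \<Longrightarrow> f j = g j) \<Longrightarrow> tail_sum f n y = tail_sum g n y"
  unfolding tail_sum_def by (rule sum.cong) auto

lemma crit_cong:
  assumes "\<And>i. i < m \<Longrightarrow> s i = s' i" "\<And>j. j < n \<Longrightarrow> p j = p' j" "q < n"
  shows "crit s m p n q = crit s' m p' n q"
proof -
  have "tail_sum s m = tail_sum s' m" "tail_sum p n = tail_sum p' n"
    using assms by (auto intro!: ext tail_sum_cong)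
  then show ?thesis unfolding crit_def using assms
    by (intro arg_cong[where f = Min] image_cong) auto
qed

lemma lower_bound_cong:
  assumes "\<And>i. i < m \<Longrightarrow> s i = s' i" "\<And>j. j < n \<Longrightarrow> p j = p' j"
  shows "lower_bound s m p n = lower_bound s' m p' n"
proof -
  have "crit s m p n ` {..<n} = crit s' m p' n ` {..<n}"
    using crit_cong[of m s s' n p p'] assms by (intro image_cong) auto
  then show ?thesis by (simp add: lower_bound_def)
qed

lemma level_cong:
  assumes "\<And>i. i < m \<Longrightarrow> s i = s' i" "\<And>j. j \<le> l \<Longrightarrow> p j = p' j"
  shows "level s m p l = level s' m p' l"
  using lower_bound_cong[of m s s' "Suc l" p p'] assms by (simp add: level_def less_Suc_eq_le)

lemma share_cong:
  assumes "\<And>i. i < m \<Longrightarrow> s i = s' i" "i < m"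
  shows "share s m y i = share s' m y i"
  using tail_sum_cong[of m s s' y] assms by (simp add: share_def)

section \<open>Elementary bounds for tail sums\<close>

lemma tail_sum_nonneg: "pos_upto f n \<Longrightarrow> 0 \<le> tail_sum f n y"
  unfolding tail_sum_def pos_upto_def by (intro sum_nonneg) (auto simp: less_imp_le)

lemma tail_sum_pos: "pos_upto f n \<Longrightarrow> i < n \<Longrightarrow> y \<le> f i \<Longrightarrow> 0 < tail_sum f n y"
  unfolding tail_sum_def pos_upto_def by (intro sum_pos2[of _ i]) (auto simp: less_imp_le)

lemma tail_sum_ge: "pos_upto f n \<Longrightarrow> i < n \<Longrightarrow> y \<le> f i \<Longrightarrow> f i \<le> tail_sum f n y"
  unfolding tail_sum_def pos_upto_def
  using member_le_sum[of i "{..<n}" "\<lambda>j. if y \<le> f j then f j else 0"] by (auto simp: less_imp_le)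

lemma tail_sum_posD:
  assumes "0 < tail_sum f n y" obtains i where "i < n" "y \<le> f i"
proof -
  have "\<not> (\<forall>i<n. \<not> y \<le> f i)"
  proof
    assume "\<forall>i<n. \<not> y \<le> f i"
    then have "tail_sum f n y = 0" unfolding tail_sum_def by (intro sum.neutral) auto
    with assms show False by simp
  qed
  then show ?thesis using that by blast
qed

lemma tail_sum_antimono: "pos_upto f n \<Longrightarrow> y \<le> z \<Longrightarrow> tail_sum f n z \<le> tail_sum f n y"
  unfolding tail_sum_def pos_upto_def by (intro sum_mono) (auto simp: less_imp_le)

text \<open>An index with \<open>y \<le> f j\<close> has \<open>y / c \<le> g j\<close>, so it is
  counted on the right as well. Both scaling lemmas for \<open>lower_bound\<close> rest on
  this.\<close>

lemma tail_sum_mono_scale: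
  assumes "pos_upto g n" "\<And>j. j < n \<Longrightarrow> f j \<le> c * g j" "0 < c"
  shows "tail_sum f n y \<le> c * tail_sum g n (y / c)"
  unfolding tail_sum_def sum_distrib_left
  using assms by (intro sum_mono) (force simp: pos_upto_def divide_simps mult.commute less_imp_le)

lemma tail_sum_prefix: "pos_upto f n \<Longrightarrow> k \<le> n \<Longrightarrow> tail_sum f k y \<le> tail_sum f n y"
  unfolding tail_sum_def pos_upto_def by (intro sum_mono2) (auto simp: less_imp_le)

lemma tail_sum_le_total:
  assumes "pos_upto f n" "\<And>i. i < n \<Longrightarrow> f i \<le> c"
  shows "tail_sum f n y \<le> real n * c"
proof -
  have "0 \<le> c" if "i < n" for i
    using assms that by (force simp: pos_upto_def intro: order_trans less_imp_le)
  then have "tail_sum f n y \<le> (\<Sum>j<n. c)"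
    unfolding tail_sum_def using assms(2) by (intro sum_mono) auto
  then show ?thesis by simp
qed

section \<open>Characterization and scaling of the lower bound\<close>

text \<open>Tail sums are step functions of \<open>y\<close>, jumping only at job sizes on the left
  and at scaled speeds on the right, so the condition for all \<open>y\<close> reduces to finitely
  many pairs of a job and a machine. Later arguments use only the right-hand side, the programs only
  the finite formula.\<close>

lemma lower_bound_le_iff:
  assumes "0 < m" "pos_upto s m" "pos_upto p n" "0 < t"
  shows "lower_bound s m p n \<le> t \<longleftrightarrow> (\<forall>y>0. tail_sum p n y \<le> t * tail_sum s m (y / t))"
proof -
  have crit_le: "crit s m p n q \<le> t \<longleftrightarrow>
      (\<exists>i<m. p q \<le> t * s i \<and> tail_sum p n (p q) \<le> t * tail_sum s m (s i))" for q
  proof -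
    have "crit s m p n q \<le> t \<longleftrightarrow> (\<exists>i<m. p q / s i \<le> t \<and> tail_sum p n (p q) / tail_sum s m (s i) \<le> t)"
      unfolding crit_def using assms(1) by (subst Min_le_iff) auto
    moreover have "p q / s i \<le> t \<longleftrightarrow> p q \<le> t * s i" if "i < m" for i
      using assms(2) that by (simp add: pos_upto_def pos_divide_le_eq)
    moreover have "tail_sum p n (p q) / tail_sum s m (s i) \<le> t \<longleftrightarrow> tail_sum p n (p q) \<le> t * tail_sum s m (s i)" if "i < m" for i
      using tail_sum_pos[OF assms(2) that order_refl] by (simp add: pos_divide_le_eq)
    ultimately show ?thesis by auto
  qed
  have LB: "lower_bound s m p n \<le> t \<longleftrightarrow> (\<forall>q<n. crit s m p n q \<le> t)"
    unfolding lower_bound_def using assms(4) by (subst Max_le_iff) auto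
  show ?thesis unfolding LB crit_le
  proof (intro iffI allI impI)
    fix y :: real
    assume A: "\<forall>q<n. \<exists>i<m. p q \<le> t * s i \<and> tail_sum p n (p q) \<le> t * tail_sum s m (s i)" and y: "0 < y"
    show "tail_sum p n y \<le> t * tail_sum s m (y / t)"
    proof (cases "{q. q < n \<and> y \<le> p q} = {}")
      case True
      then have "tail_sum p n y = 0" unfolding tail_sum_def by (intro sum.neutral) auto
      then show ?thesis using tail_sum_nonneg[OF assms(2)] assms(4) by simp
    next
      case False
      \<comment> \<open>Raising \<open>y\<close> to the smallest job size that is at least
        \<open>y\<close> leaves the left-hand tail sum unchanged.\<close>
      then obtain q where "is_arg_min p (\<lambda>q. q \<in> {q. q < n \<and> y \<le> p q}) q"
        using ex_is_arg_min_if_finite[of "{q. q < n \<and> y \<le> p q}" p] by auto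
      then have q: "q < n" "y \<le> p q" "\<And>j. j < n \<Longrightarrow> y \<le> p j \<Longrightarrow> p q \<le> p j"
        by (auto simp: is_arg_min_linorder)
      then obtain i where i: "i < m" "p q \<le> t * s i" "tail_sum p n (p q) \<le> t * tail_sum s m (s i)"
        using A by blast
      have "tail_sum p n y = tail_sum p n (p q)"
        unfolding tail_sum_def using q by (intro sum.cong) (auto intro: order_trans)
      also have "\<dots> \<le> t * tail_sum s m (s i)" by (fact i(3))
      also have "\<dots> \<le> t * tail_sum s m (y / t)"
        using assms(4) i(2) q(2)
        by (intro mult_left_mono tail_sum_antimono[OF assms(2)]) (auto simp: pos_divide_le_eq mult.commute)
      finally show ?thesis .
    qed
  next
    fix q assume A: "\<forall>y>0. tail_sum p n y \<le> t * tail_sum s m (y / t)" and q: "q < n"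
    have pq: "0 < p q" using assms(3) q by (simp add: pos_upto_def)
    have "0 < tail_sum p n (p q)" using tail_sum_pos[OF assms(3) q] by simp
    also have "\<dots> \<le> t * tail_sum s m (p q / t)" using A pq by blast
    finally have "0 < tail_sum s m (p q / t)" using assms(4) by (simp add: zero_less_mult_iff)
    then have ne: "{i. i < m \<and> p q / t \<le> s i} \<noteq> {}" by (auto elim!: tail_sum_posD)
    \<comment> \<open>The slowest machine that can finish job \<open>q\<close> within
      \<open>t\<close>: the tail of the speeds at \<open>p q / t\<close> starts exactly
      there.\<close>
    then obtain i where "is_arg_min s (\<lambda>i. i \<in> {i. i < m \<and> p q / t \<le> s i}) i"
      using ex_is_arg_min_if_finite[of "{i. i < m \<and> p q / t \<le> s i}" s] by auto
    then have i: "i < m" "p q / t \<le> s i" "\<And>j. j < m \<Longrightarrow> p q / t \<le> s j \<Longrightarrow> s i \<le> s j"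
      by (auto simp: is_arg_min_linorder)
    have "tail_sum s m (p q / t) = tail_sum s m (s i)"
      unfolding tail_sum_def using i by (intro sum.cong) (auto intro: order_trans)
    then show "\<exists>i<m. p q \<le> t * s i \<and> tail_sum p n (p q) \<le> t * tail_sum s m (s i)"
      using A pq i assms(4) by (intro exI[of _ i]) (auto simp: pos_divide_le_eq mult.commute)
  qed
qed

lemma lower_bound_pos:
  assumes "0 < m" "pos_upto s m" "pos_upto p n" "0 < n"
  shows "0 < lower_bound s m p n"
proof -
  have "0 < p 0 / s i" if "i < m" for i using assms that by (simp add: pos_upto_def)
  then have "0 < crit s m p n 0"
    unfolding crit_def using assms(1) by (subst Min_gr_iff) (auto simp: less_max_iff_disj)
  also have "\<dots> \<le> lower_bound s m p n"
    unfolding lower_bound_def using assms(4) by (intro Max_ge) auto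
  finally show ?thesis .
qed

lemma lower_bound_feasible:
  assumes "0 < m" "pos_upto s m" "pos_upto p n" "0 < n" "0 < y"
  shows "tail_sum p n y \<le> lower_bound s m p n * tail_sum s m (y / lower_bound s m p n)"
  using lower_bound_le_iff[OF assms(1-3) lower_bound_pos[OF assms(1-4)]] assms(5) by blast

lemma lower_bound_scale_jobs:
  assumes "0 < m" "pos_upto s m" "pos_upto p n" "pos_upto p' n" "0 < n" "0 < c"
    and "\<And>j. j < n \<Longrightarrow> p j \<le> c * p' j"
  shows "lower_bound s m p n \<le> c * lower_bound s m p' n"
proof -
  let ?T = "lower_bound s m p' n"
  have T: "0 < ?T" by (rule lower_bound_pos[OF assms(1,2,4,5)])
  have "tail_sum p n y \<le> c * ?T * tail_sum s m (y / (c * ?T))" if "0 < y" for y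
  proof -
    have "tail_sum p n y \<le> c * tail_sum p' n (y / c)" by (rule tail_sum_mono_scale[OF assms(4,7,6)])
    also have "\<dots> \<le> c * (?T * tail_sum s m (y / c / ?T))"
      using lower_bound_feasible[OF assms(1,2,4,5), of "y / c"] that assms(6)
      by (intro mult_left_mono) auto
    finally show ?thesis by (simp add: mult.assoc)
  qed
  then show ?thesis using lower_bound_le_iff[OF assms(1-3), of "c * ?T"] T assms(6) by simp
qed

text \<open>Used twice when one speed rises from \<open>s i\<close> to \<open>v\<close>: with c = 1
  the bound cannot increase, with c = \<open>v / s i\<close> it cannot shrink by more than that
  factor.\<close>

lemma lower_bound_scale_speeds:
  assumes "0 < m" "pos_upto s m" "pos_upto s' m" "pos_upto p n" "0 < n" "0 < c"
    and "\<And>i. i < m \<Longrightarrow> s' i \<le> c * s i"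
  shows "lower_bound s m p n \<le> c * lower_bound s' m p n"
proof -
  let ?T = "lower_bound s' m p n"
  have T: "0 < ?T" by (rule lower_bound_pos[OF assms(1,3,4,5)])
  have "tail_sum p n y \<le> c * ?T * tail_sum s m (y / (c * ?T))" if "0 < y" for y
  proof -
    have "tail_sum p n y \<le> ?T * tail_sum s' m (y / ?T)" by (rule lower_bound_feasible[OF assms(1,3,4,5) that])
    also have "\<dots> \<le> ?T * (c * tail_sum s m (y / ?T / c))"
      using T by (intro mult_left_mono tail_sum_mono_scale[OF assms(2,7,6)]) auto
    finally show ?thesis by (simp add: mult.assoc mult.left_commute mult.commute)
  qed
  then show ?thesis using lower_bound_le_iff[OF assms(1,2,4), of "c * ?T"] T assms(6) by simp
qed

lemma lower_bound_prefix:
  assumes "0 < m" "pos_upto s m" "pos_upto p n" "k \<le> n" "0 < n"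
  shows "lower_bound s m p k \<le> lower_bound s m p n"
proof -
  let ?T = "lower_bound s m p n"
  have T: "0 < ?T" by (rule lower_bound_pos[OF assms(1,2,3,5)])
  have "pos_upto p k" using assms(3,4) by (simp add: pos_upto_def)
  moreover have "tail_sum p k y \<le> ?T * tail_sum s m (y / ?T)" if "0 < y" for y
    using lower_bound_feasible[OF assms(1,2,3,5) that] tail_sum_prefix[OF assms(3,4), of y] by linarith
  ultimately show ?thesis using lower_bound_le_iff[OF assms(1,2)] T by blast
qed

section \<open>Monotonicity of levels and shares\<close>

lemma level_pos:
  assumes "0 < m" "pos_upto s m" "pos_upto p (Suc l)"
  shows "0 < level s m p l"
  using lower_bound_pos[OF assms] assms(3) by (simp add: level_def pos_upto_def)

text \<open>The capacity condition at \<open>p l\<close>: job \<open>l\<close> itself makes the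
  left-hand side positive, so some machine has speed at least \<open>p l / T\<close>, even twice the
  level.\<close>

lemma eligible_exists:
  assumes "0 < m" "pos_upto s m" "pos_upto p (Suc l)"
  obtains i where "i < m" "level s m p l \<le> s i"
proof -
  let ?T = "lower_bound s m p (Suc l)"
  have T: "0 < ?T" by (rule lower_bound_pos[OF assms]) simp
  have pl: "0 < p l" using assms(3) by (simp add: pos_upto_def)
  have "0 < tail_sum p (Suc l) (p l)" using tail_sum_pos[OF assms(3), of l] by simp
  also have "\<dots> \<le> ?T * tail_sum s m (p l / ?T)" by (rule lower_bound_feasible[OF assms _ pl]) simp
  finally have "0 < tail_sum s m (p l / ?T)" using T by (simp add: zero_less_mult_iff)
  then obtain i where i: "i < m" "p l / ?T \<le> s i" by (rule tail_sum_posD)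
  moreover have "level s m p l \<le> p l / ?T"
    using T pl by (simp add: level_def field_simps)
  ultimately show ?thesis using that by auto
qed

lemma tail_sum_level_pos:
  assumes "0 < m" "pos_upto s m" "pos_upto p (Suc l)"
  shows "0 < tail_sum s m (level s m p l)"
  using eligible_exists[OF assms] tail_sum_pos[OF assms(2)] by metis

lemma share_nonneg: "pos_upto s m \<Longrightarrow> i < m \<Longrightarrow> 0 \<le> share s m y i"
  unfolding share_def using tail_sum_nonneg[of s m y] by (auto simp: pos_upto_def less_imp_le)

lemma share_le_1: "pos_upto s m \<Longrightarrow> i < m \<Longrightarrow> share s m y i \<le> 1"
  unfolding share_def using tail_sum_ge[of s m i y] tail_sum_nonneg[of s m y]
  by (auto simp: divide_le_eq_1)

text \<open>Raising the level removes the slowest machines and so raises the average speed.\<close>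

lemma mean_inv_antimono:
  assumes "pos_upto s m" "y \<le> z" "0 < z" "0 < tail_sum s m z"
  shows "mean_inv s m z \<le> mean_inv s m y"
proof -
  define E where "E = {i. i < m \<and> z \<le> s i}"
  define D where "D = {i. i < m \<and> y \<le> s i \<and> s i < z}"
  have fin: "finite E" "finite D" "E \<inter> D = {}" by (auto simp: E_def D_def)
  have ED: "{i \<in> {..<m}. y \<le> s i} = E \<union> D" "{i \<in> {..<m}. z \<le> s i} = E"
    using assms(2) by (auto simp: E_def D_def)
  have bz: "tail_sum s m z = sum s E" and bY: "tail_sum s m y = sum s E + sum s D"
    unfolding tail_sum_def sum.inter_filter[OF finite_lessThan, symmetric] ED
    using fin by (simp_all add: sum.union_disjoint)
  have cz: "(\<Sum>i<m. if z \<le> s i then 1 else 0 :: real) = card E"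
    and cy: "(\<Sum>i<m. if y \<le> s i then 1 else 0 :: real) = card E + card D"
    unfolding sum.inter_filter[OF finite_lessThan, symmetric] ED
    using fin by (simp_all add: card_Un_disjoint)
  have 1: "sum s D \<le> z * card D"
    using sum_bounded_above[of D s z] by (auto simp: D_def less_imp_le mult.commute)
  have 2: "z * card E \<le> sum s E"
    using sum_bounded_below[of E z s] by (auto simp: E_def mult.commute)
  have "card E * sum s D \<le> card E * (z * card D)" using 1 by (intro mult_left_mono) auto
  also have "\<dots> = card D * (z * card E)" by simp
  also have "\<dots> \<le> card D * sum s E" using 2 by (intro mult_left_mono) auto
  finally have "card E * (sum s E + sum s D) \<le> (card E + card D) * sum s E"
    by (simp add: algebra_simps)
  moreover have "0 < sum s E" "0 < sum s E + sum s D"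
    using assms(4) tail_sum_antimono[OF assms(1,2)] bz bY by linarith+
  ultimately show ?thesis
    unfolding mean_inv_def bz bY cz cy by (simp add: frac_le_eq divide_simps)
qed

lemma mean_inv_nonneg: "pos_upto s m \<Longrightarrow> 0 \<le> mean_inv s m y"
  unfolding mean_inv_def by (intro divide_nonneg_nonneg sum_nonneg tail_sum_nonneg) auto

lemma mean_inv_le:
  assumes "pos_upto s m" "0 < c" "\<And>i. i < m \<Longrightarrow> c \<le> s i" "0 < tail_sum s m y"
  shows "mean_inv s m y \<le> 1 / c"
proof -
  have "c * (\<Sum>i<m. if y \<le> s i then 1 else 0) \<le> tail_sum s m y"
    unfolding tail_sum_def sum_distrib_left using assms by (intro sum_mono) auto
  then show ?thesis using assms(2,4) by (simp add: mean_inv_def divide_simps mult.commute)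
qed

text \<open>The numerator of the level grows by exactly \<open>x' / x\<close>, the bound in the
  denominator by at most that factor, because no size grows by more.\<close>

lemma level_mono_report:
  assumes "0 < m" "pos_upto s m" "pos_upto p l" "0 < x" "x \<le> x'"
  shows "level s m (p(l := x)) l \<le> level s m (p(l := x')) l"
proof -
  let ?p = "p(l := x)" and ?p' = "p(l := x')"
  have pos: "pos_upto ?p (Suc l)" "pos_upto ?p' (Suc l)"
    using assms by (auto simp: pos_upto_def less_Suc_eq)
  have "?p' j \<le> (x' / x) * ?p j" if "j < Suc l" for j
  proof (cases "j = l")
    case False
    then have "0 < p j" using assms(3) that by (simp add: pos_upto_def)
    moreover have "1 \<le> x' / x" using assms by simp
    ultimately show ?thesis using False mult_right_mono[of 1 "x' / x" "p j"] by simp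
  qed (use assms in simp)
  then have "lower_bound s m ?p' (Suc l) \<le> (x' / x) * lower_bound s m ?p (Suc l)"
    using assms by (intro lower_bound_scale_jobs[OF assms(1,2) pos(2,1)]) auto
  moreover have "0 < lower_bound s m ?p (Suc l)" "0 < lower_bound s m ?p' (Suc l)"
    using lower_bound_pos[OF assms(1,2)] pos by auto
  ultimately show ?thesis
    using assms by (simp add: level_def divide_simps mult.commute)
qed

text \<open>The share is \<open>s i / (s i + R)\<close>, where \<open>R\<close> is the speed of the
  eligible competitors. The own speed grows, and \<open>R\<close> cannot grow because the level does
  not fall. What needs care is that machine \<open>i\<close> stays eligible although the level may
  rise.\<close>

lemma share_mono_speed:
  assumes "0 < m" "pos_upto s m" "pos_upto p (Suc l)" "i < m" "s i \<le> v"
  shows "share s m (level s m p l) i \<le> share (s(i := v)) m (level (s(i := v)) m p l) i"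
proof -
  let ?s = "s(i := v)"
  let ?T = "lower_bound s m p (Suc l)" and ?T' = "lower_bound ?s m p (Suc l)"
  let ?y = "level s m p l" and ?z = "level ?s m p l"
  have si: "0 < s i" and v: "0 < v" using assms(2,4,5) by (auto simp: pos_upto_def intro: less_le_trans)
  have pos': "pos_upto ?s m" using assms(2) v by (simp add: pos_upto_def)
  have pl: "0 < p l" using assms(3) by (simp add: pos_upto_def)
  have T: "0 < ?T" "0 < ?T'" using lower_bound_pos assms pos' by auto
  have "?T' \<le> 1 * ?T"
    using assms(5) by (intro lower_bound_scale_speeds[OF assms(1) pos' assms(2,3)]) auto
  then have yz: "?y \<le> ?z" using T pl by (simp add: level_def frac_le)
  have "?s j \<le> (v / s i) * s j" if "j < m" for j
  proof (cases "j = i")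
    case False
    then have "0 < s j" using assms(2) that by (simp add: pos_upto_def)
    moreover have "1 \<le> v / s i" using assms(5) si by simp
    ultimately show ?thesis using False mult_right_mono[of 1 "v / s i" "s j"] by simp
  qed (use si in simp)
  then have "?T \<le> (v / s i) * ?T'"
    using v si by (intro lower_bound_scale_speeds[OF assms(1,2) pos' assms(3)]) auto
  \<comment> \<open>Eligibility reads \<open>p l \<le> 2 * (s i * T)\<close>; this product does not
    decrease.\<close>
  then have sT: "s i * ?T \<le> v * ?T'" using si by (simp add: divide_simps mult.commute)
  show ?thesis
  proof (cases "?y \<le> s i")
    case False
    then show ?thesis using share_nonneg[OF pos' assms(4)] by (simp add: share_def)
  next
    case True
    then have "p l \<le> 2 * (s i * ?T)" using T by (simp add: level_def divide_simps mult_ac)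
    then have "p l \<le> 2 * (v * ?T')" using sT by linarith
    then have True': "?z \<le> v" using T by (simp add: level_def divide_simps mult_ac)
    define R where "R = (\<Sum>j\<in>{..<m} - {i}. if ?y \<le> s j then s j else 0)"
    define R' where "R' = (\<Sum>j\<in>{..<m} - {i}. if ?z \<le> s j then s j else 0)"
    have B: "tail_sum s m ?y = s i + R"
      unfolding tail_sum_def R_def using assms(4) True by (subst sum.remove[of _ i]) auto
    have "tail_sum ?s m ?z = v + (\<Sum>j\<in>{..<m} - {i}. if ?z \<le> ?s j then ?s j else 0)"
      unfolding tail_sum_def using assms(4) True' by (subst sum.remove[of _ i]) auto
    also have "(\<Sum>j\<in>{..<m} - {i}. if ?z \<le> ?s j then ?s j else 0) = R'"
      unfolding R'_def by (intro sum.cong) auto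
    finally have B': "tail_sum ?s m ?z = v + R'" .
    have "R' \<le> R" unfolding R_def R'_def
      using yz assms(2) by (intro sum_mono) (auto simp: pos_upto_def less_imp_le)
    moreover have "0 \<le> R'" unfolding R'_def
      using assms(2) by (intro sum_nonneg) (auto simp: pos_upto_def less_imp_le)
    ultimately have "s i * (v + R') \<le> v * (s i + R)"
      using mult_mono[of "s i" v R' R] assms(5) si v by (simp add: algebra_simps)
    moreover have "0 < s i + R" "0 < v + R'" using \<open>R' \<le> R\<close> \<open>0 \<le> R'\<close> si v by auto
    ultimately show ?thesis
      unfolding share_def B B' using True True' by (simp add: frac_le_eq divide_simps)
  qed
qed

section \<open>Expected completion times\<close>

text \<open>The summands dominate the increments of \<open>W \<mapsto> 1 + ln (W / c)\<close>, continued linearly below \<open>c\<close>.\<close>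

lemma sum_div_prefix_le:
  fixes w D :: "'a \<Rightarrow> real"
  assumes "finite J" "0 < c" "0 < t" "\<And>j. j \<in> J \<Longrightarrow> 0 < w j"
    and "\<And>j. j \<in> J \<Longrightarrow> c \<le> D j" "\<And>j. j \<in> J \<Longrightarrow> (\<Sum>k | k \<in> J \<and> w j \<le> w k. w k) \<le> t * D j"
  shows "(\<Sum>j\<in>J. w j / D j) \<le>
    (let W = sum w J / t in if W \<le> c then t * (W / c) else t * (1 + ln (W / c)))"
  using assms(1,4-6)
\<comment> \<open>Elements enter in order of decreasing weight: the new one is the smallest, so its
  capacity hypothesis bounds the whole current sum.\<close>
proof (induction J rule: finite_ranking_induct[where f = "\<lambda>j. - w j"])
  case empty
  then show ?case using assms by simp
next
  case (insert x J)
  show ?case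
  proof (cases "x \<in> J")
    case True
    then show ?thesis using insert.IH insert.prems by (simp add: insert_absorb)
  next
    case False
    define W where "W = sum w J / t"
    define W' where "W' = sum w (insert x J) / t"
    have W': "W' = W + w x / t"
      using False insert.hyps(1) by (simp add: W_def W'_def add_divide_distrib add.commute)
    have wx: "0 < w x" using insert.prems(1) by simp
    have W0: "0 \<le> W" unfolding W_def using insert.prems(1) assms(3)
      by (intro divide_nonneg_pos sum_nonneg) (auto simp: less_imp_le)
    have "{k. k \<in> insert x J \<and> w x \<le> w k} = insert x J" using insert.hyps(2) by auto
    then have "sum w (insert x J) \<le> t * D x" using insert.prems(3)[of x] by simp
    then have "W' \<le> D x" using assms(3) by (simp add: W'_def divide_simps mult.commute)
    then have Dx: "max c W' \<le> D x" using insert.prems(2) by simp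
    have IH: "(\<Sum>j\<in>J. w j / D j) \<le> (if W \<le> c then t * (W / c) else t * (1 + ln (W / c)))"
    proof -
      have "(\<Sum>k | k \<in> J \<and> w j \<le> w k. w k) \<le> t * D j" if "j \<in> J" for j
      proof -
        have "(\<Sum>k | k \<in> J \<and> w j \<le> w k. w k) \<le> (\<Sum>k | k \<in> insert x J \<and> w j \<le> w k. w k)"
          using insert.hyps(1) insert.prems(1) by (intro sum_mono2) (auto simp: less_imp_le)
        then show ?thesis using insert.prems(3)[of j] that by force
      qed
      then show ?thesis unfolding W_def using insert.prems
        by (intro insert.IH[unfolded Let_def]) auto
    qed
    have "w x / D x \<le> w x / max c W'"
      using Dx wx assms(2) by (intro divide_left_mono) auto
    also have "w x / max c W' = t * (W' - W) / max c W'" using W' assms(3) by simp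
    also have "\<dots> \<le>
      t * (if W' \<le> c then W' / c else 1 + ln (W' / c)) - t * (if W \<le> c then W / c else 1 + ln (W / c))"
    proof -
      have ln: "1 - b / a \<le> ln (a / b)" if "0 < a" "0 < b" for a b :: real
      proof -
        have "ln (b / a) \<le> b / a - 1" using that by (intro ln_le_minus_one) simp
        moreover have "ln (b / a) = - ln (a / b)" using that by (simp add: ln_div)
        ultimately show ?thesis by simp
      qed
      have le: "W \<le> W'" using W' wx assms(3) by simp
      \<comment> \<open>The potential is concave with derivative \<open>1 / max c W\<close>, so its
        increment is at least the step times the derivative at the right end \<open>W'\<close>. The
        cases follow the position of \<open>c\<close>.\<close>
      have "(W' - W) / max c W' \<le> (if W' \<le> c then W' / c else 1 + ln (W' / c)) - (if W \<le> c then W / c else 1 + ln (W / c))"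
      proof -
        consider "W' \<le> c" | "W \<le> c" "c < W'" | "c < W" using le by linarith
        then show ?thesis
        proof cases
          case 1 then show ?thesis using le assms(2) by (simp add: diff_divide_distrib max_def)
        next
          case 2
          have "(W' - W) / max c W' = (W' - c) / W' + (c - W) / W'" using 2 by (simp add: diff_divide_distrib max_def)
          also have "(c - W) / W' \<le> (c - W) / c" using 2 assms(2) by (intro divide_left_mono) auto
          also have "(W' - c) / W' \<le> ln (W' / c)" using ln[of W' c] 2 assms(2) by (simp add: diff_divide_distrib)
          finally show ?thesis using 2 assms(2) by (simp add: diff_divide_distrib)
        next
          case 3
          have "(W' - W) / max c W' = 1 - W / W'" using 3 le assms(2) by (simp add: diff_divide_distrib max_def)
          also have "\<dots> \<le> ln (W' / W)" using ln[of W' W] 3 le assms(2) by simp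
          also have "\<dots> = ln (W' / c) - ln (W / c)" using 3 le assms(2) by (simp add: ln_div)
          finally show ?thesis using 3 le by simp
        qed
      qed
      from mult_left_mono[OF this, of t] show ?thesis using assms(3) by (simp add: right_diff_distrib)
    qed
    finally show ?thesis using IH False insert.hyps(1)
      unfolding W'_def[symmetric] Let_def by (simp split: if_splits)
  qed
qed

text \<open>The preceding lemma with \<open>c\<close> the largest speed: a nonempty tail of the
  machines contains a fastest one, and capacity at the smallest job bounds the total size by
  \<open>t * (m * c)\<close>, so the logarithm is at most \<open>ln m\<close>. The set
  \<open>J\<close> allows to treat only the jobs of one phase.\<close>

lemma sum_div_tail_sum_le:
  assumes "0 < m" "pos_upto s m" "finite J" "\<And>j. j \<in> J \<Longrightarrow> 0 < p j" "0 < t"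
    and cap: "\<And>y. 0 < y \<Longrightarrow> (\<Sum>k | k \<in> J \<and> y \<le> p k. p k) \<le> t * tail_sum s m (y / t)"
  shows "(\<Sum>j\<in>J. p j / tail_sum s m (p j / t)) \<le> t * (1 + ln m)"
proof (cases "J = {}")
  case True
  then show ?thesis using assms(1,5) by simp
next
  case False
  define c where "c = Max (s ` {..<m})"
  have cs: "s i \<le> c" if "i < m" for i using that by (simp add: c_def)
  have "c \<in> s ` {..<m}" unfolding c_def using assms(1) by (intro Max_in) auto
  then obtain i0 where i0: "i0 < m" "c = s i0" by auto
  have c0: "0 < c" using i0 assms(2) by (simp add: pos_upto_def)
  define W where "W = sum p J / t"
  have Dge: "c \<le> tail_sum s m (p j / t)" if j: "j \<in> J" for j
  proof -
    have "0 < (\<Sum>k | k \<in> J \<and> p j \<le> p k. p k)"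
      using assms(3,4) j by (intro sum_pos) auto
    also have "\<dots> \<le> t * tail_sum s m (p j / t)" using cap assms(4) j by simp
    finally have "0 < tail_sum s m (p j / t)" using assms(5) by (simp add: zero_less_mult_iff)
    then obtain i where "i < m" "p j / t \<le> s i" by (rule tail_sum_posD)
    then have "p j / t \<le> s i0" using cs i0 by force
    then show ?thesis using tail_sum_ge[OF assms(2) i0(1)] i0(2) by simp
  qed
  have "(\<Sum>j\<in>J. p j / tail_sum s m (p j / t)) \<le>
      (let W = sum p J / t in if W \<le> c then t * (W / c) else t * (1 + ln (W / c)))"
    using assms c0 Dge by (intro sum_div_prefix_le) auto
  also have "\<dots> \<le> t * (1 + ln m)"
  proof -
    have W0: "0 < W" unfolding W_def using assms False by (intro divide_pos_pos sum_pos) auto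
    have "sum p J = (\<Sum>k | k \<in> J \<and> Min (p ` J) \<le> p k. p k)"
      using assms(3) by (intro sum.cong) auto
    also have "\<dots> \<le> t * tail_sum s m (Min (p ` J) / t)"
      using assms(3,4) False by (intro cap) (simp add: Min_gr_iff)
    also have "\<dots> \<le> t * (m * c)"
      using tail_sum_le_total[OF assms(2) cs] assms(5) by (intro mult_left_mono) auto
    finally have "W / c \<le> m" using c0 assms(5) by (simp add: W_def divide_simps mult_ac)
    then have "ln (W / c) \<le> ln m" using W0 c0 assms(1) by simp
    moreover have "W / c \<le> 1 + ln m" if "W \<le> c"
    proof -
      have "W / c \<le> 1" using that c0 by simp
      also have "\<dots> \<le> 1 + ln m" using assms(1) by simp
      finally show ?thesis .
    qed
    ultimately show ?thesis unfolding W_def[symmetric] Let_def using assms(5)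
      by (simp add: mult_le_cancel_left_pos del: times_divide_eq_right)
  qed
  finally show ?thesis .
qed

text \<open>
  The jobs arriving while the bound is at most half of its final value are handled by induction,
  for the others the factor 2 in \<open>level\<close> allows to replace the current bound by the final one.
\<close>

lemma sum_div_level_le:
  assumes "0 < m" "pos_upto s m" "pos_upto p n"
  shows "(\<Sum>j<n. p j / tail_sum s m (level s m p j)) \<le> 2 * lower_bound s m p n * (1 + ln m)"
  using assms(3)
proof (induction n rule: less_induct)
  case (less n)
  let ?T = "lower_bound s m p"
  have lnm: "0 \<le> 1 + ln (real m)" using assms(1) by (simp add: add_nonneg_nonneg)
  show ?case
  proof (cases "n = 0")
    case True
    then show ?thesis by (simp add: lower_bound_def)
  next
    case False
    then have Tn: "0 < ?T n" using lower_bound_pos[OF assms(1,2) less.prems] by simp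
    \<comment> \<open>The first job whose arrival lifts the bound above half of its final value.
      Before it the bound is at most half, so the induction hypothesis, with its factor 2, costs
      just \<open>?T n * (1 + ln m)\<close>; the later jobs cost the same.\<close>
    define k where "k = (LEAST k. ?T n < 2 * ?T (Suc k))"
    have ex: "?T n < 2 * ?T (Suc (n - 1))" using Tn False by simp
    have k: "?T n < 2 * ?T (Suc k)" unfolding k_def using ex by (rule LeastI)
    have kn: "k < n" using Least_le[of "\<lambda>k. ?T n < 2 * ?T (Suc k)", OF ex] False by (simp add: k_def)
    have posk: "pos_upto p k" using less.prems kn by (simp add: pos_upto_def)
    have Tk: "2 * ?T k \<le> ?T n"
    proof (cases k)
      case 0 then show ?thesis using Tn by (simp add: lower_bound_def)
    next
      case (Suc k')
      then show ?thesis using not_less_Least[of k' "\<lambda>k. ?T n < 2 * ?T (Suc k)"] by (simp add: k_def[symmetric])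
    qed
    have "(\<Sum>j<n. p j / tail_sum s m (level s m p j)) =
        (\<Sum>j<k. p j / tail_sum s m (level s m p j)) + (\<Sum>j\<in>{k..<n}. p j / tail_sum s m (level s m p j))"
      using kn by (simp add: lessThan_atLeast0 sum.atLeastLessThan_concat)
    also have "(\<Sum>j<k. p j / tail_sum s m (level s m p j)) \<le> ?T n * (1 + ln m)"
      using less.IH[OF kn posk] mult_right_mono[OF Tk lnm] by linarith
    also have "(\<Sum>j\<in>{k..<n}. p j / tail_sum s m (level s m p j)) \<le> (\<Sum>j\<in>{k..<n}. p j / tail_sum s m (p j / ?T n))"
    proof (rule sum_mono)
      fix j assume j: "j \<in> {k..<n}"
      have pj: "0 < p j" and posj: "pos_upto p (Suc j)" using less.prems j by (auto simp: pos_upto_def)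
      have "?T (Suc k) \<le> ?T (Suc j)" using lower_bound_prefix[OF assms(1,2) posj] j by simp
      \<comment> \<open>From job \<open>k\<close> on, twice the current bound exceeds the final one,
        so every machine of speed at least \<open>p j / ?T n\<close> is eligible.\<close>
      then have "level s m p j \<le> p j / ?T n"
        unfolding level_def using pj k Tn by (intro divide_left_mono) auto
      then have "tail_sum s m (p j / ?T n) \<le> tail_sum s m (level s m p j)" by (rule tail_sum_antimono[OF assms(2)])
      moreover have "0 < tail_sum s m (p j / ?T n)"
      proof -
        have "0 < tail_sum p n (p j)" using tail_sum_pos[OF less.prems, of j] j by simp
        also have "\<dots> \<le> ?T n * tail_sum s m (p j / ?T n)"
          using lower_bound_feasible[OF assms(1,2) less.prems] False pj by simp
        finally show ?thesis using Tn by (simp add: zero_less_mult_iff)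
      qed
      ultimately show "p j / tail_sum s m (level s m p j) \<le> p j / tail_sum s m (p j / ?T n)"
        using pj by (intro divide_left_mono) auto
    qed
    also have "\<dots> \<le> ?T n * (1 + ln m)"
    proof (rule sum_div_tail_sum_le[OF assms(1,2)])
      fix y :: real assume "0 < y"
      have "(\<Sum>j | j \<in> {k..<n} \<and> y \<le> p j. p j) \<le> (\<Sum>j | j \<in> {..<n} \<and> y \<le> p j. p j)"
        using less.prems by (intro sum_mono2) (auto simp: pos_upto_def less_imp_le)
      also have "\<dots> = tail_sum p n y" unfolding tail_sum_def by (simp add: sum.inter_filter[symmetric])
      also have "\<dots> \<le> ?T n * tail_sum s m (y / ?T n)"
        using lower_bound_feasible[OF assms(1,2) less.prems] False \<open>0 < y\<close> by simp
      finally show "(\<Sum>j | j \<in> {k..<n} \<and> y \<le> p j. p j) \<le> ?T n * tail_sum s m (y / ?T n)" .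
    qed (use less.prems Tn in \<open>auto simp: pos_upto_def\<close>)
    finally show ?thesis by (simp add: algebra_simps)
  qed
qed

section \<open>Random tapes\<close>

abbreviation unif :: "real measure" where
  "unif \<equiv> uniform_measure lborel {0..1}"

lemma unif_eq_density: "unif = density lborel (indicator {0..1})"
  unfolding uniform_measure_def by (intro density_cong) (auto simp: divide_ennreal_def)

interpretation unif: prob_space unif
  by (rule prob_space_uniform_measure) auto

interpretation tape: prob_space tape_space
  unfolding tape_space_def by (rule prob_space_PiM) (rule unif.prob_space_axioms)

interpretation runs: prob_space run_space
  unfolding run_space_def by (rule prob_space_PiM) (rule tape.prob_space_axioms)

lemma measurable_tape_component [measurable]: "(\<lambda>\<omega>. \<omega> k) \<in> tape_space \<rightarrow>\<^sub>M borel"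
proof -
  have "(\<lambda>\<omega>. \<omega> k) \<in> tape_space \<rightarrow>\<^sub>M unif"
    unfolding tape_space_def by (rule measurable_component_singleton) simp
  then show ?thesis by (simp cong: measurable_cong_sets)
qed

lemma measurable_run_component [measurable]: "(\<lambda>\<omega>. \<omega> j) \<in> run_space \<rightarrow>\<^sub>M tape_space"
  unfolding run_space_def by (rule measurable_component_singleton) simp

lemma measurable_unif: "f \<in> borel_measurable unif \<longleftrightarrow> f \<in> borel_measurable borel"
  by (simp cong: measurable_cong_sets)

lemma distr_tape_component: "distr tape_space unif (\<lambda>\<omega>. \<omega> k) = unif"
  unfolding tape_space_def by (rule distr_PiM_component) (auto intro: unif.prob_space_axioms)

lemma distr_run_component: "distr run_space tape_space (\<lambda>\<omega>. \<omega> j) = tape_space"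
  unfolding run_space_def by (rule distr_PiM_component) (auto intro: tape.prob_space_axioms)

lemma
  fixes f :: "real \<Rightarrow> real"
  assumes [measurable]: "f \<in> borel_measurable borel"
  shows integrable_tape_component: "integrable tape_space (\<lambda>\<omega>. f (\<omega> k)) \<longleftrightarrow> integrable unif f"
    and integral_tape_component: "(\<integral>\<omega>. f (\<omega> k) \<partial>tape_space) = integral\<^sup>L unif f"
proof -
  have [measurable]: "(\<lambda>\<omega>. \<omega> k) \<in> tape_space \<rightarrow>\<^sub>M unif" by (simp cong: measurable_cong_sets)
  have f: "f \<in> borel_measurable unif" using assms by (simp add: measurable_unif)
  show "integrable tape_space (\<lambda>\<omega>. f (\<omega> k)) \<longleftrightarrow> integrable unif f"
    using integrable_distr_eq[OF _ f, of "\<lambda>\<omega>. \<omega> k" tape_space] by (simp add: distr_tape_component)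
  show "(\<integral>\<omega>. f (\<omega> k) \<partial>tape_space) = integral\<^sup>L unif f"
    using integral_distr[OF _ f, of "\<lambda>\<omega>. \<omega> k" tape_space] by (simp add: distr_tape_component)
qed

lemma
  fixes f :: "real \<Rightarrow> real"
  assumes [measurable]: "f \<in> borel_measurable borel"
  shows integrable_run_component: "integrable run_space (\<lambda>\<omega>. f (\<omega> j k)) \<longleftrightarrow> integrable unif f"
    and integral_run_component: "(\<integral>\<omega>. f (\<omega> j k) \<partial>run_space) = integral\<^sup>L unif f"
proof -
  have f: "(\<lambda>\<omega>. f (\<omega> k)) \<in> borel_measurable tape_space" by measurable
  show "integrable run_space (\<lambda>\<omega>. f (\<omega> j k)) \<longleftrightarrow> integrable unif f"
    using integrable_distr_eq[OF _ f, of "\<lambda>\<omega>. \<omega> j" run_space] integrable_tape_component[OF assms, of k]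
    by (simp add: distr_run_component)
  show "(\<integral>\<omega>. f (\<omega> j k) \<partial>run_space) = integral\<^sup>L unif f"
    using integral_distr[OF _ f, of "\<lambda>\<omega>. \<omega> j" run_space] integral_tape_component[OF assms, of k]
    by (simp add: distr_run_component)
qed

lemma integral_unif:
  fixes f :: "real \<Rightarrow> real"
  assumes "f \<in> borel_measurable borel"
  shows "integral\<^sup>L unif f = (\<integral>x. indicator {0..1} x * f x \<partial>lborel)"
    and "integrable unif f \<longleftrightarrow> integrable lborel (\<lambda>x. indicator {0..1} x * f x)"
proof -
  have *: "unif = density lborel (\<lambda>x. ennreal (indicator {0..1} x))"
    unfolding unif_eq_density by (intro density_cong) (auto split: split_indicator)
  show "integral\<^sup>L unif f = (\<integral>x. indicator {0..1} x * f x \<partial>lborel)"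
    unfolding * using assms by (subst integral_density) auto
  show "integrable unif f \<longleftrightarrow> integrable lborel (\<lambda>x. indicator {0..1} x * f x)"
    unfolding * using assms by (subst integrable_density) auto
qed

text \<open>Excludes the point 0, where the scaled report would be 0; monotonicity and bounds are
  available for positive reports only.\<close>

lemma AE_unif_pos: "AE u in unif. 0 < u \<and> u \<le> 1"
proof -
  have "AE u in lborel. u \<noteq> (0::real)" by (rule AE_lborel_singleton)
  then show ?thesis by (subst AE_uniform_measure) (auto elim!: eventually_mono)
qed

lemma integrable_unif_bounded:
  fixes f :: "real \<Rightarrow> real"
  assumes "f \<in> borel_measurable borel" "\<And>u. 0 < u \<Longrightarrow> u \<le> 1 \<Longrightarrow> \<bar>f u\<bar> \<le> K"
  shows "integrable unif f"
proof -
  have "AE u in unif. norm (f u) \<le> K"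
    using AE_unif_pos by (rule eventually_mono) (use assms(2) in auto)
  then show ?thesis using assms(1) by (intro unif.integrable_const_bound[of _ K]) (auto simp: measurable_unif)
qed

text \<open>
  If \<open>G b\<close> is the expected time per unit of a private cost, reported as \<open>b\<close>, then
  \<open>(b\<^sub>0 - b) * G b + b * \<integral>G (b * u)\<close> is the total cost under Myerson's payment rule, with the integral
  of \<open>G\<close> from 0 to \<open>b\<close> estimated at a random point \<open>b * u\<close>.
\<close>

lemma myerson:
  fixes G :: "real \<Rightarrow> real"
  assumes G [measurable]: "G \<in> borel_measurable borel"
    and mono: "\<And>x y. 0 < x \<Longrightarrow> x \<le> y \<Longrightarrow> G y \<le> G x"
    and bnd: "\<And>x. 0 < x \<Longrightarrow> \<bar>G x\<bar> \<le> K"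
    and b: "0 < b" "0 < b\<^sub>0"
  shows "b\<^sub>0 * (\<integral>u. G (b\<^sub>0 * u) \<partial>unif) \<le> (b\<^sub>0 - b) * G b + b * (\<integral>u. G (b * u) \<partial>unif)"
    and "integrable unif (\<lambda>u. G (b * u))"
proof -
  have int: "integrable unif (\<lambda>u. G (c * u))" if "0 < c" for c
    using that bnd by (intro integrable_unif_bounded[of _ K]) auto
  show "integrable unif (\<lambda>u. G (b * u))" using int b by simp
  have ind: "indicator {0..c} (c * u) = (indicator {0..1} u :: real)" if "0 < c" for c u :: real
    using that by (auto split: split_indicator simp: zero_le_mult_iff)
  have eq: "c * (\<integral>u. G (c * u) \<partial>unif) = (\<integral>x. indicator {0..c} x * G x \<partial>lborel)" if "0 < c" for c
    using lborel_integral_real_affine[of c "\<lambda>x. indicator {0..c} x * G x" 0] that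
    by (simp add: integral_unif(1) ind)
  have li: "integrable lborel (\<lambda>x. indicator {0..c} x * G x)" if "0 < c" for c
  proof -
    have "integrable lborel (\<lambda>u. indicator {0..1} u * G (c * u))"
      using int[OF that] by (subst (asm) integral_unif(2)) auto
    then show ?thesis
      using lborel_integrable_real_affine_iff[of c "\<lambda>x. indicator {0..c} x * G x" 0] that by (simp add: ind)
  qed
  have li1: "integrable lborel (\<lambda>x. indicator {0..c} x * G b)" for c :: real
    by (intro integrable_mult_left integrable_real_indicator) (auto simp: emeasure_lborel_Icc_eq)
  have "b\<^sub>0 * (\<integral>u. G (b\<^sub>0 * u) \<partial>unif) = (\<integral>x. indicator {0..b\<^sub>0} x * G x \<partial>lborel)"
    using eq b by simp
  \<comment> \<open>Between \<open>b\<close> and \<open>b\<^sub>0\<close> the function is compared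
    with the constant \<open>G b\<close>. Differences of indicators cover both orders of
    \<open>b\<close> and \<open>b\<^sub>0\<close> at once.\<close>
  also have "\<dots> \<le> (\<integral>x. indicator {0..b} x * G x + (indicator {0..b\<^sub>0} x * G b - indicator {0..b} x * G b) \<partial>lborel)"
  proof (rule integral_mono_AE)
    have "AE x in lborel. x \<noteq> (0::real)" by (rule AE_lborel_singleton)
    then show "AE x in lborel. indicator {0..b\<^sub>0} x * G x
        \<le> indicator {0..b} x * G x + (indicator {0..b\<^sub>0} x * G b - indicator {0..b} x * G b)"
      by (rule eventually_mono) (use mono[of _ b] mono[of b] b in \<open>auto split: split_indicator\<close>)
  qed (use li li1 b in auto)
  also have "\<dots> = b * (\<integral>u. G (b * u) \<partial>unif) + (b\<^sub>0 * G b - b * G b)"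
    using li li1 b by (simp add: eq)
  finally show "b\<^sub>0 * (\<integral>u. G (b\<^sub>0 * u) \<partial>unif) \<le> (b\<^sub>0 - b) * G b + b * (\<integral>u. G (b * u) \<partial>unif)"
    by (simp add: algebra_simps)
qed

section \<open>Proportional random choice\<close>

text \<open>Inverse transform sampling: eligible machine \<open>k\<close> owns an interval of length
  \<open>s k\<close> starting at \<open>tail_sum s k y\<close>, and the last interval starting below
  \<open>w\<close> wins. The default 0 makes the result a valid machine for every tape, also where
  \<open>w\<close> is not positive.\<close>

fun pick :: "(nat \<Rightarrow> real) \<Rightarrow> real \<Rightarrow> real \<Rightarrow> nat \<Rightarrow> nat" where
  "pick s y w 0 = 0"
| "pick s y w (Suc k) = (if y \<le> s k \<and> tail_sum s k y < w then k else pick s y w k)"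

definition draw :: "(nat \<Rightarrow> real) \<Rightarrow> nat \<Rightarrow> real \<Rightarrow> real \<Rightarrow> nat" where
  "draw s m y u = pick s y (u * tail_sum s m y) m"

lemma pick_cong: "(\<And>i. i < m \<Longrightarrow> s i = s' i) \<Longrightarrow> pick s y w m = pick s' y w m"
  by (induction m) (simp_all cong: tail_sum_cong)

lemma draw_cong: "(\<And>i. i < m \<Longrightarrow> s i = s' i) \<Longrightarrow> draw s m y u = draw s' m y u"
  unfolding draw_def using pick_cong[of m s s'] tail_sum_cong[of m s s'] by simp

lemma tail_sum_Suc: "tail_sum f (Suc n) y = tail_sum f n y + (if y \<le> f n then f n else 0)"
  by (simp add: tail_sum_def)

lemma pick_less: "0 < k \<Longrightarrow> pick s y w k < k"
  by (induction k) (auto simp: less_Suc_eq)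

lemma draw_less: "0 < m \<Longrightarrow> draw s m y u < m"
  by (simp add: draw_def pick_less)

lemma pick_correct:
  assumes "0 < w" "w \<le> tail_sum s k y"
  shows "tail_sum s (pick s y w k) y < w \<and> w \<le> tail_sum s (Suc (pick s y w k)) y"
  using assms(2)
proof (induction k)
  case 0
  then show ?case using assms(1) by (simp add: tail_sum_def)
next
  case (Suc k)
  then show ?case by (auto simp: tail_sum_Suc split: if_splits)
qed

lemma draw_iff:
  assumes "pos_upto s m" "i < m" "0 < tail_sum s m y" "0 < u" "u \<le> 1"
  shows "draw s m y u = i \<longleftrightarrow> tail_sum s i y < u * tail_sum s m y \<and> u * tail_sum s m y \<le> tail_sum s (Suc i) y"
proof -
  let ?w = "u * tail_sum s m y" and ?c = "draw s m y u"
  have w: "0 < ?w" "?w \<le> tail_sum s m y" using assms mult_right_mono[of u 1 "tail_sum s m y"] by auto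
  have c: "?c < m" "tail_sum s ?c y < ?w" "?w \<le> tail_sum s (Suc ?c) y"
    using pick_correct[OF w] draw_less[of m s y u] assms(2) by (auto simp: draw_def)
  have mono: "tail_sum s a y \<le> tail_sum s b y" if "a \<le> b" "b \<le> m" for a b
    using that assms(1) by (intro tail_sum_prefix) (auto simp: pos_upto_def)
  show ?thesis
  proof
    assume R: "tail_sum s i y < ?w \<and> ?w \<le> tail_sum s (Suc i) y"
    have "\<not> Suc i \<le> ?c" using mono[of "Suc i" ?c] c R by auto
    moreover have "\<not> Suc ?c \<le> i" using mono[of "Suc ?c" i] assms(2) c R by auto
    ultimately show "?c = i" by simp
  qed (use c in auto)
qed

lemma measurable_draw [measurable]: "draw s m y \<in> borel \<rightarrow>\<^sub>M count_space UNIV"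
proof -
  have "(\<lambda>u. pick s y (u * c) k) \<in> borel \<rightarrow>\<^sub>M count_space UNIV" for c k
    by (induction k) simp_all
  then show ?thesis unfolding draw_def[abs_def] .
qed

lemma prob_draw:
  assumes "pos_upto s m" "i < m" "0 < tail_sum s m y"
  shows "measure unif {u. draw s m y u = i} = share s m y i"
proof -
  let ?S = "tail_sum s m y"
  let ?a = "tail_sum s i y / ?S" and ?b = "tail_sum s (Suc i) y / ?S"
  have pos: "pos_upto s i" "pos_upto s (Suc i)" using assms by (auto simp: pos_upto_def)
  have le: "0 \<le> ?a" "?a \<le> ?b" "?b \<le> 1"
    using tail_sum_nonneg[OF pos(1)] tail_sum_prefix[OF pos(2), of i y] tail_sum_prefix[OF assms(1), of "Suc i" y] assms
    by (auto intro!: divide_right_mono)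
  have "AE u in unif. u \<in> {u. draw s m y u = i} \<longleftrightarrow> u \<in> {?a<..?b}"
    using AE_unif_pos
    by (rule eventually_mono) (use draw_iff[OF assms] assms(3) in \<open>auto simp: field_simps\<close>)
  then have "measure unif {u. draw s m y u = i} = measure unif {?a<..?b}"
    by (intro measure_eq_AE) (auto simp: measurable_sets_borel)
  also have "\<dots> = measure lborel ({0..1} \<inter> {?a<..?b})" by (subst measure_uniform_measure) auto
  also have "{0..1} \<inter> {?a<..?b} = {?a<..?b}" using le by auto
  also have "measure lborel {?a<..?b} = ?b - ?a" using le by simp
  also have "\<dots> = share s m y i" by (simp add: share_def tail_sum_Suc add_divide_distrib)
  finally show ?thesis .
qed

lemma integral_draw:
  fixes f :: "nat \<Rightarrow> real"
  assumes "pos_upto s m" "0 < m" "0 < tail_sum s m y"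
  shows "(\<integral>u. f (draw s m y u) \<partial>unif) = (\<Sum>i<m. f i * share s m y i)"
    and "integrable unif (\<lambda>u. f (draw s m y u))"
proof -
  have [measurable]: "{u. draw s m y u = i} \<in> sets borel" for i by measurable
  have eq: "f (draw s m y u) = (\<Sum>i<m. f i * indicator {u. draw s m y u = i} u)" for u
    using draw_less[OF assms(2), of s y u]
    by (simp add: indicator_def if_distrib[of "\<lambda>x. _ * x"] sum.delta' cong: if_cong)
  show "integrable unif (\<lambda>u. f (draw s m y u))"
    unfolding eq by (intro Bochner_Integration.integrable_sum integrable_mult_right
      finite_measure.integrable_const_bound[where B = 1] unif.integrable_const_bound[where B = 1])
      (auto simp: measurable_unif)
  have "integrable unif (indicator {u. draw s m y u = i} :: real \<Rightarrow> real)" for i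
    by (intro unif.integrable_const_bound[where B = 1]) (auto simp: measurable_unif)
  moreover have "(\<integral>u. indicator {u. draw s m y u = i} u \<partial>unif) = share s m y i" if "i < m" for i
    using prob_draw[OF assms(1) that assms(3)] by (simp del: measure_uniform_measure)
  ultimately show "(\<integral>u. f (draw s m y u) \<partial>unif) = (\<Sum>i<m. f i * share s m y i)"
    unfolding eq by (subst Bochner_Integration.integral_sum) simp_all
qed

lemma sum_share_div:
  assumes "pos_upto s m"
  shows "(\<Sum>i<m. 1 / s i * share s m y i) = mean_inv s m y"
  unfolding share_def mean_inv_def sum_divide_distrib
  using assms by (intro sum.cong) (auto simp: pos_upto_def)

section \<open>The mechanism and its truthfulness\<close>

text \<open>The mean of the random load, by \<open>expectation_load\<close>. It is available in
  closed form for any hypothetical speeds, so a payment needs no second simulated run.\<close>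

definition expected_load :: "(nat \<Rightarrow> real) \<Rightarrow> nat \<Rightarrow> (nat \<Rightarrow> real) \<Rightarrow> nat \<Rightarrow> nat \<Rightarrow> real" where
  "expected_load s m p n i = (\<Sum>l<n. p l * share s m (level s m p l) i)"

text \<open>Index \<open>length ps\<close> belongs to the arriving job; the update replaces the
  unspecified list entry there.\<close>

definition report_level :: "real list \<Rightarrow> real list \<Rightarrow> real \<Rightarrow> real" where
  "report_level s ps x = level ((!) s) (length s) (((!) ps)(length ps := x)) (length ps)"

text \<open>
  Cell 0 of a tape determines the random report of the payment rule, cell 1 the machine. The fee
  subtracts the completion time that the job has if \<open>r\<close> is its true size. The private cost of a
  machine is its inverse speed, so its random report is the speed \<open>s ! i / \<omega> 0\<close>, the junk value
  for \<open>\<omega> 0 = 0\<close> having probability 0.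
\<close>

definition draw_mechanism :: mechanism where
  "draw_mechanism =
    \<lparr>alloc = (\<lambda>s ps a r \<omega>.
       let i = draw ((!) s) (length s) (report_level s ps r) (\<omega> 1)
       in (i, r * mean_inv ((!) s) (length s) (report_level s ps (\<omega> 0 * r)) - (load ps a i + r) / s ! i)),
     pay = (\<lambda>s ps a \<omega> i. load ps a i / s ! i -
       expected_load (((!) s)(i := s ! i / \<omega> 0)) (length s) ((!) ps) (length ps) i / s ! i)\<rparr>"

section \<open>Measurability and validity\<close>

lemma borel_measurable_tail_sum [measurable (raw)]:
  assumes [measurable]: "\<And>j. j < n \<Longrightarrow> (\<lambda>x. f x j) \<in> borel_measurable M" "y \<in> borel_measurable M"
  shows "(\<lambda>x. tail_sum (f x) n (y x)) \<in> borel_measurable M"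
  unfolding tail_sum_def by (intro borel_measurable_sum) measurable

lemma borel_measurable_lower_bound [measurable (raw)]:
  assumes [measurable]: "\<And>i. i < m \<Longrightarrow> (\<lambda>x. s x i) \<in> borel_measurable M"
    "\<And>j. j < n \<Longrightarrow> (\<lambda>x. p x j) \<in> borel_measurable M"
  shows "(\<lambda>x. lower_bound (s x) m (p x) n) \<in> borel_measurable M"
proof -
  have [measurable]: "(\<lambda>x. crit (s x) m (p x) n q) \<in> borel_measurable M" if [simp]: "q < n" for q
    unfolding crit_def by (intro borel_measurable_Min) measurable
  \<comment> \<open>The option type turns the inserted 0 into one more member of a finite indexed
    family.\<close>
  have "lower_bound (s x) m (p x) n =
      Max ((\<lambda>q. case q of None \<Rightarrow> 0 | Some q \<Rightarrow> crit (s x) m (p x) n q) ` insert None (Some ` {..<n}))" for x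
    unfolding lower_bound_def by (simp add: image_image)
  then show ?thesis by (simp only:) (intro borel_measurable_Max, auto)
qed

lemma borel_measurable_level [measurable (raw)]:
  assumes [measurable]: "\<And>i. i < m \<Longrightarrow> (\<lambda>x. s x i) \<in> borel_measurable M"
    "\<And>j. j \<le> l \<Longrightarrow> (\<lambda>x. p x j) \<in> borel_measurable M"
  shows "(\<lambda>x. level (s x) m (p x) l) \<in> borel_measurable M"
proof -
  have "(\<lambda>x. lower_bound (s x) m (p x) (Suc l)) \<in> borel_measurable M" "(\<lambda>x. p x l) \<in> borel_measurable M"
    by (auto intro!: borel_measurable_lower_bound assms simp: less_Suc_eq_le)
  then show ?thesis unfolding level_def by measurable
qed

lemma borel_measurable_mean_inv [measurable (raw)]:
  assumes [measurable]: "y \<in> borel_measurable M"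
  shows "(\<lambda>x. mean_inv s m (y x)) \<in> borel_measurable M"
  unfolding mean_inv_def by measurable

lemma borel_measurable_report_level [measurable (raw)]:
  assumes [measurable]: "f \<in> borel_measurable M"
  shows "(\<lambda>x. report_level s ps (f x)) \<in> borel_measurable M"
  unfolding report_level_def by (intro borel_measurable_level) (auto simp: fun_upd_def)

lemma borel_measurable_expected_load:
  assumes s [measurable]: "\<And>i. i < m \<Longrightarrow> (\<lambda>x. s x i) \<in> borel_measurable M" and i: "i < m"
  shows "(\<lambda>x. expected_load (s x) m p n i) \<in> borel_measurable M"
proof -
  have [measurable]: "(\<lambda>x. s x i) \<in> borel_measurable M" using s i .
  have [measurable]: "(\<lambda>x. level (s x) m p l) \<in> borel_measurable M" for l
    by (intro borel_measurable_level s) auto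
  have [measurable]: "(\<lambda>x. tail_sum (s x) m (level (s x) m p l)) \<in> borel_measurable M" for l
    by (intro borel_measurable_tail_sum s) auto
  show ?thesis unfolding expected_load_def share_def by measurable
qed

lemma pos_upto_nth: "positive xs \<Longrightarrow> pos_upto ((!) xs) (length xs)"
  by (simp add: positive_def pos_upto_def)

lemma history_pos:
  assumes "history s ps a"
  shows "0 < length s" "pos_upto ((!) s) (length s)" "pos_upto ((!) ps) (length ps)"
  using assms pos_upto_nth by (auto simp: history_def)

lemma tail_sum_report_level_pos:
  assumes "history s ps a" "0 < x"
  shows "0 < tail_sum ((!) s) (length s) (report_level s ps x)"
  unfolding report_level_def using history_pos[OF assms(1)] assms(2)
  by (intro tail_sum_level_pos) (auto simp: pos_upto_def)

lemma report_level_pos: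
  assumes "history s ps a" "0 < x"
  shows "0 < report_level s ps x"
  unfolding report_level_def using history_pos[OF assms(1)] assms(2)
  by (intro level_pos) (auto simp: pos_upto_def)

lemma valid_draw_mechanism: "valid_mechanism draw_mechanism"
  unfolding valid_mechanism_def
proof (intro allI impI conjI)
  fix s ps a and r :: real
  assume h: "history s ps a"
  show "fst (alloc draw_mechanism s ps a r \<omega>) < length s" for \<omega>
    using history_pos(1)[OF h] by (simp add: draw_mechanism_def Let_def draw_less)
  have [measurable]: "(\<lambda>\<omega>. draw ((!) s) (length s) (report_level s ps r) (\<omega> 1)) \<in> tape_space \<rightarrow>\<^sub>M count_space UNIV"
    by (rule measurable_compose[OF _ measurable_draw]) measurable
  have [measurable]: "(\<lambda>\<omega>. (load ps a (draw ((!) s) (length s) (report_level s ps r) (\<omega> 1)) + r)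
      / s ! draw ((!) s) (length s) (report_level s ps r) (\<omega> 1)) \<in> borel_measurable tape_space"
    by (rule measurable_compose[where f = "\<lambda>\<omega>. draw ((!) s) (length s) (report_level s ps r) (\<omega> 1)"
        and g = "\<lambda>i. (load ps a i + r) / s ! i" and N = "count_space UNIV"]) simp_all
  show "alloc draw_mechanism s ps a r \<in> tape_space \<rightarrow>\<^sub>M (count_space UNIV \<Otimes>\<^sub>M borel)"
    unfolding draw_mechanism_def mechanism.simps Let_def by measurable
next
  fix s ps a i
  assume h: "history s ps a" and i: "i < length s"
  have "(\<lambda>\<omega>. expected_load (((!) s)(i := s ! i / \<omega> 0)) (length s) ((!) ps) (length ps) i) \<in> borel_measurable tape_space"
    using i by (intro borel_measurable_expected_load) (auto simp: fun_upd_def)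
  then show "(\<lambda>\<omega>. pay draw_mechanism s ps a \<omega> i) \<in> borel_measurable tape_space"
    by (simp add: draw_mechanism_def)
qed

section \<open>Truthfulness for jobs\<close>

text \<open>An instance of \<open>myerson\<close> with the size as private parameter and
  \<open>g x\<close>, the expected inverse speed obtained by reporting \<open>x\<close>, as expected
  time per unit. It decreases because a larger report has a higher level.\<close>

lemma job_truthful_draw_mechanism: "job_truthful draw_mechanism"
  unfolding job_truthful_def
proof (intro allI impI, elim conjE)
  fix s ps a and p r :: real
  assume h: "history s ps a" and p: "0 < p" and r: "0 < r"
  let ?m = "length s" and ?s = "(!) s"
  note pos = history_pos[OF h]
  define g where "g x = mean_inv ?s ?m (report_level s ps x)" for x
  have [measurable]: "g \<in> borel_measurable borel" unfolding g_def[abs_def] by measurable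
  have mono: "g y \<le> g x" if "0 < x" "x \<le> y" for x y
  proof -
    have "report_level s ps x \<le> report_level s ps y"
      unfolding report_level_def by (rule level_mono_report[OF pos that])
    then show ?thesis
      unfolding g_def using report_level_pos[OF h] tail_sum_report_level_pos[OF h] that
      by (intro mean_inv_antimono[OF pos(2)]) auto
  qed
  define c where "c = Min (set s)"
  have c: "0 < c" "c \<le> s ! i" if "i < ?m" for i
    using h that by (auto simp: c_def history_def positive_def Min_gr_iff)
  have c0: "0 < c" using c(1) pos(1) by blast
  have bnd: "\<bar>g x\<bar> \<le> 1 / c" if "0 < x" for x
    using mean_inv_nonneg[OF pos(2)] mean_inv_le[OF pos(2) c0 c(2) tail_sum_report_level_pos[OF h that]]
    by (simp add: g_def)
  have U: "integrable tape_space (job_utility draw_mechanism s ps a p x)"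
    "integral\<^sup>L tape_space (job_utility draw_mechanism s ps a p x) = - ((p - x) * g x + x * (\<integral>u. g (x * u) \<partial>unif))"
    if x: "0 < x" for x
  proof -
    let ?d = "\<lambda>u. 1 / s ! draw ?s ?m (report_level s ps x) u"
    \<comment> \<open>The fee refunds the waiting time and the processing time of the report, so the
      drawn machine matters only through \<open>(p - x) / s ! i\<close>.\<close>
    have eq: "job_utility draw_mechanism s ps a p x = (\<lambda>\<omega>. - ((p - x) * ?d (\<omega> 1) + x * g (x * \<omega> 0)))"
      by (rule ext) (simp add: job_utility_def draw_mechanism_def Let_def g_def add_divide_distrib
        diff_divide_distrib left_diff_distrib mult.commute)
    have meas: "?d \<in> borel_measurable borel"
      by (rule measurable_compose[OF measurable_draw]) simp
    note d = integral_draw[OF pos(2,1) tail_sum_report_level_pos[OF h x], of "\<lambda>i. 1 / s ! i"]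
    have "(\<integral>u. ?d u \<partial>unif) = g x" unfolding d(1) g_def by (rule sum_share_div[OF pos(2)])
    then have 1: "(\<integral>\<omega>. ?d (\<omega> 1) \<partial>tape_space) = g x" "integrable tape_space (\<lambda>\<omega>. ?d (\<omega> 1))"
      using integral_tape_component[OF meas, of 1] integrable_tape_component[OF meas, of 1] d(2) by auto
    have meas': "(\<lambda>u. g (x * u)) \<in> borel_measurable borel" by measurable
    have "integrable unif (\<lambda>u. g (x * u))" by (rule myerson(2)[OF _ mono bnd x p]) auto
    then have 2: "(\<integral>\<omega>. g (x * \<omega> 0) \<partial>tape_space) = (\<integral>u. g (x * u) \<partial>unif)"
      "integrable tape_space (\<lambda>\<omega>. g (x * \<omega> 0))"
      using integral_tape_component[OF meas', of 0] integrable_tape_component[OF meas', of 0] by auto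
    show "integrable tape_space (job_utility draw_mechanism s ps a p x)"
      unfolding eq using 1(2) 2(2)
      by (intro integrable_minus Bochner_Integration.integrable_add integrable_mult_right)
    show "integral\<^sup>L tape_space (job_utility draw_mechanism s ps a p x) = - ((p - x) * g x + x * (\<integral>u. g (x * u) \<partial>unif))"
      unfolding eq Bochner_Integration.integral_minus using 1 2
      by (subst Bochner_Integration.integral_add) (auto simp del: times_divide_eq_right times_divide_eq_left One_nat_def)
  qed
  have "p * (\<integral>u. g (p * u) \<partial>unif) \<le> (p - r) * g r + r * (\<integral>u. g (r * u) \<partial>unif)"
    by (rule myerson(1)[OF _ mono bnd r p]) auto
  then show "integrable tape_space (job_utility draw_mechanism s ps a p p) \<and>
     integrable tape_space (job_utility draw_mechanism s ps a p r) \<and>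
     integral\<^sup>L tape_space (job_utility draw_mechanism s ps a p r)
       \<le> integral\<^sup>L tape_space (job_utility draw_mechanism s ps a p p)"
    using U p r by simp
qed

section \<open>Truthfulness for machines\<close>

text \<open>The machines of earlier jobs enter the fee but not the draw, so the recursion unrolls:
  the machine of job \<open>j\<close> is a function of the \<open>j\<close>-th tape alone.\<close>

lemma run_draw_mechanism:
  "run draw_mechanism s ps \<omega> = map (\<lambda>j. draw ((!) s) (length s) (level ((!) s) (length s) ((!) ps) j) (\<omega> j 1)) [0..<length ps]"
proof -
  have "run_upto draw_mechanism s ps \<omega> k =
      map (\<lambda>j. draw ((!) s) (length s) (level ((!) s) (length s) ((!) ps) j) (\<omega> j 1)) [0..<k]"
    if "k \<le> length ps" for k
    using that
  proof (induction k)
    case (Suc k)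
    have "report_level s (take k ps) (ps ! k) = level ((!) s) (length s) ((!) ps) k"
      unfolding report_level_def using Suc.prems by (auto intro!: level_cong)
    then show ?case using Suc by (simp add: Let_def draw_mechanism_def)
  qed simp
  then show ?thesis by (simp add: run_def)
qed

lemma load_run_draw_mechanism:
  "load ps (run draw_mechanism s ps \<omega>) i = (\<Sum>j<length ps. ps ! j *
     of_bool (draw ((!) s) (length s) (level ((!) s) (length s) ((!) ps) j) (\<omega> j 1) = i))"
proof -
  have "load ps (run draw_mechanism s ps \<omega>) i = (\<Sum>j\<in>{j \<in> {..<length ps}.
      draw ((!) s) (length s) (level ((!) s) (length s) ((!) ps) j) (\<omega> j 1) = i}. ps ! j)"
    unfolding load_def run_draw_mechanism by (intro sum.cong) auto
  also have "\<dots> = (\<Sum>j<length ps. if draw ((!) s) (length s) (level ((!) s) (length s) ((!) ps) j) (\<omega> j 1) = i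
      then ps ! j else 0)"
    by (rule sum.inter_filter) simp
  finally show ?thesis by (simp add: of_bool_def if_distrib cong: if_cong)
qed

lemma expectation_load:
  assumes "s \<noteq> []" "positive s" "positive ps" "i < length s"
  shows "integrable run_space (\<lambda>\<omega>. load ps (run draw_mechanism s ps \<omega>) i)"
    and "(\<integral>\<omega>. load ps (run draw_mechanism s ps \<omega>) i \<partial>run_space) =
      expected_load ((!) s) (length s) ((!) ps) (length ps) i"
proof -
  let ?m = "length s" and ?s = "(!) s"
  let ?l = "level ?s ?m ((!) ps)"
  let ?f = "\<lambda>j u. of_bool (draw ?s ?m (?l j) u = i) :: real"
  have pos: "0 < ?m" "pos_upto ?s ?m" "pos_upto ((!) ps) (length ps)" using assms pos_upto_nth by auto
  have f: "integrable run_space (\<lambda>\<omega>. ?f j (\<omega> j 1))" "(\<integral>\<omega>. ?f j (\<omega> j 1) \<partial>run_space) = share ?s ?m (?l j) i"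
    if j: "j < length ps" for j
  proof -
    have "pos_upto ((!) ps) (Suc j)" using pos(3) j by (simp add: pos_upto_def)
    note d = integral_draw[OF pos(2,1) tail_sum_level_pos[OF pos(1,2) this], of "\<lambda>k. of_bool (k = i)"]
    have meas: "?f j \<in> borel_measurable borel"
      by (rule measurable_compose[OF measurable_draw]) simp
    show "integrable run_space (\<lambda>\<omega>. ?f j (\<omega> j 1))" using integrable_run_component[OF meas, of j 1] d(2) by simp
    have "integral\<^sup>L unif (?f j) = (\<Sum>k<?m. if k = i then share ?s ?m (?l j) k else 0)"
      unfolding d(1) by (intro sum.cong) auto
    then show "(\<integral>\<omega>. ?f j (\<omega> j 1) \<partial>run_space) = share ?s ?m (?l j) i"
      using integral_run_component[OF meas, of j 1] assms(4) by simp
  qed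
  show "integrable run_space (\<lambda>\<omega>. load ps (run draw_mechanism s ps \<omega>) i)"
    unfolding load_run_draw_mechanism using f(1)
    by (intro Bochner_Integration.integrable_sum integrable_mult_right) simp
  show "(\<integral>\<omega>. load ps (run draw_mechanism s ps \<omega>) i \<partial>run_space) = expected_load ?s ?m ((!) ps) (length ps) i"
    unfolding load_run_draw_mechanism expected_load_def
    by (subst Bochner_Integration.integral_sum) (simp_all add: f del: One_nat_def)
qed

lemma expected_load_cong:
  assumes "\<And>k. k < m \<Longrightarrow> s k = s' k" "i < m"
  shows "expected_load s m p n i = expected_load s' m p n i"
  unfolding expected_load_def using assms
  by (intro sum.cong arg_cong2[where f = "(*)"]) (auto simp: share_cong[of m s s'] level_cong[of m s s' _ p p])

text \<open>An instance of \<open>myerson\<close> with the inverse speed as private cost per unit of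
  load. \<open>G b\<close> is the expected load at cost \<open>b\<close>, decreasing by
  \<open>share_mono_speed\<close> applied to every job.\<close>

lemma machine_truthful_draw_mechanism: "machine_truthful draw_mechanism"
  unfolding machine_truthful_def
proof (intro allI impI, elim conjE)
  fix s ps i and r :: real
  assume s: "positive s" and ps: "positive ps" and i: "i < length s" and r: "0 < r"
  let ?m = "length s" and ?s = "(!) s" and ?n = "length ps" and ?p = "(!) ps"
  note pos = pos_upto_nth[OF s] pos_upto_nth[OF ps]
  define v where "v = s ! i"
  have v: "0 < v" using s i by (simp add: positive_def v_def)
  define G where "G b = expected_load (?s(i := 1 / b)) ?m ?p ?n i" for b
  have [measurable]: "G \<in> borel_measurable borel"
    unfolding G_def[abs_def] using i by (intro borel_measurable_expected_load) (auto simp: fun_upd_def)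
  have pos': "pos_upto (?s(i := 1 / x)) ?m" if "0 < x" for x
    using pos that by (simp add: pos_upto_def)
  have mono: "G y \<le> G x" if "0 < x" "x \<le> y" for x y
  proof -
    have "share (?s(i := 1 / y)) ?m (level (?s(i := 1 / y)) ?m ?p l) i
        \<le> share (?s(i := 1 / x)) ?m (level (?s(i := 1 / x)) ?m ?p l) i" if l: "l < ?n" for l
    proof -
      have "pos_upto ?p (Suc l)" using pos l by (simp add: pos_upto_def)
      from share_mono_speed[OF _ pos' this i, of y "1 / x"] show ?thesis
        using \<open>0 < x\<close> \<open>x \<le> y\<close> i by (fastforce simp: frac_le)
    qed
    then show ?thesis unfolding G_def expected_load_def
      using pos by (intro sum_mono mult_left_mono) (auto simp: pos_upto_def less_imp_le)
  qed
  have bnd: "\<bar>G x\<bar> \<le> sum ?p {..<?n}" if x: "0 < x" for x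
  proof -
    have "0 \<le> G x" unfolding G_def expected_load_def
      using pos share_nonneg[OF pos'[OF x] i] by (intro sum_nonneg mult_nonneg_nonneg) (auto simp: pos_upto_def less_imp_le)
    moreover have "G x \<le> sum ?p {..<?n}" unfolding G_def expected_load_def
      using pos share_le_1[OF pos'[OF x] i] by (intro sum_mono mult_left_le) (auto simp: pos_upto_def less_imp_le)
    ultimately show ?thesis by simp
  qed
  have U: "integrable run_space (machine_utility draw_mechanism i v (s[i := x]) ps)"
    "integral\<^sup>L run_space (machine_utility draw_mechanism i v (s[i := x]) ps) =
      - ((1 / v - 1 / x) * G (1 / x) + 1 / x * (\<integral>u. G (1 / x * u) \<partial>unif))"
    if x: "0 < x" for x
  proof -
    let ?s' = "s[i := x]"
    have s': "?s' \<noteq> []" "positive ?s'"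
      using s i x by (auto simp: positive_def dest: set_update_subset_insert[THEN subsetD])
    have G1: "expected_load ((!) ?s') ?m ?p ?n i = G (1 / x)"
      unfolding G_def using i by (intro expected_load_cong) auto
    \<comment> \<open>Reporting speed \<open>x / u\<close> means reporting cost
      \<open>1 / x * u\<close>, the random point below the reported cost.\<close>
    have G2: "expected_load (((!) ?s')(i := x / u)) ?m ?p ?n i = G (1 / x * u)" for u
      unfolding G_def using i by (intro expected_load_cong) auto
    \<comment> \<open>The payment refunds the load at the reported speed, so only the difference of
      the inverse speeds multiplies the realized load.\<close>
    have eq: "machine_utility draw_mechanism i v ?s' ps = (\<lambda>\<omega>.
        - ((1 / v - 1 / x) * load ps (run draw_mechanism ?s' ps \<omega>) i + 1 / x * G (1 / x * \<omega> ?n 0)))"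
      using G2 i by (intro ext) (simp add: machine_utility_def draw_mechanism_def Let_def left_diff_distrib)
    note L = expectation_load[OF s' ps, of i, unfolded length_list_update G1, OF i]
    have meas: "(\<lambda>u. G (1 / x * u)) \<in> borel_measurable borel" by measurable
    have "integrable unif (\<lambda>u. G (1 / x * u))"
      by (rule myerson(2)[OF _ mono bnd, where b\<^sub>0 = 1]) (use x in auto)
    then have 2: "(\<integral>\<omega>. G (1 / x * \<omega> ?n 0) \<partial>run_space) = (\<integral>u. G (1 / x * u) \<partial>unif)"
      "integrable run_space (\<lambda>\<omega>. G (1 / x * \<omega> ?n 0))"
      using integral_run_component[OF meas, of ?n 0] integrable_run_component[OF meas, of ?n 0] by auto
    show "integrable run_space (machine_utility draw_mechanism i v ?s' ps)"
      unfolding eq using L 2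
      by (intro integrable_minus Bochner_Integration.integrable_add integrable_mult_right)
    have "integral\<^sup>L run_space (machine_utility draw_mechanism i v ?s' ps) =
        - ((\<integral>\<omega>. (1 / v - 1 / x) * load ps (run draw_mechanism ?s' ps \<omega>) i \<partial>run_space) +
           (\<integral>\<omega>. 1 / x * G (1 / x * \<omega> ?n 0) \<partial>run_space))"
      unfolding eq Bochner_Integration.integral_minus
      using L(1) 2(2) by (subst Bochner_Integration.integral_add) (auto intro!: integrable_mult_right simp del: times_divide_eq_left)
    then show "integral\<^sup>L run_space (machine_utility draw_mechanism i v ?s' ps) =
        - ((1 / v - 1 / x) * G (1 / x) + 1 / x * (\<integral>u. G (1 / x * u) \<partial>unif))"
      using L(2) 2(1) by (simp only: integral_mult_right_zero)
  qed
  have "1 / v * (\<integral>u. G (1 / v * u) \<partial>unif)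
      \<le> (1 / v - 1 / r) * G (1 / r) + 1 / r * (\<integral>u. G (1 / r * u) \<partial>unif)"
    by (rule myerson(1)[OF _ mono bnd]) (use r v in auto)
  moreover have "s[i := v] = s" by (simp add: v_def)
  ultimately show "integrable run_space (machine_utility draw_mechanism i (s ! i) s ps) \<and>
      integrable run_space (machine_utility draw_mechanism i (s ! i) (s[i := r]) ps) \<and>
      integral\<^sup>L run_space (machine_utility draw_mechanism i (s ! i) (s[i := r]) ps)
        \<le> integral\<^sup>L run_space (machine_utility draw_mechanism i (s ! i) s ps)"
    using U[OF v] U[OF r] unfolding v_def[symmetric] by simp
qed

section \<open>Competitive ratio\<close>

lemma finite_assignments: "finite (assignments m n)"
  unfolding assignments_def by (rule finite_lists_length_eq) simp

lemma OPT_attained: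
  assumes "s \<noteq> []"
  obtains a where "a \<in> assignments (length s) (length ps)" "makespan s ps a = OPT s ps"
proof -
  have "replicate (length ps) 0 \<in> assignments (length s) (length ps)"
    using assms by (auto simp: assignments_def)
  then have "OPT s ps \<in> makespan s ps ` assignments (length s) (length ps)"
    unfolding OPT_def using finite_assignments by (intro Min_in) auto
  then show ?thesis using that by auto
qed

lemma makespan_ge:
  assumes "positive s" "i < length s"
  shows "load ps a i \<le> makespan s ps a * s ! i"
proof -
  have "load ps a i / s ! i \<le> makespan s ps a" unfolding makespan_def using assms(2) by (intro Max_ge) auto
  moreover have "0 < s ! i" using assms by (simp add: positive_def)
  ultimately show ?thesis by (simp add: pos_divide_le_eq)
qed

lemma OPT_pos:
  assumes "s \<noteq> []" "positive s" "positive ps" "ps \<noteq> []"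
  shows "0 < OPT s ps"
    and "lower_bound ((!) s) (length s) ((!) ps) (length ps) \<le> OPT s ps"
proof -
  let ?m = "length s" and ?n = "length ps" and ?C = "OPT s ps"
  obtain a where a: "a \<in> assignments ?m ?n" "makespan s ps a = ?C" by (rule OPT_attained[OF assms(1)])
  have a': "length a = ?n" "\<And>j. j < ?n \<Longrightarrow> a ! j < ?m"
    using a(1) nth_mem by (force simp: assignments_def)+
  have sp: "0 < s ! i" if "i < ?m" for i using assms(2) that by (simp add: positive_def)
  have pp: "0 < ps ! j" if "j < ?n" for j using assms(3) that by (simp add: positive_def)
  have le: "load ps a i \<le> ?C * s ! i" if "i < ?m" for i using makespan_ge[OF assms(2) that] a(2) by metis
  have job: "ps ! j \<le> load ps a (a ! j)" if j: "j < ?n" for j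
    unfolding load_def using j a' pp by (intro member_le_sum) (auto simp: less_imp_le)
  have "0 < ?C * s ! (a ! 0)"
    using job[of 0] le[of "a ! 0"] a' pp[of 0] assms(4) by (auto intro: less_le_trans)
  then show C: "0 < ?C" using sp a' assms(4) by (simp add: zero_less_mult_iff) (metis length_greater_0_conv not_less_iff_gr_or_eq)
  have "tail_sum ((!) ps) ?n y \<le> ?C * tail_sum ((!) s) ?m (y / ?C)" if y: "0 < y" for y
  proof -
    \<comment> \<open>The sum is grouped by the machines of an optimal assignment, each of which
      carries at most \<open>?C * s ! i\<close>.\<close>
    have "tail_sum ((!) ps) ?n y = (\<Sum>i<?m. \<Sum>j\<in>{j \<in> {..<?n}. a ! j = i}. if y \<le> ps ! j then ps ! j else 0)"
      unfolding tail_sum_def by (rule sum.group[symmetric]) (use a' in auto)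
    also have "\<dots> \<le> (\<Sum>i<?m. ?C * (if y / ?C \<le> s ! i then s ! i else 0))"
    proof (rule sum_mono)
      fix i assume i: "i \<in> {..<?m}"
      show "(\<Sum>j\<in>{j \<in> {..<?n}. a ! j = i}. if y \<le> ps ! j then ps ! j else 0)
          \<le> ?C * (if y / ?C \<le> s ! i then s ! i else 0)"
      proof (cases "y / ?C \<le> s ! i")
        case True
        have "(\<Sum>j\<in>{j \<in> {..<?n}. a ! j = i}. if y \<le> ps ! j then ps ! j else 0) \<le> (\<Sum>j\<in>{j \<in> {..<?n}. a ! j = i}. ps ! j)"
          using pp by (intro sum_mono) (auto simp: less_imp_le)
        also have "\<dots> = load ps a i" unfolding load_def a'(1) by (intro sum.cong) auto
        finally show ?thesis using le i True by force
      next
        case False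
        \<comment> \<open>Such a machine cannot carry a single job of size at least \<open>y\<close>
          in the optimal schedule, so its group contributes 0.\<close>
        then have "?C * s ! i < y" using C by (simp add: not_le pos_less_divide_eq mult.commute)
        then have "ps ! j < y" if "j < ?n" "a ! j = i" for j
          using job[OF that(1)] le[of i] i that(2) by simp
        then have "(\<Sum>j\<in>{j \<in> {..<?n}. a ! j = i}. if y \<le> ps ! j then ps ! j else 0) = 0"
          by (intro sum.neutral) force
        then show ?thesis using False by simp
      qed
    qed
    finally show ?thesis by (simp add: tail_sum_def sum_distrib_left)
  qed
  then show "lower_bound ((!) s) ?m ((!) ps) ?n \<le> ?C"
    using lower_bound_le_iff[OF _ pos_upto_nth[OF assms(2)] pos_upto_nth[OF assms(3)] C] assms(1) by simp
qed

section \<open>Exponential moments of the loads\<close>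

lemma indep_run_components: "runs.indep_vars (\<lambda>_. tape_space) (\<lambda>j \<omega>. \<omega> j) UNIV"
proof -
  have "distr run_space (PiM UNIV (\<lambda>_. tape_space)) (\<lambda>x. \<lambda>i\<in>UNIV. x i) = run_space"
    by (simp add: run_space_def[symmetric] distr_id2 restrict_UNIV)
  then show ?thesis
    by (subst runs.indep_vars_iff_distr_eq_PiM'[where I = UNIV]) (simp_all add: distr_run_component run_space_def[symmetric])
qed

text \<open>Being affine in the indicator, the exponential has an expectation determined by the
  probability alone.\<close>

lemma exp_of_bool: "exp (c * of_bool b) = 1 + (exp c - 1) * of_bool b" for c :: real
  by simp

text \<open>
  Eligibility bounds the jobs on machine \<open>i\<close> by \<open>2 * OPT * s\<^sub>i\<close>, so the exponential moments of
  its load are controlled by the expected load as in Chernoff's bound.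
\<close>

lemma exp_load_le:
  assumes "s \<noteq> []" "positive s" "positive ps" "ps \<noteq> []" "i < length s"
  defines "B \<equiv> 2 * OPT s ps"
  shows "integrable run_space (\<lambda>\<omega>. exp (load ps (run draw_mechanism s ps \<omega>) i / (s ! i * B)))"
    and "(\<integral>\<omega>. exp (load ps (run draw_mechanism s ps \<omega>) i / (s ! i * B)) \<partial>run_space) \<le> exp (2 + 2 * ln (length s))"
proof -
  let ?m = "length s" and ?s = "(!) s" and ?n = "length ps" and ?p = "(!) ps"
  let ?l = "level ?s ?m ?p" and ?T = "lower_bound ?s ?m ?p ?n"
  have pos: "0 < ?m" "pos_upto ?s ?m" "pos_upto ?p ?n" using assms pos_upto_nth by auto
  have posj: "pos_upto ?p (Suc j)" if "j < ?n" for j using pos(3) that by (simp add: pos_upto_def)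
  have B: "0 < B" "2 * ?T \<le> B" unfolding B_def using OPT_pos[OF assms(1-4)] by simp_all
  have si: "0 < s ! i" using assms(2,5) by (simp add: positive_def)
  have pp: "0 < ps ! j" if "j < ?n" for j using assms(3) that by (simp add: positive_def)
  define c where "c j = ps ! j / (s ! i * B)" for j
  define x where "x j = share ?s ?m (?l j) i" for j
  define X where "X j u = exp (c j * of_bool (draw ?s ?m (?l j) u = i))" for j u
  have c0: "0 \<le> c j" if "j < ?n" for j using pp[OF that] si B by (simp add: c_def less_imp_le)
  have x0: "0 \<le> x j" for j unfolding x_def by (rule share_nonneg[OF pos(2) assms(5)])
  \<comment> \<open>A positive share means eligibility, hence
    \<open>ps ! j \<le> 2 * T * s ! i\<close> for the bound \<open>T\<close> at arrival; this is why
    \<open>B\<close> is twice the optimum. Jobs of share 0 may be too large, but contribute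
    nothing.\<close>
  have c1: "c j \<le> 1" if j: "j < ?n" "x j \<noteq> 0" for j
  proof -
    have "?l j \<le> s ! i" using j(2) by (auto simp: x_def share_def split: if_splits)
    moreover have "?T \<ge> lower_bound ?s ?m ?p (Suc j)"
      using j by (intro lower_bound_prefix[OF pos]) auto
    moreover have "0 < lower_bound ?s ?m ?p (Suc j)" using lower_bound_pos[OF pos(1,2) posj] j by simp
    ultimately have "ps ! j \<le> 2 * lower_bound ?s ?m ?p (Suc j) * s ! i"
      by (simp add: level_def pos_divide_le_eq mult_ac)
    also have "\<dots> \<le> B * s ! i" using B si \<open>?T \<ge> lower_bound ?s ?m ?p (Suc j)\<close> by (intro mult_right_mono) auto
    finally show ?thesis using B si by (simp add: c_def pos_divide_le_eq mult_ac)
  qed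
  have X_meas: "X j \<in> borel_measurable borel" for j
    unfolding X_def[abs_def] by (rule measurable_compose[OF measurable_draw]) simp
  have X_int: "integrable unif (X j)" "integral\<^sup>L unif (X j) \<le> exp (2 * c j * x j)" if j: "j < ?n" for j
  proof -
    note d = integral_draw[OF pos(2,1) tail_sum_level_pos[OF pos(1,2) posj[OF j]]]
    have Xe: "X j = (\<lambda>u. 1 + (exp (c j) - 1) * of_bool (draw ?s ?m (?l j) u = i))"
      unfolding X_def[abs_def] exp_of_bool ..
    show "integrable unif (X j)" unfolding X_def[abs_def] by (rule d(2))
    have "integral\<^sup>L unif (X j) = 1 + (exp (c j) - 1) * (\<integral>u. of_bool (draw ?s ?m (?l j) u = i) \<partial>unif)"
      unfolding Xe using d(2)[of "\<lambda>k. of_bool (k = i)"] unif.prob_space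
      by (subst Bochner_Integration.integral_add) auto
    also have "(\<integral>u. of_bool (draw ?s ?m (?l j) u = i) \<partial>unif) = (\<Sum>k<?m. if k = i then share ?s ?m (?l j) k else 0)"
      unfolding d(1)[of "\<lambda>k. of_bool (k = i)"] by (intro sum.cong) auto
    also have "\<dots> = x j" using assms(5) by (simp add: x_def)
    also have "(exp (c j) - 1) * x j \<le> 2 * c j * x j"
    proof (cases "x j = 0")
      case False
      note cj = c0[OF j] c1[OF j False]
      \<comment> \<open>On [0, 1] this gives \<open>exp c \<le> 1 + 2 * c\<close>, the source of the
        2 in the exponent.\<close>
      have "exp (c j) \<le> 1 + c j + (c j)\<^sup>2" by (rule exp_bound[OF cj])
      also have "(c j)\<^sup>2 \<le> c j" using cj by (simp add: power2_eq_square mult_left_le)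
      finally show ?thesis using x0 by (intro mult_right_mono) auto
    qed simp
    also have "1 + 2 * c j * x j \<le> exp (2 * c j * x j)" by (rule exp_ge_add_one_self)
    finally show "integral\<^sup>L unif (X j) \<le> exp (2 * c j * x j)" by simp
  qed
  have eq: "exp (load ps (run draw_mechanism s ps \<omega>) i / (s ! i * B)) = (\<Prod>j<?n. X j (\<omega> j 1))" for \<omega>
    unfolding load_run_draw_mechanism X_def exp_sum[OF finite_lessThan, symmetric]
    by (simp only: sum_divide_distrib c_def times_divide_eq_left)
  have ind: "runs.indep_vars (\<lambda>_. borel) (\<lambda>j \<omega>. X j (\<omega> j 1)) {..<?n}"
  proof (rule runs.indep_vars_compose2[where X = "\<lambda>j \<omega>. \<omega> j" and Y = "\<lambda>j \<omega>. X j (\<omega> 1)"])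
    show "runs.indep_vars (\<lambda>_. tape_space) (\<lambda>j \<omega>. \<omega> j) {..<?n}"
      by (rule runs.indep_vars_subset[OF indep_run_components]) simp
    show "(\<lambda>\<omega>. X j (\<omega> 1)) \<in> borel_measurable tape_space" for j
      by (rule measurable_compose[OF _ X_meas]) simp
  qed
  have Xr: "integrable run_space (\<lambda>\<omega>. X j (\<omega> j 1))" if "j < ?n" for j
    using integrable_run_component[OF X_meas] X_int(1)[OF that] by simp
  show "integrable run_space (\<lambda>\<omega>. exp (load ps (run draw_mechanism s ps \<omega>) i / (s ! i * B)))"
    unfolding eq using Xr by (intro runs.indep_vars_integrable[OF _ ind]) auto
  have "(\<integral>\<omega>. exp (load ps (run draw_mechanism s ps \<omega>) i / (s ! i * B)) \<partial>run_space) = (\<Prod>j<?n. \<integral>\<omega>. X j (\<omega> j 1) \<partial>run_space)"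
    unfolding eq using Xr by (intro runs.indep_vars_lebesgue_integral[OF _ ind]) auto
  also have "\<dots> = (\<Prod>j<?n. integral\<^sup>L unif (X j))" using integral_run_component[OF X_meas] by simp
  also have "\<dots> \<le> (\<Prod>j<?n. exp (2 * c j * x j))"
    using X_int(2) by (intro prod_mono) (auto intro!: Bochner_Integration.integral_nonneg simp: X_def)
  also have "\<dots> = exp (\<Sum>j<?n. 2 * c j * x j)" by (simp add: exp_sum)
  also have "(\<Sum>j<?n. 2 * c j * x j) \<le> 2 + 2 * ln ?m"
  proof -
    have "(\<Sum>j<?n. 2 * c j * x j) \<le> (\<Sum>j<?n. (2 / B) * (ps ! j / tail_sum ?s ?m (?l j)))"
    proof (rule sum_mono)
      fix j assume "j \<in> {..<?n}"
      then have j: "j < ?n" by simp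
      have "0 < tail_sum ?s ?m (?l j)" by (rule tail_sum_level_pos[OF pos(1,2) posj[OF j]])
      \<comment> \<open>The speed \<open>s ! i\<close> cancels against the one in
        \<open>c j\<close>, so the bound is the same for all machines.\<close>
      then have "x j \<le> s ! i / tail_sum ?s ?m (?l j)" unfolding x_def share_def using si by (intro divide_right_mono) auto
      then have "2 * c j * x j \<le> 2 * c j * (s ! i / tail_sum ?s ?m (?l j))" using c0[OF j] by (intro mult_left_mono) auto
      also have "\<dots> = (2 / B) * (ps ! j / tail_sum ?s ?m (?l j))" using si by (simp add: c_def)
      finally show "2 * c j * x j \<le> (2 / B) * (ps ! j / tail_sum ?s ?m (?l j))" .
    qed
    also have "\<dots> = (2 / B) * (\<Sum>j<?n. ps ! j / tail_sum ?s ?m (?l j))" by (simp only: sum_distrib_left)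
    also have "\<dots> \<le> (2 / B) * (2 * ?T * (1 + ln ?m))"
      using B by (intro mult_left_mono sum_div_level_le[OF pos]) auto
    also have "\<dots> \<le> (2 / B) * (B * (1 + ln ?m))"
    proof -
      have "1 \<le> real ?m" using pos(1) by linarith
      then have "0 \<le> 1 + ln ?m" using ln_ge_zero by fastforce
      then show ?thesis using B by (intro mult_left_mono mult_right_mono) auto
    qed
    also have "\<dots> = 2 + 2 * ln ?m" using B by simp
    finally show ?thesis .
  qed
  finally show "(\<integral>\<omega>. exp (load ps (run draw_mechanism s ps \<omega>) i / (s ! i * B)) \<partial>run_space) \<le> exp (2 + 2 * ln ?m)" by simp
qed

text \<open>With no jobs the optimum is 0 and loads cannot be normalized by it, so this case is
  separate.\<close>

lemma makespan_run_empty: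
  assumes "s \<noteq> []"
  shows "makespan s [] (run M s [] \<omega>) = 0" "OPT s [] = 0"
proof -
  have 0: "makespan s [] [] = 0"
  proof -
    have "(\<lambda>i. load [] [] i / s ! i) ` {..<length s} = {0}" using assms by (auto simp: load_def image_def)
    then show ?thesis by (simp add: makespan_def)
  qed
  then show "makespan s [] (run M s [] \<omega>) = 0" by (simp add: run_def)
  obtain a where "a \<in> assignments (length s) (length ([] :: real list))" "makespan s [] a = OPT s []"
    by (rule OPT_attained[OF assms])
  then show "OPT s [] = 0" using 0 by (simp add: assignments_def)
qed

text \<open>\<open>Z\<close> sums the exponentials of all normalized completion times, so its
  logarithm dominates their maximum; summing over the machines turns \<open>2 * ln m\<close> into
  \<open>3 * ln m\<close>. Both competitive bounds follow from the mean of \<open>Z\<close>.\<close>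

lemma makespan_moment:
  assumes "s \<noteq> []" "positive s" "positive ps" "ps \<noteq> []"
  defines "B \<equiv> 2 * OPT s ps"
  obtains Z where "integrable run_space Z" "\<And>\<omega>. 0 < Z \<omega>" "integral\<^sup>L run_space Z \<le> exp (2 + 3 * ln (length s))"
    "\<And>\<omega>. makespan s ps (run draw_mechanism s ps \<omega>) \<le> B * ln (Z \<omega>)"
proof -
  let ?m = "length s"
  define f where "f i \<omega> = exp (load ps (run draw_mechanism s ps \<omega>) i / (s ! i * B))" for i \<omega>
  define Z where "Z \<omega> = (\<Sum>i<?m. f i \<omega>)" for \<omega>
  have B: "0 < B" unfolding B_def using OPT_pos[OF assms(1-4)] by simp
  have m: "0 < ?m" using assms by simp
  have f: "integrable run_space (f i)" "integral\<^sup>L run_space (f i) \<le> exp (2 + 2 * ln ?m)" if "i < ?m" for i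
    unfolding f_def[abs_def] B_def using exp_load_le[OF assms(1-4) that] by auto
  have Z0: "0 < Z \<omega>" for \<omega> unfolding Z_def using m by (intro sum_pos) (auto simp: f_def)
  have "integral\<^sup>L run_space Z = (\<Sum>i<?m. integral\<^sup>L run_space (f i))"
    unfolding Z_def[abs_def] using f by (intro Bochner_Integration.integral_sum) auto
  also have "\<dots> \<le> (\<Sum>i<?m. exp (2 + 2 * ln ?m))" using f by (intro sum_mono) auto
  also have "\<dots> = exp (ln ?m) * exp (2 + 2 * ln ?m)" using m by simp
  also have "\<dots> = exp (2 + 3 * ln ?m)" unfolding exp_add[symmetric] by simp
  finally have EZ: "integral\<^sup>L run_space Z \<le> exp (2 + 3 * ln ?m)" .
  show ?thesis
  proof (rule that[of Z])
    show "integrable run_space Z" unfolding Z_def[abs_def] using f by auto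
    fix \<omega>
    show "makespan s ps (run draw_mechanism s ps \<omega>) \<le> B * ln (Z \<omega>)"
      unfolding makespan_def
    proof (rule Max.boundedI)
      fix y assume "y \<in> (\<lambda>i. load ps (run draw_mechanism s ps \<omega>) i / s ! i) ` {..<?m}"
      then obtain i where i: "i < ?m" "y = load ps (run draw_mechanism s ps \<omega>) i / s ! i" by auto
      have "f i \<omega> \<le> Z \<omega>" unfolding Z_def using i by (intro member_le_sum) (auto simp: f_def)
      then have "ln (f i \<omega>) \<le> ln (Z \<omega>)" by (subst ln_le_cancel_iff) (auto simp: Z0, simp add: f_def)
      then have "y / B \<le> ln (Z \<omega>)" by (simp add: f_def i(2))
      then show "y \<le> B * ln (Z \<omega>)" using B by (simp add: pos_divide_le_eq mult.commute)
    qed (use m in auto)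
  qed (use Z0 EZ in auto)
qed

lemma measurable_makespan_run [measurable]:
  "(\<lambda>\<omega>. makespan s ps (run draw_mechanism s ps \<omega>)) \<in> borel_measurable run_space"
proof -
  have [measurable]: "(\<lambda>\<omega>. \<omega> j k) \<in> borel_measurable run_space" for j k
    by (rule measurable_compose[OF measurable_run_component measurable_tape_component])
  have *: "(\<lambda>\<omega>. of_bool (draw ((!) s) (length s) y (\<omega> j 1) = i) :: real) \<in> borel_measurable run_space" for y j i
    by (rule measurable_compose[where f = "\<lambda>\<omega>. \<omega> j 1" and N = borel])
      (auto intro: measurable_compose[OF measurable_draw])
  show ?thesis unfolding makespan_def load_run_draw_mechanism
    by (intro borel_measurable_Max finite_lessThan borel_measurable_divide borel_measurable_sum
      borel_measurable_times borel_measurable_const *)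
qed

section \<open>Bounds in expectation and with high probability\<close>

text \<open>Instead of Jensen's inequality, the tangent of the logarithm at \<open>?K\<close>, the
  bound for the mean of \<open>Z\<close>: \<open>ln z \<le> ln ?K + z / ?K - 1\<close>. Integration
  leaves \<open>2 * OPT * ln ?K\<close>.\<close>

lemma competitive_expectation:
  assumes "1 \<le> m"
  shows "competitive_in_expectation draw_mechanism m (4 + 6 * ln m)"
  unfolding competitive_in_expectation_def
proof (intro allI impI, elim conjE)
  fix s ps assume s: "length s = m" "positive s" and ps: "positive ps"
  then have ne: "s \<noteq> []" using assms by auto
  let ?X = "\<lambda>\<omega>. makespan s ps (run draw_mechanism s ps \<omega>)"
  show "integrable run_space ?X \<and> (\<integral>\<omega>. ?X \<omega> \<partial>run_space) \<le> (4 + 6 * ln m) * OPT s ps"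
  proof (cases "ps = []")
    case True
    then show ?thesis by (simp add: makespan_run_empty[OF ne])
  next
    case False
    let ?B = "2 * OPT s ps" and ?K = "exp (2 + 3 * ln (real m))"
    obtain Z where Z: "integrable run_space Z" "\<And>\<omega>. 0 < Z \<omega>" "integral\<^sup>L run_space Z \<le> ?K"
      "\<And>\<omega>. ?X \<omega> \<le> ?B * ln (Z \<omega>)"
      using makespan_moment[OF ne s(2) ps False] unfolding s(1) by metis
    have B: "0 < ?B" using OPT_pos[OF ne s(2) ps False] by simp
    have le: "?X \<omega> \<le> ?B * (1 + 3 * ln m + Z \<omega> / ?K)" for \<omega>
    proof -
      have "ln (Z \<omega> / ?K) \<le> Z \<omega> / ?K - 1" using Z(2) by (intro ln_le_minus_one) auto
      moreover have "ln (Z \<omega> / ?K) = ln (Z \<omega>) - (2 + 3 * ln m)"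
        using Z(2)[of \<omega>] by (subst ln_div) auto
      ultimately have "?B * ln (Z \<omega>) \<le> ?B * (1 + 3 * ln m + Z \<omega> / ?K)" using B by (intro mult_left_mono) auto
      with Z(4) show ?thesis by (rule order_trans)
    qed
    have nonneg: "0 \<le> ?X \<omega>" for \<omega>
    proof -
      have "0 \<le> load ps (run draw_mechanism s ps \<omega>) 0"
        unfolding load_run_draw_mechanism using ps by (intro sum_nonneg) (auto simp: positive_def less_imp_le)
      also have "\<dots> \<le> ?X \<omega> * s ! 0" using s assms by (intro makespan_ge) auto
      finally show ?thesis using s assms ne by (auto simp: positive_def zero_le_mult_iff nth_mem dest!: bspec[OF _ nth_mem[of 0 s]])
    qed
    have int: "integrable run_space (\<lambda>\<omega>. ?B * (1 + 3 * ln m + Z \<omega> / ?K))" using Z(1) by auto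
    have "integrable run_space ?X"
      using nonneg le by (intro Bochner_Integration.integrable_bound[OF int]) (auto intro!: AE_I2 order_trans[OF _ abs_ge_self])
    moreover have "(\<integral>\<omega>. ?X \<omega> \<partial>run_space) \<le> (\<integral>\<omega>. ?B * (1 + 3 * ln m + Z \<omega> / ?K) \<partial>run_space)"
      using calculation int le by (intro integral_mono) auto
    moreover have "\<dots> = ?B * (1 + 3 * ln m + integral\<^sup>L run_space Z / ?K)"
      using Z(1) runs.prob_space by simp
    moreover have "\<dots> \<le> ?B * (1 + 3 * ln m + 1)" using B Z(3) by (intro mult_left_mono add_left_mono) auto
    ultimately show ?thesis by (simp add: algebra_simps)
  qed
qed

text \<open>Markov's inequality for \<open>Z\<close>: a makespan above \<open>?c * OPT\<close>
  forces \<open>Z\<close> above \<open>exp (?c / 2)\<close>, and \<open>?c / 2\<close> exceeds the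
  logarithm of the bound for the mean by exactly \<open>k * ln m\<close>.\<close>

lemma competitive_prob:
  fixes k :: nat
  assumes "1 \<le> m"
  shows "competitive_with_prob draw_mechanism m (4 + (6 + 2 * real k) * ln m) (1 - 1 / real m ^ k)"
  unfolding competitive_with_prob_def
proof (intro allI impI, elim conjE)
  fix s ps assume s: "length s = m" "positive s" and ps: "positive ps"
  then have ne: "s \<noteq> []" using assms by auto
  let ?X = "\<lambda>\<omega>. makespan s ps (run draw_mechanism s ps \<omega>)"
  let ?c = "4 + (6 + 2 * real k) * ln m"
  show "1 - 1 / real m ^ k \<le> runs.prob {\<omega> \<in> space run_space. ?X \<omega> \<le> ?c * OPT s ps}"
  proof (cases "ps = []")
    case True
    then show ?thesis using runs.prob_space by (simp add: makespan_run_empty[OF ne])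
  next
    case False
    let ?B = "2 * OPT s ps" and ?K = "exp (2 + 3 * ln (real m))"
    obtain Z where Z: "integrable run_space Z" "\<And>\<omega>. 0 < Z \<omega>" "integral\<^sup>L run_space Z \<le> ?K"
      "\<And>\<omega>. ?X \<omega> \<le> ?B * ln (Z \<omega>)"
      using makespan_moment[OF ne s(2) ps False] unfolding s(1) by metis
    have [measurable]: "Z \<in> borel_measurable run_space" using Z(1) by auto
    have B: "0 < ?B" using OPT_pos[OF ne s(2) ps False] by simp
    let ?a = "exp (?c / 2)"
    have "{\<omega> \<in> space run_space. \<not> ?X \<omega> \<le> ?c * OPT s ps} \<subseteq> {\<omega> \<in> space run_space. ?a \<le> Z \<omega>}"
    proof safe
      fix \<omega> assume "\<not> ?X \<omega> \<le> ?c * OPT s ps"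
      then have "?B * (?c / 2) < ?B * ln (Z \<omega>)" using Z(4)[of \<omega>] by (simp add: mult.commute)
      then have "?c / 2 < ln (Z \<omega>)" using B by (simp only: mult_less_cancel_left_pos)
      then have "?a < exp (ln (Z \<omega>))" by (simp only: exp_less_cancel_iff)
      then show "?a \<le> Z \<omega>" using Z(2)[of \<omega>] by simp
    qed
    then have "runs.prob {\<omega> \<in> space run_space. \<not> ?X \<omega> \<le> ?c * OPT s ps} \<le> runs.prob {\<omega> \<in> space run_space. ?a \<le> Z \<omega>}"
      by (intro runs.finite_measure_mono) measurable
    also have "\<dots> \<le> integral\<^sup>L run_space Z / ?a"
      using Z by (intro integral_Markov_inequality_measure[where A = "{}"]) (auto simp: less_imp_le)
    also have "\<dots> \<le> ?K / ?a" using Z(3) by (intro divide_right_mono) auto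
    also have "\<dots> = exp (- (real k * ln m))" unfolding exp_diff[symmetric] by (simp add: algebra_simps add_divide_distrib)
    also have "\<dots> = 1 / real m ^ k" using assms by (simp add: exp_minus exp_of_nat_mult inverse_eq_divide)
    finally have "runs.prob {\<omega> \<in> space run_space. \<not> ?X \<omega> \<le> ?c * OPT s ps} \<le> 1 / real m ^ k" .
    moreover have "runs.prob {\<omega> \<in> space run_space. \<not> ?X \<omega> \<le> ?c * OPT s ps} = 1 - runs.prob {\<omega> \<in> space run_space. ?X \<omega> \<le> ?c * OPT s ps}"
      by (rule runs.prob_neg) measurable
    ultimately show ?thesis by simp
  qed
qed

lemma affine_ln_bigo: "(\<lambda>m. a + b * ln (real m)) \<in> O(\<lambda>m. ln (real m))"
proof (rule bigoI[of _ "\<bar>a\<bar> + \<bar>b\<bar>"])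
  show "\<forall>\<^sub>F m in sequentially. norm (a + b * ln (real m)) \<le> (\<bar>a\<bar> + \<bar>b\<bar>) * norm (ln (real m))"
  \<comment> \<open>From 3 on, \<open>ln m\<close> is at least 1 and absorbs the constant
    term.\<close>
  proof (rule eventually_sequentiallyI[of 3])
    fix m :: nat assume m: "3 \<le> m"
    have "exp 1 \<le> real m" using exp_le m by linarith
    then have "1 \<le> ln (real m)" using m by (subst ln_ge_iff) auto
    then have "\<bar>a\<bar> * 1 \<le> \<bar>a\<bar> * \<bar>ln (real m)\<bar>" by (intro mult_left_mono) auto
    then show "norm (a + b * ln (real m)) \<le> (\<bar>a\<bar> + \<bar>b\<bar>) * norm (ln (real m))"
      using abs_triangle_ineq[of a "b * ln (real m)"] by (simp add: abs_mult algebra_simps)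
  qed
qed

section \<open>Time-bounded program verification\<close>

text \<open>Termination is included, and the postcondition also sees the number of steps, so result
  and running time are proved together.\<close>

definition wp :: "com \<Rightarrow> (nat \<Rightarrow> state \<Rightarrow> bool) \<Rightarrow> state \<Rightarrow> bool" where
  "wp c Q st \<longleftrightarrow> (\<exists>t st'. exec c st t st' \<and> Q t st')"

lemma wp_Skip: "Q 1 st \<Longrightarrow> wp Skip Q st"
  unfolding wp_def by (intro exI conjI, rule exec.Skip)

lemma wp_IAssign: "Q 1 (st\<lparr>ints := set_cell (ints st) x (ival k st) (ival e st)\<rparr>) \<Longrightarrow> wp (IAssign x k e) Q st"
  unfolding wp_def by (intro exI conjI, rule exec.IAssign)

lemma wp_RAssign: "Q 1 (st\<lparr>reals := set_cell (reals st) x (ival k st) (rval e st)\<rparr>) \<Longrightarrow> wp (RAssign x k e) Q st"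
  unfolding wp_def by (intro exI conjI, rule exec.RAssign)

lemma wp_Sample:
  "Q 1 (st\<lparr>reals := set_cell (reals st) x (ival k st) (rands st 0), rands := (\<lambda>l. rands st (Suc l))\<rparr>) \<Longrightarrow>
    wp (Sample x k) Q st"
  unfolding wp_def by (intro exI conjI, rule exec.Sample)

lemma wp_Seq: "wp c (\<lambda>t. wp d (\<lambda>u. Q (t + u))) st \<Longrightarrow> wp (Seq c d) Q st"
  unfolding wp_def by (meson exec.Seq)

lemma wp_Cond:
  "(bval b st \<Longrightarrow> wp c (\<lambda>t. Q (Suc t)) st) \<Longrightarrow> (\<not> bval b st \<Longrightarrow> wp d (\<lambda>t. Q (Suc t)) st) \<Longrightarrow> wp (Cond b c d) Q st"
  unfolding wp_def by (meson exec.CondTrue exec.CondFalse)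

lemma wp_conseq: "wp c Q st \<Longrightarrow> (\<And>t st'. Q t st' \<Longrightarrow> Q' t st') \<Longrightarrow> wp c Q' st"
  unfolding wp_def by blast

lemma wp_Seq_conseq:
  "wp c P st \<Longrightarrow> (\<And>t st'. P t st' \<Longrightarrow> wp d (\<lambda>u. Q (t + u)) st') \<Longrightarrow> wp (Seq c d) Q st"
  by (intro wp_Seq) (rule wp_conseq)

lemmas wp_intros = wp_Skip wp_IAssign wp_RAssign wp_Sample wp_Seq wp_Cond

abbreviation ivar :: "string \<Rightarrow> iexp" where "ivar x \<equiv> ICell x (INum 0)"
abbreviation rvar :: "string \<Rightarrow> rexp" where "rvar x \<equiv> RCell x (INum 0)"
abbreviation iset :: "string \<Rightarrow> iexp \<Rightarrow> com" where "iset x e \<equiv> IAssign x (INum 0) e"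
abbreviation rset :: "string \<Rightarrow> rexp \<Rightarrow> com" where "rset x e \<equiv> RAssign x (INum 0) e"

definition For :: "string \<Rightarrow> iexp \<Rightarrow> com \<Rightarrow> com" where
  "For x e c = Seq (iset x (INum 0)) (While (ILess (ivar x) e) (Seq c (iset x (ISuc (ivar x)))))"

text \<open>Each round adds the test and the increment to the cost \<open>B\<close> of the body; the
  final 2 stands for the initialization and the failing test. \<open>M\<close> caps the number of
  rounds, so nested loops get bounds in a single size.\<close>

lemma wp_For:
  assumes bound: "\<And>k st'. I k st' \<Longrightarrow> ints st' x 0 = k \<and> ival e st' = N"
    and init: "I 0 (st\<lparr>ints := set_cell (ints st) x 0 0\<rparr>)"
    and step: "\<And>k st'. k < N \<Longrightarrow> I k st' \<Longrightarrow>
      wp c (\<lambda>t st''. t \<le> B \<and> ints st'' x 0 = k \<and> I (Suc k) (st''\<lparr>ints := set_cell (ints st'') x 0 (Suc k)\<rparr>)) st'"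
    and N: "N \<le> M"
  shows "wp (For x e c) (\<lambda>t st'. t \<le> M * (B + 2) + 2 \<and> I N st') st"
proof -
  let ?c = "Seq c (iset x (ISuc (ivar x)))"
  let ?w = "While (ILess (ivar x) e) ?c"
  have loop: "\<exists>t st''. exec ?w st' t st'' \<and> t \<le> j * (B + 2) + 1 \<and> I N st''"
    if "I k st'" "N = k + j" for j k st'
    using that
  proof (induction j arbitrary: k st')
    case 0
    then have "exec ?w st' 1 st'" using bound by (intro WhileFalse) force
    then show ?case using 0 by auto
  next
    case (Suc j)
    then obtain t st'' where t: "exec c st' t st''" "t \<le> B" "ints st'' x 0 = k"
      "I (Suc k) (st''\<lparr>ints := set_cell (ints st'') x 0 (Suc k)\<rparr>)"
      using step[of k st'] by (auto simp: wp_def)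
    have "exec (iset x (ISuc (ivar x))) st'' 1 (st''\<lparr>ints := set_cell (ints st'') x 0 (Suc k)\<rparr>)"
      using exec.IAssign[of x "INum 0" "ISuc (ivar x)" st''] t(3) by simp
    note body = exec.Seq[OF t(1) this]
    from Suc.IH[OF t(4)] Suc.prems(2) obtain u st3 where u:
      "exec ?w (st''\<lparr>ints := set_cell (ints st'') x 0 (Suc k)\<rparr>) u st3" "u \<le> j * (B + 2) + 1" "I N st3"
      by auto
    have "bval (ILess (ivar x) e) st'" using bound[OF Suc.prems(1)] Suc.prems(2) by simp
    from exec.WhileTrue[OF this body u(1)] show ?case
      using u t(2) by (intro exI[of _ "Suc (t + 1 + u)"] exI[of _ st3] conjI) auto
  qed
  have "exec (iset x (INum 0)) st 1 (st\<lparr>ints := set_cell (ints st) x 0 0\<rparr>)"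
    using exec.IAssign[of x "INum 0" "INum 0" st] by simp
  moreover obtain t st' where "exec ?w (st\<lparr>ints := set_cell (ints st) x 0 0\<rparr>) t st'" "t \<le> N * (B + 2) + 1" "I N st'"
    using loop[OF init] by auto
  moreover have "N * (B + 2) \<le> M * (B + 2)" using N by (rule mult_le_mono1)
  ultimately show ?thesis unfolding wp_def For_def
    by (intro exI[of _ "1 + t"] exI[of _ st'] conjI exec.Seq) auto
qed

text \<open>A frame condition by array names, the integer and the real array of one name being taken
  together.\<close>

definition unchanged :: "string set \<Rightarrow> state \<Rightarrow> state \<Rightarrow> bool" where
  "unchanged V st st' \<longleftrightarrow> (\<forall>x. x \<notin> V \<longrightarrow> ints st' x = ints st x \<and> reals st' x = reals st x)"

definition sum_prog :: "iexp \<Rightarrow> bexp \<Rightarrow> rexp \<Rightarrow> string \<Rightarrow> com" where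
  "sum_prog e b g x = Seq (rset x (RNum 0))
     (For ''k'' e (Cond b (rset x (RAdd (rvar x) g)) Skip))"

lemma wp_sum:
  assumes e: "\<And>st'. unchanged {''k'', x} st st' \<Longrightarrow> ival e st' = N"
    and g: "\<And>st' j. unchanged {''k'', x} st st' \<Longrightarrow> ints st' ''k'' 0 = j \<Longrightarrow> j < N \<Longrightarrow>
      bval b st' = P j \<and> (P j \<longrightarrow> rval g st' = G j)"
    and N: "N \<le> M"
  shows "wp (sum_prog e b g x) (\<lambda>t st'. t \<le> 4 * M + 3 \<and> unchanged {''k'', x} st st' \<and>
    reals st' x 0 = (\<Sum>j<N. if P j then G j else 0)) st"
proof -
  let ?I = "\<lambda>j st'. unchanged {''k'', x} st st' \<and> ints st' ''k'' 0 = j \<and>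
    reals st' x 0 = (\<Sum>i<j. if P i then G i else 0)"
  show ?thesis unfolding sum_prog_def
  proof (intro wp_Seq wp_RAssign, rule wp_conseq[OF wp_For[where I = ?I and N = N and M = M and B = 2]])
    fix j st' assume j: "j < N" and I: "?I j st'"
    then have "bval b st' = P j" "P j \<Longrightarrow> rval g st' = G j" using g by auto
    then show "wp (Cond b (rset x (RAdd (rvar x) g)) Skip) (\<lambda>t st''. t \<le> 2 \<and> ints st'' ''k'' 0 = j \<and>
        ?I (Suc j) (st''\<lparr>ints := set_cell (ints st'') ''k'' 0 (Suc j)\<rparr>)) st'"
      using I by (intro wp_intros) (auto simp: unchanged_def set_cell_def)
  qed (use e N in \<open>auto simp: unchanged_def set_cell_def\<close>)
qed

definition tail_sum_prog :: "string \<Rightarrow> iexp \<Rightarrow> string \<Rightarrow> string \<Rightarrow> com" where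
  "tail_sum_prog f e y x = sum_prog e (BNot (RLess (RCell f (ivar ''k'')) (rvar y))) (RCell f (ivar ''k'')) x"

lemma wp_tail_sum:
  assumes "\<And>st'. unchanged {''k'', x} st st' \<Longrightarrow> ival e st' = N" "N \<le> M"
    and "x \<noteq> f" "x \<noteq> y" "f \<noteq> ''k''" "y \<noteq> ''k''"
  shows "wp (tail_sum_prog f e y x) (\<lambda>t st'. t \<le> 4 * M + 3 \<and> unchanged {''k'', x} st st' \<and>
    reals st' x 0 = tail_sum (reals st f) N (reals st y 0)) st"
  unfolding tail_sum_prog_def tail_sum_def
  by (rule wp_sum) (use assms in \<open>auto simp: unchanged_def\<close>)

section \<open>Programs for the fees and payments\<close>

text \<open>
  The cells \<open>y\<close>, \<open>W\<close> hold \<open>p q\<close> and the total size of the jobs that are at least as large, \<open>z\<close>, \<open>S\<close>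
  a speed and the total speed of the machines that are at least as fast, \<open>c\<close> and \<open>t\<close> the current
  values of \<open>crit\<close> and \<open>lower_bound\<close>, \<open>l\<close> the job under consideration.
\<close>

definition crit_update :: com where
  "crit_update =
     Seq (rset ''v'' (RDiv (rvar ''y'') (rvar ''z'')))
     (Seq (rset ''w'' (RDiv (rvar ''W'') (rvar ''S'')))
     (Seq (Cond (RLess (rvar ''v'') (rvar ''w'')) (rset ''v'' (rvar ''w'')) Skip)
          (Cond (BAnd (BNot (ILess (ivar ''i'') (INum 1))) (BNot (RLess (rvar ''v'') (rvar ''c'')))) Skip
             (rset ''c'' (rvar ''v'')))))"

text \<open>Machine 0 starts the minimum, since there is no infinite initial value.\<close>

lemma wp_crit_update:
  "wp crit_update (\<lambda>t st'. t \<le> 6 \<and> unchanged {''v'', ''w'', ''c''} st st' \<and>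
     reals st' ''c'' 0 = (let x = max (reals st ''y'' 0 / reals st ''z'' 0) (reals st ''W'' 0 / reals st ''S'' 0)
       in if ints st ''i'' 0 = 0 then x else min x (reals st ''c'' 0))) st"
  unfolding crit_update_def
  by (intro wp_intros) (auto simp: unchanged_def set_cell_def max_def min_def Let_def)

definition crit_prog :: com where
  "crit_prog = For ''i'' (ivar ''m'')
     (Seq (rset ''z'' (RCell ''s'' (ivar ''i'')))
     (Seq (tail_sum_prog ''s'' (ivar ''m'') ''z'' ''S'') crit_update))"

lemma Min_image_lessThan_Suc:
  "Min (f ` {..<Suc k}) = (if k = 0 then f 0 else min (f k) (Min (f ` {..<k})))" for f :: "nat \<Rightarrow> real"
  using Min_insert[of "f ` {..<k}" "f k"] by (auto simp: lessThan_Suc lessThan_empty_iff)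

abbreviation "crit_vars \<equiv> {''k'', ''i'', ''z'', ''S'', ''v'', ''w'', ''c''}"

lemma wp_crit:
  assumes "ints st ''m'' 0 = m" "0 < m" "m \<le> M"
  shows "wp crit_prog (\<lambda>t st'. t \<le> M * (4 * M + 12) + 2 \<and> unchanged crit_vars st st' \<and>
    reals st' ''c'' 0 = Min ((\<lambda>i. max (reals st ''y'' 0 / reals st ''s'' i)
      (reals st ''W'' 0 / tail_sum (reals st ''s'') m (reals st ''s'' i))) ` {..<m})) st"
proof -
  define f where "f i = max (reals st ''y'' 0 / reals st ''s'' i)
      (reals st ''W'' 0 / tail_sum (reals st ''s'') m (reals st ''s'' i))" for i
  let ?I = "\<lambda>k st'. unchanged crit_vars st st' \<and> ints st' ''i'' 0 = k \<and>
    (0 < k \<longrightarrow> reals st' ''c'' 0 = Min (f ` {..<k}))"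
  show ?thesis unfolding crit_prog_def f_def[symmetric]
  proof (rule wp_conseq[OF wp_For[where I = ?I and N = m and M = M and B = "4 * M + 10"]])
    fix k st' assume k: "k < m" and I: "?I k st'"
    define st0 where "st0 = st'\<lparr>reals := set_cell (reals st') ''z'' 0 (reals st' ''s'' k)\<rparr>"
    have st0: "unchanged crit_vars st st0" "ints st0 ''i'' 0 = k" "reals st0 ''z'' 0 = reals st ''s'' k"
      "reals st0 ''c'' 0 = reals st' ''c'' 0"
      using I by (simp_all add: unchanged_def set_cell_def st0_def)
    have "wp (tail_sum_prog ''s'' (ivar ''m'') ''z'' ''S'') (\<lambda>t. wp crit_update (\<lambda>u st''.
        1 + (t + u) \<le> 4 * M + 10 \<and> ints st'' ''i'' 0 = k \<and>
        ?I (Suc k) (st''\<lparr>ints := set_cell (ints st'') ''i'' 0 (Suc k)\<rparr>))) st0"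
    proof (rule wp_conseq[OF wp_tail_sum[where N = m and M = M]])
      fix t st1
      assume 1: "t \<le> 4 * M + 3 \<and> unchanged {''k'', ''S''} st0 st1 \<and>
        reals st1 ''S'' 0 = tail_sum (reals st0 ''s'') m (reals st0 ''z'' 0)"
      have 2: "reals st1 ''S'' 0 = tail_sum (reals st ''s'') m (reals st ''s'' k)" "reals st1 ''z'' 0 = reals st ''s'' k"
        "reals st1 ''y'' 0 = reals st ''y'' 0" "reals st1 ''W'' 0 = reals st ''W'' 0"
        "reals st1 ''c'' 0 = reals st' ''c'' 0" "ints st1 ''i'' 0 = k" "unchanged crit_vars st st1"
        using 1 st0 by (simp_all add: unchanged_def)
      show "wp crit_update (\<lambda>u st''. 1 + (t + u) \<le> 4 * M + 10 \<and> ints st'' ''i'' 0 = k \<and>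
        ?I (Suc k) (st''\<lparr>ints := set_cell (ints st'') ''i'' 0 (Suc k)\<rparr>)) st1"
      proof (rule wp_conseq[OF wp_crit_update])
        fix u :: nat and st2
        assume 3: "u \<le> 6 \<and> unchanged {''v'', ''w'', ''c''} st1 st2 \<and>
          reals st2 ''c'' 0 = (let x = max (reals st1 ''y'' 0 / reals st1 ''z'' 0) (reals st1 ''W'' 0 / reals st1 ''S'' 0)
            in if ints st1 ''i'' 0 = 0 then x else min x (reals st1 ''c'' 0))"
        then have "reals st2 ''c'' 0 = Min (f ` {..<Suc k})"
          using I unfolding Min_image_lessThan_Suc by (simp add: 2 f_def)
        moreover have "unchanged crit_vars st st2" "ints st2 ''i'' 0 = k"
          using 2 3 by (simp_all add: unchanged_def)
        ultimately show "1 + (t + u) \<le> 4 * M + 10 \<and> ints st2 ''i'' 0 = k \<and>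
            ?I (Suc k) (st2\<lparr>ints := set_cell (ints st2) ''i'' 0 (Suc k)\<rparr>)"
          using 1 3 by (simp add: unchanged_def set_cell_def)
      qed
    qed (use assms st0 in \<open>simp_all add: unchanged_def\<close>)
    then show "wp (Seq (rset ''z'' (RCell ''s'' (ivar ''i''))) (Seq (tail_sum_prog ''s'' (ivar ''m'') ''z'' ''S'') crit_update))
      (\<lambda>t st''. t \<le> 4 * M + 10 \<and> ints st'' ''i'' 0 = k \<and>
        ?I (Suc k) (st''\<lparr>ints := set_cell (ints st'') ''i'' 0 (Suc k)\<rparr>)) st'"
      unfolding st0_def using I by (intro wp_Seq wp_RAssign) simp
  qed (use assms in \<open>simp_all add: unchanged_def set_cell_def add.commute\<close>)
qed

definition level_update :: com where
  "level_update = Cond (RLess (rvar ''t'') (rvar ''c'')) (rset ''t'' (rvar ''c'')) Skip"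

lemma wp_level_update:
  "wp level_update (\<lambda>t st'. t \<le> 2 \<and> unchanged {''t''} st st' \<and>
     reals st' ''t'' 0 = max (reals st ''c'' 0) (reals st ''t'' 0)) st"
  unfolding level_update_def by (intro wp_intros) (auto simp: unchanged_def set_cell_def)

definition level_body :: com where
  "level_body = Seq (rset ''y'' (RCell ''p'' (ivar ''q'')))
     (Seq (tail_sum_prog ''p'' (ISuc (ivar ''l'')) ''y'' ''W'') (Seq crit_prog level_update))"

definition level_prog :: com where
  "level_prog = Seq (rset ''t'' (RNum 0)) (Seq (For ''q'' (ISuc (ivar ''l'')) level_body)
     (rset ''lev'' (RDiv (RCell ''p'' (ivar ''l'')) (RMul (RNum 2) (rvar ''t'')))))"

abbreviation "body_vars \<equiv> {''k'', ''i'', ''z'', ''S'', ''v'', ''w'', ''c'', ''y'', ''W'', ''t''}"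
abbreviation "level_vars \<equiv> {''k'', ''i'', ''z'', ''S'', ''v'', ''w'', ''c'', ''y'', ''W'', ''t'', ''q'', ''lev''}"

text \<open>Polymorphic so that one expression serves as a number of steps and, at
  \<open>[:0, 1:]\<close>, as the polynomial bounding them; likewise for the other costs.\<close>

definition level_cost :: "'a::comm_semiring_1 \<Rightarrow> 'a" where
  "level_cost M = M * (M * (4 * M + 12) + 4 * M + 10) + 4"

lemma wp_level_body:
  assumes "ints st ''m'' 0 = m" "0 < m" "m \<le> M" "ints st ''l'' 0 = l" "Suc l \<le> M" "ints st ''q'' 0 = q"
  shows "wp level_body (\<lambda>t st'. t \<le> M * (4 * M + 12) + 4 * M + 8 \<and> unchanged body_vars st st' \<and>
    reals st' ''t'' 0 = max (crit (reals st ''s'') m (reals st ''p'') (Suc l) q) (reals st ''t'' 0)) st"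
  unfolding level_body_def
proof (intro wp_Seq wp_RAssign, rule wp_conseq[OF wp_tail_sum[where N = "Suc l" and M = M]])
  define st0 where "st0 = st\<lparr>reals := set_cell (reals st) ''y'' (ival (INum 0) st) (rval (RCell ''p'' (ivar ''q'')) st)\<rparr>"
  fix t1 st1
  assume "t1 \<le> 4 * M + 3 \<and> unchanged {''k'', ''W''} (st\<lparr>reals := set_cell (reals st) ''y'' (ival (INum 0) st) (rval (RCell ''p'' (ivar ''q'')) st)\<rparr>) st1 \<and>
    reals st1 ''W'' 0 = tail_sum (reals (st\<lparr>reals := set_cell (reals st) ''y'' (ival (INum 0) st) (rval (RCell ''p'' (ivar ''q'')) st)\<rparr>) ''p'') (Suc l)
      (reals (st\<lparr>reals := set_cell (reals st) ''y'' (ival (INum 0) st) (rval (RCell ''p'' (ivar ''q'')) st)\<rparr>) ''y'' 0)"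
  then have 1: "t1 \<le> 4 * M + 3" "unchanged {''k'', ''W''} st0 st1"
    "reals st1 ''W'' 0 = tail_sum (reals st0 ''p'') (Suc l) (reals st0 ''y'' 0)"
    unfolding st0_def[symmetric] by auto
  have 0: "unchanged {''y''} st st0" "reals st0 ''y'' 0 = reals st ''p'' q"
    using assms by (simp_all add: st0_def unchanged_def set_cell_def)
  have 2: "unchanged body_vars st st1" "reals st1 ''y'' 0 = reals st ''p'' q" "reals st1 ''t'' 0 = reals st ''t'' 0"
    "reals st1 ''W'' 0 = tail_sum (reals st ''p'') (Suc l) (reals st ''p'' q)" "ints st1 ''m'' 0 = m"
    "reals st1 ''s'' = reals st ''s''"
    using 0 1 assms by (simp_all add: unchanged_def)
  show "wp (Seq crit_prog level_update) (\<lambda>u st'. 1 + (t1 + u) \<le> M * (4 * M + 12) + 4 * M + 8 \<and> unchanged body_vars st st' \<and>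
    reals st' ''t'' 0 = max (crit (reals st ''s'') m (reals st ''p'') (Suc l) q) (reals st ''t'' 0)) st1"
  proof (rule wp_Seq_conseq[OF wp_crit[where m = m and M = M]])
    fix t2 st2
    assume 3: "t2 \<le> M * (4 * M + 12) + 2 \<and> unchanged crit_vars st1 st2 \<and>
      reals st2 ''c'' 0 = Min ((\<lambda>i. max (reals st1 ''y'' 0 / reals st1 ''s'' i)
        (reals st1 ''W'' 0 / tail_sum (reals st1 ''s'') m (reals st1 ''s'' i))) ` {..<m})"
    then have c: "reals st2 ''c'' 0 = crit (reals st ''s'') m (reals st ''p'') (Suc l) q"
      by (simp add: crit_def 2)
    have 4: "unchanged body_vars st st2" "reals st2 ''t'' 0 = reals st ''t'' 0"
      using 2 3 by (simp_all add: unchanged_def)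
    show "wp level_update (\<lambda>u st'. 1 + (t1 + (t2 + u)) \<le> M * (4 * M + 12) + 4 * M + 8 \<and> unchanged body_vars st st' \<and>
      reals st' ''t'' 0 = max (crit (reals st ''s'') m (reals st ''p'') (Suc l) q) (reals st ''t'' 0)) st2"
      by (rule wp_conseq[OF wp_level_update]) (use 1(1) 3 4 c in \<open>simp add: unchanged_def\<close>)
  qed (use assms 2 in simp_all)
qed (use assms in \<open>simp_all add: unchanged_def set_cell_def\<close>)

lemma wp_level:
  assumes "ints st ''m'' 0 = m" "0 < m" "m \<le> M" "ints st ''l'' 0 = l" "Suc l \<le> M"
  shows "wp level_prog (\<lambda>t st'. t \<le> level_cost M \<and> unchanged level_vars st st' \<and>
    reals st' ''lev'' 0 = level (reals st ''s'') m (reals st ''p'') l) st"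
proof -
  define f where "f = crit (reals st ''s'') m (reals st ''p'') (Suc l)"
  let ?V = "{''k'', ''i'', ''z'', ''S'', ''v'', ''w'', ''c'', ''y'', ''W'', ''t'', ''q''}"
  let ?I = "\<lambda>k st'. unchanged ?V st st' \<and> ints st' ''q'' 0 = k \<and>
    reals st' ''t'' 0 = Max (insert 0 (f ` {..<k}))"
  show ?thesis unfolding level_prog_def
  proof (intro wp_Seq wp_RAssign, rule wp_conseq[OF wp_For[where I = ?I and N = "Suc l" and M = M
        and B = "M * (4 * M + 12) + 4 * M + 8"]])
    fix k st' assume k: "k < Suc l" and I: "?I k st'"
    have Max: "Max (insert 0 (f ` {..<Suc k})) = max (f k) (Max (insert 0 (f ` {..<k})))"
      by (simp add: lessThan_Suc insert_commute[of 0])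
    show "wp level_body (\<lambda>t st''. t \<le> M * (4 * M + 12) + 4 * M + 8 \<and> ints st'' ''q'' 0 = k \<and>
        ?I (Suc k) (st''\<lparr>ints := set_cell (ints st'') ''q'' 0 (Suc k)\<rparr>)) st'"
      by (rule wp_conseq[OF wp_level_body[where m = m and l = l and q = k and M = M]])
        (use assms I in \<open>simp_all add: unchanged_def set_cell_def Max[unfolded f_def] f_def\<close>)
  next
    fix t st'
    assume "t \<le> M * (M * (4 * M + 12) + 4 * M + 8 + 2) + 2 \<and> ?I (Suc l) st'"
    then show "wp (rset ''lev'' (RDiv (RCell ''p'' (ivar ''l'')) (RMul (RNum 2) (rvar ''t''))))
       (\<lambda>u st'. 1 + (t + u) \<le> level_cost M \<and> unchanged level_vars st st' \<and>
          reals st' ''lev'' 0 = level (reals st ''s'') m (reals st ''p'') l) st'"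
      using assms by (intro wp_intros)
        (simp add: unchanged_def set_cell_def level_def lower_bound_def f_def level_cost_def add.commute)
  qed (use assms in \<open>simp_all add: unchanged_def set_cell_def\<close>)
qed

definition mean_prog :: com where
  "mean_prog = Seq level_prog (Seq (tail_sum_prog ''s'' (ivar ''m'') ''lev'' ''D'')
     (Seq (sum_prog (ivar ''m'') (BNot (RLess (RCell ''s'' (ivar ''k'')) (rvar ''lev''))) (RNum 1) ''N'')
          (rset ''g'' (RDiv (rvar ''N'') (rvar ''D'')))))"

abbreviation "mean_vars \<equiv> {''k'', ''i'', ''z'', ''S'', ''v'', ''w'', ''c'', ''y'', ''W'', ''t'', ''q'', ''lev'', ''D'', ''N'', ''g''}"

lemma wp_mean:
  assumes "ints st ''m'' 0 = m" "0 < m" "m \<le> M" "ints st ''l'' 0 = l" "Suc l \<le> M"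
  shows "wp mean_prog (\<lambda>t st'. t \<le> level_cost M + 8 * M + 7 \<and> unchanged mean_vars st st' \<and>
    reals st' ''g'' 0 = mean_inv (reals st ''s'') m (level (reals st ''s'') m (reals st ''p'') l)) st"
  unfolding mean_prog_def
proof (rule wp_Seq_conseq[OF wp_level[OF assms]], elim conjE)
  fix t1 st1
  assume 1: "t1 \<le> level_cost M" "unchanged level_vars st st1"
    "reals st1 ''lev'' 0 = level (reals st ''s'') m (reals st ''p'') l"
  have m1: "ints st1 ''m'' 0 = m" and s1: "reals st1 ''s'' = reals st ''s''" using 1 assms by (simp_all add: unchanged_def)
  show "wp (Seq (tail_sum_prog ''s'' (ivar ''m'') ''lev'' ''D'')
     (Seq (sum_prog (ivar ''m'') (BNot (RLess (RCell ''s'' (ivar ''k'')) (rvar ''lev''))) (RNum 1) ''N'')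
          (rset ''g'' (RDiv (rvar ''N'') (rvar ''D'')))))
    (\<lambda>u st'. t1 + u \<le> level_cost M + 8 * M + 7 \<and> unchanged mean_vars st st' \<and>
    reals st' ''g'' 0 = mean_inv (reals st ''s'') m (level (reals st ''s'') m (reals st ''p'') l)) st1"
  proof (rule wp_Seq_conseq[OF wp_tail_sum[where N = m and M = M]], unfold s1 1(3))
    fix t2 st2
    assume 2: "t2 \<le> 4 * M + 3 \<and> unchanged {''k'', ''D''} st1 st2 \<and>
      reals st2 ''D'' 0 = tail_sum (reals st ''s'') m (level (reals st ''s'') m (reals st ''p'') l)"
    have m2: "ints st2 ''m'' 0 = m" "reals st2 ''s'' = reals st ''s''"
      "reals st2 ''lev'' 0 = level (reals st ''s'') m (reals st ''p'') l" using 1 2 m1 s1 by (simp_all add: unchanged_def)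
    show "wp (Seq (sum_prog (ivar ''m'') (BNot (RLess (RCell ''s'' (ivar ''k'')) (rvar ''lev''))) (RNum 1) ''N'')
          (rset ''g'' (RDiv (rvar ''N'') (rvar ''D''))))
      (\<lambda>u st'. t1 + (t2 + u) \<le> level_cost M + 8 * M + 7 \<and> unchanged mean_vars st st' \<and>
      reals st' ''g'' 0 = mean_inv (reals st ''s'') m (level (reals st ''s'') m (reals st ''p'') l)) st2"
    proof (rule wp_Seq_conseq[OF wp_sum[where N = m and M = M and G = "\<lambda>_. 1"
            and P = "\<lambda>i. level (reals st ''s'') m (reals st ''p'') l \<le> reals st ''s'' i"]])
      fix t3 st3
      assume 3: "t3 \<le> 4 * M + 3 \<and> unchanged {''k'', ''N''} st2 st3 \<and> reals st3 ''N'' 0 =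
        (\<Sum>j<m. if level (reals st ''s'') m (reals st ''p'') l \<le> reals st ''s'' j then 1 else 0)"
      have "reals st3 ''D'' 0 = tail_sum (reals st ''s'') m (level (reals st ''s'') m (reals st ''p'') l)"
        "unchanged mean_vars st st3"
        using 1(2) 2 3 by (simp_all add: unchanged_def)
      with 1(1) 2 3 show "wp (rset ''g'' (RDiv (rvar ''N'') (rvar ''D'')))
        (\<lambda>u st'. t1 + (t2 + (t3 + u)) \<le> level_cost M + 8 * M + 7 \<and> unchanged mean_vars st st' \<and>
        reals st' ''g'' 0 = mean_inv (reals st ''s'') m (level (reals st ''s'') m (reals st ''p'') l)) st3"
        by (intro wp_intros) (simp add: unchanged_def set_cell_def mean_inv_def)
    qed (use assms m2 in \<open>simp_all add: unchanged_def not_less\<close>)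
  qed (use assms m1 in \<open>simp_all add: unchanged_def\<close>)
qed

text \<open>An ascending scan that overwrites \<open>out\<close>, so the largest hit survives as in
  \<open>pick\<close>; \<open>f\<close> holds the tail sum of the machines already seen.\<close>

definition draw_loop :: com where
  "draw_loop = For ''k'' (ivar ''m'') (Cond (RLess (RCell ''s'' (ivar ''k'')) (rvar ''lev'')) Skip
     (Seq (Cond (RLess (rvar ''f'') (rvar ''b'')) (iset ''out'' (ivar ''k'')) Skip)
          (rset ''f'' (RAdd (rvar ''f'') (RCell ''s'' (ivar ''k''))))))"

lemma wp_draw_loop:
  assumes "ints st ''m'' 0 = m" "m \<le> M" "ints st ''out'' 0 = 0" "reals st ''f'' 0 = 0"
  shows "wp draw_loop (\<lambda>t st'. t \<le> 6 * M + 2 \<and> unchanged {''k'', ''f'', ''out''} st st' \<and>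
    ints st' ''out'' 0 = pick (reals st ''s'') (reals st ''lev'' 0) (reals st ''b'' 0) m) st"
proof -
  let ?I = "\<lambda>k st'. unchanged {''k'', ''f'', ''out''} st st' \<and> ints st' ''k'' 0 = k \<and>
    reals st' ''f'' 0 = tail_sum (reals st ''s'') k (reals st ''lev'' 0) \<and>
    ints st' ''out'' 0 = pick (reals st ''s'') (reals st ''lev'' 0) (reals st ''b'' 0) k"
  show ?thesis unfolding draw_loop_def
  proof (rule wp_conseq[OF wp_For[where I = ?I and N = m and M = M and B = 4]])
    fix k st' assume "k < m" and I: "?I k st'"
    then show "wp (Cond (RLess (RCell ''s'' (ivar ''k'')) (rvar ''lev'')) Skip
     (Seq (Cond (RLess (rvar ''f'') (rvar ''b'')) (iset ''out'' (ivar ''k'')) Skip)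
          (rset ''f'' (RAdd (rvar ''f'') (RCell ''s'' (ivar ''k''))))))
       (\<lambda>t st''. t \<le> 4 \<and> ints st'' ''k'' 0 = k \<and> ?I (Suc k) (st''\<lparr>ints := set_cell (ints st'') ''k'' 0 (Suc k)\<rparr>)) st'"
      by (intro wp_intros) (auto simp: unchanged_def set_cell_def tail_sum_Suc)
  qed (use assms in \<open>simp_all add: unchanged_def set_cell_def tail_sum_def\<close>)
qed

definition draw_prog :: com where
  "draw_prog = Seq level_prog (Seq (tail_sum_prog ''s'' (ivar ''m'') ''lev'' ''D'')
     (Seq (rset ''b'' (RMul (rvar ''x'') (rvar ''D'')))
     (Seq (iset ''out'' (INum 0)) (Seq (rset ''f'' (RNum 0)) draw_loop))))"

abbreviation "draw_vars \<equiv> {''k'', ''i'', ''z'', ''S'', ''v'', ''w'', ''c'', ''y'', ''W'', ''t'', ''q'', ''lev'', ''D'', ''b'', ''f'', ''out''}"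

lemma wp_draw:
  assumes "ints st ''m'' 0 = m" "0 < m" "m \<le> M" "ints st ''l'' 0 = l" "Suc l \<le> M"
  shows "wp draw_prog (\<lambda>t st'. t \<le> level_cost M + 10 * M + 8 \<and> unchanged draw_vars st st' \<and>
    ints st' ''out'' 0 = draw (reals st ''s'') m (level (reals st ''s'') m (reals st ''p'') l) (reals st ''x'' 0)) st"
  unfolding draw_prog_def
proof (rule wp_Seq_conseq[OF wp_level[OF assms]], elim conjE)
  let ?l = "level (reals st ''s'') m (reals st ''p'') l"
  fix t1 st1
  assume 1: "t1 \<le> level_cost M" "unchanged level_vars st st1" "reals st1 ''lev'' 0 = ?l"
  have m1: "ints st1 ''m'' 0 = m" and s1: "reals st1 ''s'' = reals st ''s''" using 1 assms by (simp_all add: unchanged_def)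
  show "wp (Seq (tail_sum_prog ''s'' (ivar ''m'') ''lev'' ''D'')
     (Seq (rset ''b'' (RMul (rvar ''x'') (rvar ''D'')))
     (Seq (iset ''out'' (INum 0)) (Seq (rset ''f'' (RNum 0)) draw_loop))))
    (\<lambda>u st'. t1 + u \<le> level_cost M + 10 * M + 8 \<and> unchanged draw_vars st st' \<and>
    ints st' ''out'' 0 = draw (reals st ''s'') m ?l (reals st ''x'' 0)) st1"
  proof (rule wp_Seq_conseq[OF wp_tail_sum[where N = m and M = M]], unfold s1 1(3))
    fix t2 st2
    assume 2: "t2 \<le> 4 * M + 3 \<and> unchanged {''k'', ''D''} st1 st2 \<and> reals st2 ''D'' 0 = tail_sum (reals st ''s'') m ?l"
    define st3 where "st3 = st2\<lparr>ints := set_cell (ints st2) ''out'' 0 0,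
      reals := set_cell (set_cell (reals st2) ''b'' 0 (reals st2 ''x'' 0 * reals st2 ''D'' 0)) ''f'' 0 0\<rparr>"
    have 3: "unchanged draw_vars st st3" "ints st3 ''m'' 0 = m" "reals st3 ''s'' = reals st ''s''" "reals st3 ''lev'' 0 = ?l"
      "reals st3 ''b'' 0 = reals st ''x'' 0 * tail_sum (reals st ''s'') m ?l" "ints st3 ''out'' 0 = 0" "reals st3 ''f'' 0 = 0"
      using 1 2 m1 s1 by (simp_all add: unchanged_def set_cell_def st3_def)
    have "wp draw_loop (\<lambda>u st'. t1 + (t2 + (1 + (1 + (1 + u)))) \<le> level_cost M + 10 * M + 8 \<and> unchanged draw_vars st st' \<and>
      ints st' ''out'' 0 = draw (reals st ''s'') m ?l (reals st ''x'' 0)) st3"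
      by (rule wp_conseq[OF wp_draw_loop[OF 3(2) assms(3) 3(6,7)]])
        (use 1(1) 2 3 in \<open>simp add: draw_def unchanged_def\<close>)
    then show "wp (Seq (rset ''b'' (RMul (rvar ''x'') (rvar ''D'')))
      (Seq (iset ''out'' (INum 0)) (Seq (rset ''f'' (RNum 0)) draw_loop)))
      (\<lambda>u st'. t1 + (t2 + u) \<le> level_cost M + 10 * M + 8 \<and> unchanged draw_vars st st' \<and>
      ints st' ''out'' 0 = draw (reals st ''s'') m ?l (reals st ''x'' 0)) st2"
      unfolding st3_def by (intro wp_Seq wp_RAssign wp_IAssign) simp
  qed (use assms m1 in \<open>simp_all add: unchanged_def\<close>)
qed

text \<open>Finds \<open>n - 1\<close> by counting, as indices can be incremented but not
  decremented.\<close>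

definition last_prog :: com where
  "last_prog = For ''i'' (ivar ''n'') (iset ''l'' (ivar ''i''))"

lemma wp_last:
  assumes "ints st ''n'' 0 = Suc l" "Suc l \<le> M"
  shows "wp last_prog (\<lambda>t st'. t \<le> 3 * M + 2 \<and> unchanged {''i'', ''l''} st st' \<and> ints st' ''l'' 0 = l) st"
proof -
  let ?I = "\<lambda>k st'. unchanged {''i'', ''l''} st st' \<and> ints st' ''i'' 0 = k \<and> (0 < k \<longrightarrow> ints st' ''l'' 0 = k - 1)"
  show ?thesis unfolding last_prog_def
  proof (rule wp_conseq[OF wp_For[where I = ?I and N = "Suc l" and M = M and B = 1]])
    fix k st' assume "k < Suc l" and I: "?I k st'"
    then show "wp (iset ''l'' (ivar ''i'')) (\<lambda>t st''. t \<le> 1 \<and> ints st'' ''i'' 0 = k \<and>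
        ?I (Suc k) (st''\<lparr>ints := set_cell (ints st'') ''i'' 0 (Suc k)\<rparr>)) st'"
      by (intro wp_intros) (simp add: unchanged_def set_cell_def)
  qed (use assms in \<open>simp_all add: unchanged_def set_cell_def\<close>)
qed

definition load_prog :: "iexp \<Rightarrow> string \<Rightarrow> com" where
  "load_prog e h = sum_prog e
     (BAnd (BNot (ILess (ICell ''a'' (ivar ''k'')) (ivar h))) (BNot (ILess (ivar h) (ICell ''a'' (ivar ''k'')))))
     (RCell ''p'' (ivar ''k'')) ''L''"

lemma wp_load:
  assumes "\<And>st'. unchanged {''k'', ''L''} st st' \<Longrightarrow> ival e st' = N" "N \<le> M" "h \<noteq> ''k''" "h \<noteq> ''L''"
  shows "wp (load_prog e h) (\<lambda>t st'. t \<le> 4 * M + 3 \<and> unchanged {''k'', ''L''} st st' \<and>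
    reals st' ''L'' 0 = (\<Sum>j<N. if ints st ''a'' j = ints st h 0 then reals st ''p'' j else 0)) st"
  unfolding load_prog_def
proof (rule wp_sum)
  fix st' j assume "unchanged {''k'', ''L''} st st'" "ints st' ''k'' 0 = j" "j < N"
  moreover from this(1) have "ints st' ''a'' = ints st ''a''" "ints st' h = ints st h" "reals st' ''p'' = reals st ''p''"
    using assms(3,4) by (simp_all add: unchanged_def)
  ultimately show "bval (BAnd (BNot (ILess (ICell ''a'' (ivar ''k'')) (ivar h))) (BNot (ILess (ivar h) (ICell ''a'' (ivar ''k''))))) st' =
      (ints st ''a'' j = ints st h 0) \<and> (ints st ''a'' j = ints st h 0 \<longrightarrow> rval (RCell ''p'' (ivar ''k'')) st' = reals st ''p'' j)"
    by (auto simp: not_less)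
qed (use assms in auto)

lemma load_eq:
  assumes "length a = n" "\<And>j. j < n \<Longrightarrow> A j = a ! j" "\<And>j. j < n \<Longrightarrow> p j = ps ! j"
  shows "(\<Sum>j<n. if A j = i then p j else 0) = load ps a i"
  unfolding load_def assms(1) using assms(2,3)
  by (simp add: sum.inter_filter[symmetric])

section \<open>The allocation program\<close>

text \<open>Both random numbers are drawn first, in tape order. The last cell of \<open>p\<close>
  holds the scaled report while the fee is computed and is restored before the draw.\<close>

definition alloc_prog :: com where
  "alloc_prog = Seq (Sample ''u'' (INum 0)) (Seq (Sample ''x'' (INum 0)) (Seq last_prog
     (Seq (rset ''r'' (RCell ''p'' (ivar ''l'')))
     (Seq (RAssign ''p'' (ivar ''l'') (RMul (rvar ''u'') (rvar ''r'')))
     (Seq mean_prog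
     (Seq (RAssign ''p'' (ivar ''l'') (rvar ''r''))
     (Seq draw_prog
     (Seq (load_prog (ivar ''l'') ''out'')
          (rset ''out'' (RSub (RMul (rvar ''r'') (rvar ''g''))
             (RDiv (RAdd (rvar ''L'') (rvar ''r'')) (RCell ''s'' (ivar ''out'')))))))))))))"

definition alloc_cost :: "'a::comm_semiring_1 \<Rightarrow> 'a" where
  "alloc_cost M = 2 * level_cost M + 25 * M + 30"

lemma mean_inv_cong:
  assumes "\<And>i. i < m \<Longrightarrow> s i = s' i"
  shows "mean_inv s m y = mean_inv s' m y"
  unfolding mean_inv_def using tail_sum_cong[of m s s' y] assms by (auto intro!: arg_cong2[where f = "(/)"] sum.cong)

lemma wp_alloc:
  assumes m: "ints st ''m'' 0 = m" "0 < m" "m \<le> M" and n: "ints st ''n'' 0 = Suc l" "Suc l \<le> M"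
    and r: "reals st ''p'' l = r"
  shows "wp alloc_prog (\<lambda>t st'. t \<le> alloc_cost M \<and>
    (let i = draw (reals st ''s'') m (level (reals st ''s'') m (reals st ''p'') l) (rands st 1)
     in ints st' ''out'' 0 = i \<and> reals st' ''out'' 0 =
       r * mean_inv (reals st ''s'') m (level (reals st ''s'') m ((reals st ''p'')(l := rands st 0 * r)) l)
       - ((\<Sum>j<l. if ints st ''a'' j = i then reals st ''p'' j else 0) + r) / reals st ''s'' i)) st"
    (is "wp _ ?Q _")
proof -
  let ?s = "reals st ''s''" and ?p = "reals st ''p''"
  let ?g = "mean_inv ?s m (level ?s m (?p(l := rands st 0 * r)) l)"
  let ?i = "draw ?s m (level ?s m ?p l) (rands st 1)"
  let ?L = "\<Sum>j<l. if ints st ''a'' j = ?i then ?p j else 0"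
  \<comment> \<open>The postcondition after \<open>u\<close> steps already spent. The suffixes of
    the program are treated from the last one backwards, each with the budget left to it.\<close>
  define P where "P u t = (\<lambda>st' :: state. t + u \<le> alloc_cost M \<and> ints st' ''out'' 0 = ?i \<and> reals st' ''out'' 0 = r * ?g - (?L + r) / ?s ?i)" for u t :: nat
  have shift: "(\<lambda>v. P u (t + v)) = P (u + t)" "(\<lambda>v. P u (Suc (t + v))) = P (u + t + 1)"
    "(\<lambda>v. P u (Suc (Suc (t + v)))) = P (u + t + 2)" "(\<lambda>v. P 0 (Suc (Suc v))) = P 2" for u t
    by (simp_all add: P_def fun_eq_iff add_ac)
  have Q: "?Q = P 0" by (simp add: P_def fun_eq_iff Let_def)
  define c6 where "c6 = rset ''out'' (RSub (RMul (rvar ''r'') (rvar ''g''))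
             (RDiv (RAdd (rvar ''L'') (rvar ''r'')) (RCell ''s'' (ivar ''out''))))"
  define c5 where "c5 = Seq (load_prog (ivar ''l'') ''out'') c6"
  define c4 where "c4 = Seq draw_prog c5"
  define c3 where "c3 = Seq mean_prog (Seq (RAssign ''p'' (ivar ''l'') (rvar ''r'')) c4)"
  have 6: "wp c6 (P u) st'" if "u + 1 \<le> alloc_cost M" "reals st' ''r'' 0 = r" "reals st' ''g'' 0 = ?g" "reals st' ''L'' 0 = ?L"
    "ints st' ''out'' 0 = ?i" "reals st' ''s'' = ?s" for u st'
    unfolding c6_def P_def using that by (intro wp_intros) (simp add: set_cell_def)
  have 5: "wp c5 (P u) st'" if "u + 4 * M + 4 \<le> alloc_cost M" "reals st' ''r'' 0 = r" "reals st' ''g'' 0 = ?g" "reals st' ''p'' = ?p"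
    "ints st' ''out'' 0 = ?i" "reals st' ''s'' = ?s" "ints st' ''a'' = ints st ''a''" "ints st' ''l'' 0 = l" for u st'
    unfolding c5_def
  proof (rule wp_Seq_conseq[OF wp_load[where N = l and M = M]])
    fix t st2
    assume *: "t \<le> 4 * M + 3 \<and> unchanged {''k'', ''L''} st' st2 \<and>
      reals st2 ''L'' 0 = (\<Sum>j<l. if ints st' ''a'' j = ints st' ''out'' 0 then reals st' ''p'' j else 0)"
    have "wp c6 (P (u + t)) st2" using * that by (intro 6) (simp_all add: unchanged_def cong: if_cong)
    then show "wp c6 (\<lambda>v. P u (t + v)) st2" by (simp only: shift)
  qed (use that n in \<open>simp_all add: unchanged_def\<close>)
  have 4: "wp c4 (P u) st'" if "u + level_cost M + 14 * M + 12 \<le> alloc_cost M" "reals st' ''r'' 0 = r" "reals st' ''g'' 0 = ?g" "reals st' ''p'' = ?p"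
    "reals st' ''s'' = ?s" "ints st' ''a'' = ints st ''a''" "ints st' ''l'' 0 = l" "ints st' ''m'' 0 = m"
    "reals st' ''x'' 0 = rands st 1" for u st'
    unfolding c4_def
  proof (rule wp_Seq_conseq[OF wp_draw[where m = m and M = M and l = l]])
    fix t st2
    assume *: "t \<le> level_cost M + 10 * M + 8 \<and> unchanged draw_vars st' st2 \<and>
      ints st2 ''out'' 0 = draw (reals st' ''s'') m (level (reals st' ''s'') m (reals st' ''p'') l) (reals st' ''x'' 0)"
    have "wp c5 (P (u + t)) st2" using * that by (intro 5) (simp_all add: unchanged_def)
    then show "wp c5 (\<lambda>v. P u (t + v)) st2" by (simp only: shift)
  qed (use that m n in simp_all)
  have 3: "wp c3 (P u) st'" if "u + 2 * level_cost M + 22 * M + 20 \<le> alloc_cost M" "reals st' ''r'' 0 = r"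
    "reals st' ''p'' = ?p(l := rands st 0 * r)"
    "reals st' ''s'' = ?s" "ints st' ''a'' = ints st ''a''" "ints st' ''l'' 0 = l" "ints st' ''m'' 0 = m"
    "reals st' ''x'' 0 = rands st 1" for u st'
    unfolding c3_def
  proof (rule wp_Seq_conseq[OF wp_mean[where m = m and M = M and l = l]])
    fix t st2
    assume *: "t \<le> level_cost M + 8 * M + 7 \<and> unchanged mean_vars st' st2 \<and>
      reals st2 ''g'' 0 = mean_inv (reals st' ''s'') m (level (reals st' ''s'') m (reals st' ''p'') l)"
    define st3 where "st3 = st2\<lparr>reals := set_cell (reals st2) ''p'' l r\<rparr>"
    have **: "reals st2 ''r'' 0 = r" "ints st2 ''l'' 0 = l" "reals st2 ''p'' = ?p(l := rands st 0 * r)"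
      using * that by (simp_all add: unchanged_def)
    then have "reals st3 ''p'' = ?p" using r by (simp add: st3_def set_cell_def fun_upd_idem)
    then have "wp c4 (P (u + t + 1)) st3" using * that
      by (intro 4) (simp_all add: unchanged_def st3_def set_cell_def)
    then show "wp (Seq (RAssign ''p'' (ivar ''l'') (rvar ''r'')) c4) (\<lambda>v. P u (t + v)) st2"
      using ** by (intro wp_Seq wp_RAssign) (simp add: shift st3_def)
  qed (use that m n in simp_all)
  define st2 where "st2 = st\<lparr>reals := set_cell (set_cell (reals st) ''u'' 0 (rands st 0)) ''x'' 0 (rands st 1), rands := \<lambda>k. rands st (Suc (Suc k))\<rparr>"
  have "wp (Seq last_prog (Seq (rset ''r'' (RCell ''p'' (ivar ''l'')))
     (Seq (RAssign ''p'' (ivar ''l'') (RMul (rvar ''u'') (rvar ''r''))) c3))) (P 2) st2"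
  proof (rule wp_Seq_conseq[OF wp_last[where l = l and M = M]])
    fix t st3
    assume *: "t \<le> 3 * M + 2 \<and> unchanged {''i'', ''l''} st2 st3 \<and> ints st3 ''l'' 0 = l"
    define st4 where "st4 = st3\<lparr>reals := set_cell (set_cell (reals st3) ''r'' 0 r) ''p'' l (rands st 0 * r)\<rparr>"
    have **: "reals st3 ''p'' = ?p" "reals st3 ''u'' 0 = rands st 0" "ints st3 ''m'' 0 = m" "reals st3 ''s'' = ?s"
      "reals st3 ''x'' 0 = rands st 1" "ints st3 ''a'' = ints st ''a''"
      using * m(1) by (simp_all add: unchanged_def st2_def set_cell_def)
    have "wp c3 (P (2 + t + 2)) st4" using * **
      by (intro 3) (simp_all add: st4_def set_cell_def alloc_cost_def)
    then show "wp (Seq (rset ''r'' (RCell ''p'' (ivar ''l'')))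
      (Seq (RAssign ''p'' (ivar ''l'') (RMul (rvar ''u'') (rvar ''r''))) c3)) (\<lambda>v. P 2 (t + v)) st3"
      using * ** r by (intro wp_Seq wp_RAssign) (simp add: shift st4_def set_cell_def)
  qed (use m n in \<open>simp_all add: st2_def\<close>)
  then show ?thesis unfolding Q alloc_prog_def c3_def c4_def c5_def c6_def st2_def
    by (intro wp_Seq[where c = "Sample _ _"] wp_Sample) (simp add: shift)
qed

lemma computes_alloc: "computes_alloc alloc_prog draw_mechanism (alloc_cost [:0, 1:])"
  unfolding computes_alloc_def
proof (intro allI impI, elim conjE)
  fix s ps a \<omega> and r :: real assume h: "history s ps a" and r: "0 < r"
  let ?m = "length s" and ?l = "length ps"
  let ?st = "input s (ps @ [r]) a \<omega>"
  have a: "length a = ?l" using h by (simp add: history_def assignments_def)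
  have s: "reals ?st ''s'' i = s ! i" if "i < ?m" for i using that by (simp add: input_def)
  have p: "reals ?st ''p'' j = (if j = ?l then r else ps ! j)" if "j \<le> ?l" for j
    using that by (auto simp: input_def nth_append)
  have i: "draw (reals ?st ''s'') ?m (level (reals ?st ''s'') ?m (reals ?st ''p'') ?l) u =
      draw ((!) s) ?m (report_level s ps r) u" for u
    unfolding report_level_def using s p
    by (subst draw_cong[of ?m _ "(!) s"]) (auto intro!: arg_cong[where f = "\<lambda>y. draw _ _ y _"] level_cong)
  have g: "mean_inv (reals ?st ''s'') ?m (level (reals ?st ''s'') ?m ((reals ?st ''p'')(?l := x)) ?l) =
      mean_inv ((!) s) ?m (report_level s ps x)" for x
    unfolding report_level_def using s p
    by (subst mean_inv_cong[of ?m _ "(!) s"]) (auto intro!: arg_cong[where f = "mean_inv _ _"] level_cong)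
  have L: "(\<Sum>j<?l. if ints ?st ''a'' j = i then reals ?st ''p'' j else 0) = load ps a i" for i
    by (rule load_eq[OF a]) (use a p in \<open>auto simp: input_def nth_append\<close>)
  have lt: "draw ((!) s) ?m (report_level s ps r) u < ?m" for u
    using history_pos(1)[OF h] by (rule draw_less)
  have "wp alloc_prog (\<lambda>t st'. t \<le> alloc_cost (?m + ?l + 1) \<and>
    (let i = draw ((!) s) ?m (report_level s ps r) (\<omega> 1)
     in ints st' ''out'' 0 = i \<and> reals st' ''out'' 0 =
       r * mean_inv ((!) s) ?m (report_level s ps (\<omega> 0 * r)) - (load ps a i + r) / s ! i)) ?st"
    by (rule wp_conseq[OF wp_alloc[where m = ?m and l = ?l and M = "?m + ?l + 1" and r = r]])
      (use history_pos(1)[OF h] p[of ?l] in \<open>simp_all add: i g L s[OF lt] Let_def, simp_all add: input_def\<close>)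
  then obtain t st' where t: "exec alloc_prog ?st t st'" "t \<le> alloc_cost (?m + ?l + 1)"
    and out: "ints st' ''out'' 0 = draw ((!) s) ?m (report_level s ps r) (\<omega> 1)"
      "reals st' ''out'' 0 = r * mean_inv ((!) s) ?m (report_level s ps (\<omega> 0 * r)) -
         (load ps a (draw ((!) s) ?m (report_level s ps r) (\<omega> 1)) + r) / s ! draw ((!) s) ?m (report_level s ps r) (\<omega> 1)"
    by (auto simp: wp_def Let_def)
  have "poly (alloc_cost [:0, 1:]) M = alloc_cost M" for M :: nat
    by (simp add: alloc_cost_def level_cost_def algebra_simps)
  then show "\<exists>t st. exec alloc_prog ?st t st \<and> t \<le> poly (alloc_cost [:0, 1:]) (?m + ?l + 1) \<and>
      alloc draw_mechanism s ps a r \<omega> = (ints st ''out'' 0, reals st ''out'' 0)"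
    using t out by (intro exI[of _ t] exI[of _ st']) (simp add: draw_mechanism_def Let_def)
qed

section \<open>The payment program\<close>

definition share_update :: com where
  "share_update = Cond (RLess (RCell ''s'' (ivar ''h'')) (rvar ''lev'')) Skip
     (rset ''acc'' (RAdd (rvar ''acc'') (RMul (RCell ''p'' (ivar ''l'')) (RDiv (RCell ''s'' (ivar ''h'')) (rvar ''D'')))))"

definition expected_load_prog :: com where
  "expected_load_prog = Seq (rset ''acc'' (RNum 0)) (For ''l'' (ivar ''n'')
     (Seq level_prog (Seq (tail_sum_prog ''s'' (ivar ''m'') ''lev'' ''D'') share_update)))"

abbreviation "load_vars \<equiv> {''k'', ''i'', ''z'', ''S'', ''v'', ''w'', ''c'', ''y'', ''W'', ''t'', ''q'', ''lev'', ''D'', ''acc'', ''l''}"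

definition expected_load_cost :: "'a::comm_semiring_1 \<Rightarrow> 'a" where
  "expected_load_cost M = M * (level_cost M + 4 * M + 7) + 3"

lemma wp_expected_load:
  assumes "ints st ''m'' 0 = m" "0 < m" "m \<le> M" "ints st ''n'' 0 = n" "n \<le> M" "ints st ''h'' 0 = h"
  shows "wp expected_load_prog (\<lambda>t st'. t \<le> expected_load_cost M \<and> unchanged load_vars st st' \<and>
    reals st' ''acc'' 0 = expected_load (reals st ''s'') m (reals st ''p'') n h) st"
proof -
  let ?s = "reals st ''s''" and ?p = "reals st ''p''"
  let ?I = "\<lambda>k st'. unchanged load_vars st st' \<and> ints st' ''l'' 0 = k \<and>
    reals st' ''acc'' 0 = expected_load ?s m ?p k h"
  show ?thesis unfolding expected_load_prog_def
  proof (intro wp_Seq wp_RAssign, rule wp_conseq[OF wp_For[where I = ?I and N = n and M = M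
        and B = "level_cost M + 4 * M + 5"]])
    fix k st' assume k: "k < n" and I: "?I k st'"
    let ?l = "level ?s m ?p k"
    have I': "reals st' ''s'' = ?s" "reals st' ''p'' = ?p" "ints st' ''m'' 0 = m" "ints st' ''h'' 0 = h"
      using I assms by (simp_all add: unchanged_def)
    show "wp (Seq level_prog (Seq (tail_sum_prog ''s'' (ivar ''m'') ''lev'' ''D'') share_update))
      (\<lambda>t st''. t \<le> level_cost M + 4 * M + 5 \<and> ints st'' ''l'' 0 = k \<and>
        ?I (Suc k) (st''\<lparr>ints := set_cell (ints st'') ''l'' 0 (Suc k)\<rparr>)) st'"
    proof (rule wp_Seq_conseq[OF wp_level[where m = m and M = M and l = k]], unfold I'(1,2))
      fix t1 st1
      assume 1: "t1 \<le> level_cost M \<and> unchanged level_vars st' st1 \<and> reals st1 ''lev'' 0 = ?l"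
      have r1: "reals st1 ''s'' = ?s" "reals st1 ''p'' = ?p" "ints st1 ''m'' 0 = m" "ints st1 ''h'' 0 = h" "ints st1 ''l'' 0 = k"
        "reals st1 ''acc'' 0 = expected_load ?s m ?p k h" "unchanged load_vars st st1"
        using 1 I I' by (simp_all add: unchanged_def)
      show "wp (Seq (tail_sum_prog ''s'' (ivar ''m'') ''lev'' ''D'') share_update)
        (\<lambda>u st''. t1 + u \<le> level_cost M + 4 * M + 5 \<and> ints st'' ''l'' 0 = k \<and>
          ?I (Suc k) (st''\<lparr>ints := set_cell (ints st'') ''l'' 0 (Suc k)\<rparr>)) st1"
      proof (rule wp_Seq_conseq[OF wp_tail_sum[where N = m and M = M]], unfold r1(1))
        fix t2 st2
        assume 2: "t2 \<le> 4 * M + 3 \<and> unchanged {''k'', ''D''} st1 st2 \<and> reals st2 ''D'' 0 = tail_sum ?s m (reals st1 ''lev'' 0)"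
        have r2: "reals st2 ''s'' = ?s" "reals st2 ''p'' = ?p" "ints st2 ''h'' 0 = h" "ints st2 ''l'' 0 = k"
          "reals st2 ''acc'' 0 = expected_load ?s m ?p k h" "reals st2 ''lev'' 0 = ?l" "reals st2 ''D'' 0 = tail_sum ?s m ?l"
          "unchanged load_vars st st2"
          using 1 2 r1 by (simp_all add: unchanged_def)
        have t: "t1 \<le> level_cost M" "t2 \<le> 4 * M + 3" using 1 2 by auto
        have E: "expected_load ?s m ?p (Suc k) h = expected_load ?s m ?p k h + (if ?l \<le> ?s h then ?p k * (?s h / tail_sum ?s m ?l) else 0)"
          by (simp add: expected_load_def share_def)
        show "wp share_update (\<lambda>u st''. t1 + (t2 + u) \<le> level_cost M + 4 * M + 5 \<and> ints st'' ''l'' 0 = k \<and>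
          ?I (Suc k) (st''\<lparr>ints := set_cell (ints st'') ''l'' 0 (Suc k)\<rparr>)) st2"
          unfolding share_update_def E
          by (intro wp_intros) (use t r2 in \<open>simp_all add: unchanged_def set_cell_def\<close>)
      qed (use assms r1 in \<open>simp_all add: unchanged_def\<close>)
    qed (use assms I I' k in simp_all)
  qed (use assms in \<open>simp_all add: unchanged_def set_cell_def expected_load_def expected_load_cost_def add.commute\<close>)
qed

text \<open>The machine's speed is replaced by its random report during the computation and then
  restored, so that the next machines again see the reported speeds.\<close>

definition pay_body :: com where
  "pay_body = Seq (rset ''o'' (RCell ''s'' (ivar ''h'')))
     (Seq (RAssign ''s'' (ivar ''h'') (RDiv (rvar ''o'') (rvar ''u'')))
     (Seq expected_load_prog
     (Seq (RAssign ''s'' (ivar ''h'') (rvar ''o''))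
     (Seq (load_prog (ivar ''n'') ''h'')
          (RAssign ''out'' (ivar ''h'') (RSub (RDiv (rvar ''L'') (rvar ''o'')) (RDiv (rvar ''acc'') (rvar ''o''))))))))"

text \<open>One random number serves all machines: truthfulness concerns the expectation of each
  payment separately.\<close>

definition pay_prog :: com where
  "pay_prog = Seq (Sample ''u'' (INum 0)) (For ''h'' (ivar ''m'') pay_body)"

abbreviation "pay_vars \<equiv> {''k'', ''i'', ''z'', ''S'', ''v'', ''w'', ''c'', ''y'', ''W'', ''t'', ''q'', ''lev'', ''D'', ''acc'', ''l'', ''o'', ''L''}"

definition pay_cost :: "'a::comm_semiring_1 \<Rightarrow> 'a" where
  "pay_cost M = M * (expected_load_cost M + 4 * M + 9) + 3"

lemma wp_pay_body:
  assumes "ints st ''m'' 0 = m" "0 < m" "m \<le> M" "ints st ''n'' 0 = n" "n \<le> M" "ints st ''h'' 0 = h"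
  defines "x \<equiv> reals st ''s'' h"
  shows "wp pay_body (\<lambda>t st'. t \<le> expected_load_cost M + 4 * M + 7 \<and> unchanged (insert ''out'' pay_vars) st st' \<and>
    reals st' ''out'' = (reals st ''out'')(h :=
      (\<Sum>j<n. if ints st ''a'' j = h then reals st ''p'' j else 0) / x -
      expected_load ((reals st ''s'')(h := x / reals st ''u'' 0)) m (reals st ''p'') n h / x)) st"
proof -
  let ?s = "(reals st ''s'')(h := x / reals st ''u'' 0)" and ?p = "reals st ''p''"
  let ?L = "\<Sum>j<n. if ints st ''a'' j = h then reals st ''p'' j else 0"
  let ?E = "expected_load ?s m ?p n h"
  let ?Q = "\<lambda>u t st'. u + t \<le> expected_load_cost M + 4 * M + 7 \<and> unchanged (insert ''out'' pay_vars) st st' \<and>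
    reals st' ''out'' = (reals st ''out'')(h := ?L / x - ?E / x)"
  define st2 where "st2 = st\<lparr>reals := set_cell (set_cell (reals st) ''o'' 0 x) ''s'' h (x / reals st ''u'' 0)\<rparr>"
  have 2: "reals st2 ''s'' = ?s" "reals st2 ''p'' = ?p" "ints st2 = ints st" "reals st2 ''o'' 0 = x"
    "unchanged {''o'', ''s''} st st2"
    using assms by (simp_all add: st2_def set_cell_def unchanged_def)
  have "wp (Seq expected_load_prog (Seq (RAssign ''s'' (ivar ''h'') (rvar ''o''))
     (Seq (load_prog (ivar ''n'') ''h'')
          (RAssign ''out'' (ivar ''h'') (RSub (RDiv (rvar ''L'') (rvar ''o'')) (RDiv (rvar ''acc'') (rvar ''o''))))))) (?Q 2) st2"
  proof (rule wp_Seq_conseq[OF wp_expected_load[where m = m and M = M and n = n and h = h]], unfold 2(1,2))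
    fix t3 st3
    assume 3: "t3 \<le> expected_load_cost M \<and> unchanged load_vars st2 st3 \<and> reals st3 ''acc'' 0 = ?E"
    have r3: "reals st3 ''s'' = ?s" "reals st3 ''o'' 0 = x" "ints st3 ''h'' 0 = h"
      using 3 2 assms by (simp_all add: unchanged_def)
    define st4 where "st4 = st3\<lparr>reals := set_cell (reals st3) ''s'' h x\<rparr>"
    have s4: "reals st4 ''s'' = reals st ''s''"
      using r3 by (simp add: st4_def set_cell_def x_def)
    have u4: "unchanged (insert ''s'' pay_vars) st st4" "reals st4 ''acc'' 0 = ?E" "reals st4 ''o'' 0 = x"
      using 3 2 r3 by (simp_all add: st4_def unchanged_def set_cell_def)
    \<comment> \<open>The array \<open>s\<close> was written to, but its contents are restored, so
      it is absent from \<open>pay_vars\<close>.\<close>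
    have 4: "unchanged pay_vars st st4"
      unfolding unchanged_def
    proof (intro allI impI)
      fix y assume "y \<notin> pay_vars"
      then show "ints st4 y = ints st y \<and> reals st4 y = reals st y"
        using u4(1) s4 by (cases "y = ''s''") (simp_all add: unchanged_def st4_def 3 2 x_def, use 3 2 in \<open>simp_all add: unchanged_def\<close>)
    qed
    have "wp (Seq (load_prog (ivar ''n'') ''h'')
        (RAssign ''out'' (ivar ''h'') (RSub (RDiv (rvar ''L'') (rvar ''o'')) (RDiv (rvar ''acc'') (rvar ''o'')))))
      (\<lambda>t. ?Q 2 (t3 + (1 + t))) st4"
    proof (rule wp_Seq_conseq[OF wp_load[where N = n and M = M]])
      fix t5 st5
      assume 5: "t5 \<le> 4 * M + 3 \<and> unchanged {''k'', ''L''} st4 st5 \<and>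
        reals st5 ''L'' 0 = (\<Sum>j<n. if ints st4 ''a'' j = ints st4 ''h'' 0 then reals st4 ''p'' j else 0)"
      have r5: "unchanged pay_vars st st5" "reals st5 ''L'' 0 = ?L" "reals st5 ''o'' 0 = x" "reals st5 ''acc'' 0 = ?E"
        "ints st5 ''h'' 0 = h" "reals st5 ''out'' = reals st ''out''"
        using 5 4 u4 assms(6) by (simp_all add: unchanged_def cong: if_cong)
      have t: "t3 \<le> expected_load_cost M" "t5 \<le> 4 * M + 3" using 3 5 by auto
      show "wp (RAssign ''out'' (ivar ''h'') (RSub (RDiv (rvar ''L'') (rvar ''o'')) (RDiv (rvar ''acc'') (rvar ''o''))))
        (\<lambda>t. ?Q 2 (t3 + (1 + (t5 + t)))) st5"
        by (intro wp_intros) (use r5 t in \<open>simp add: unchanged_def set_cell_def\<close>)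
    qed (use 4 assms in \<open>simp_all add: unchanged_def\<close>)
    then show "wp (Seq (RAssign ''s'' (ivar ''h'') (rvar ''o'')) (Seq (load_prog (ivar ''n'') ''h'')
        (RAssign ''out'' (ivar ''h'') (RSub (RDiv (rvar ''L'') (rvar ''o'')) (RDiv (rvar ''acc'') (rvar ''o''))))))
      (\<lambda>t. ?Q 2 (t3 + t)) st3"
      using r3 by (intro wp_Seq[where c = "RAssign _ _ _"] wp_RAssign) (simp add: st4_def)
  qed (use assms 2 in simp_all)
  then show ?thesis unfolding pay_body_def st2_def
    using assms by (intro wp_Seq[where c = "RAssign _ _ _"] wp_RAssign) (simp add: set_cell_def)
qed

lemma wp_pay:
  assumes "ints st ''m'' 0 = m" "0 < m" "m \<le> M" "ints st ''n'' 0 = n" "n \<le> M"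
  shows "wp pay_prog (\<lambda>t st'. t \<le> pay_cost M \<and> (\<forall>i<m. reals st' ''out'' i =
      (\<Sum>j<n. if ints st ''a'' j = i then reals st ''p'' j else 0) / reals st ''s'' i -
      expected_load ((reals st ''s'')(i := reals st ''s'' i / rands st 0)) m (reals st ''p'') n i / reals st ''s'' i)) st"
proof -
  let ?P = "\<lambda>i. (\<Sum>j<n. if ints st ''a'' j = i then reals st ''p'' j else 0) / reals st ''s'' i -
      expected_load ((reals st ''s'')(i := reals st ''s'' i / rands st 0)) m (reals st ''p'') n i / reals st ''s'' i"
  define st1 where "st1 = st\<lparr>reals := set_cell (reals st) ''u'' 0 (rands st 0), rands := \<lambda>k. rands st (Suc k)\<rparr>"
  have 1: "unchanged {''u''} st st1" "reals st1 ''u'' 0 = rands st 0"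
    by (simp_all add: st1_def unchanged_def set_cell_def)
  let ?I = "\<lambda>k st'. unchanged (insert ''h'' (insert ''out'' pay_vars)) st1 st' \<and> ints st' ''h'' 0 = k \<and>
    (\<forall>i<k. reals st' ''out'' i = ?P i)"
  have "wp (For ''h'' (ivar ''m'') pay_body) (\<lambda>t st'. Suc t \<le> pay_cost M \<and> (\<forall>i<m. reals st' ''out'' i = ?P i)) st1"
  proof (rule wp_conseq[OF wp_For[where I = ?I and N = m and M = M and B = "expected_load_cost M + 4 * M + 7"]])
    fix k st' assume k: "k < m" and I: "?I k st'"
    have I': "reals st' ''s'' = reals st ''s''" "reals st' ''p'' = reals st ''p''" "ints st' ''a'' = ints st ''a''"
      "ints st' ''m'' 0 = m" "ints st' ''n'' 0 = n" "reals st' ''u'' 0 = rands st 0"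
      using I 1 assms by (simp_all add: unchanged_def)
    show "wp pay_body (\<lambda>t st''. t \<le> expected_load_cost M + 4 * M + 7 \<and> ints st'' ''h'' 0 = k \<and>
        ?I (Suc k) (st''\<lparr>ints := set_cell (ints st'') ''h'' 0 (Suc k)\<rparr>)) st'"
    proof (rule wp_conseq[OF wp_pay_body[where m = m and M = M and n = n and h = k]], unfold I')
      fix t st2
      assume 2: "t \<le> expected_load_cost M + 4 * M + 7 \<and> unchanged (insert ''out'' pay_vars) st' st2 \<and>
        reals st2 ''out'' = (reals st' ''out'')(k := ?P k)"
      then have "\<forall>i<Suc k. reals st2 ''out'' i = ?P i" using I by (simp add: less_Suc_eq)
      moreover have "unchanged (insert ''h'' (insert ''out'' pay_vars)) st1 st2" "ints st2 ''h'' 0 = k"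
        using I 2 by (simp_all add: unchanged_def)
      ultimately show "t \<le> expected_load_cost M + 4 * M + 7 \<and> ints st2 ''h'' 0 = k \<and>
        ?I (Suc k) (st2\<lparr>ints := set_cell (ints st2) ''h'' 0 (Suc k)\<rparr>)"
        using 2 by (simp add: unchanged_def set_cell_def)
    qed (use assms I I' in simp_all)
  qed (use assms 1 in \<open>simp_all add: unchanged_def set_cell_def pay_cost_def add.commute\<close>)
  then show ?thesis unfolding pay_prog_def st1_def
    by (intro wp_Seq[where c = "Sample _ _"] wp_Sample) simp
qed

lemma computes_pay: "computes_pay pay_prog draw_mechanism (pay_cost [:0, 1:])"
  unfolding computes_pay_def
proof (intro allI impI)
  fix s ps a \<omega> assume h: "history s ps a"
  let ?m = "length s" and ?n = "length ps"
  let ?st = "input s ps a \<omega>"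
  have a: "length a = ?n" using h by (simp add: history_def assignments_def)
  have s: "reals ?st ''s'' i = s ! i" if "i < ?m" for i using that by (simp add: input_def)
  have p: "reals ?st ''p'' j = ps ! j" if "j < ?n" for j using that by (simp add: input_def)
  have L: "(\<Sum>j<?n. if ints ?st ''a'' j = i then reals ?st ''p'' j else 0) = load ps a i" for i
    by (rule load_eq[OF a]) (use a p in \<open>auto simp: input_def\<close>)
  have E: "expected_load ((reals ?st ''s'')(i := x)) ?m (reals ?st ''p'') ?n i =
      expected_load (((!) s)(i := x)) ?m ((!) ps) ?n i" if i: "i < ?m" for i x
  proof -
    have "expected_load ((reals ?st ''s'')(i := x)) ?m (reals ?st ''p'') ?n i =
        expected_load (((!) s)(i := x)) ?m (reals ?st ''p'') ?n i"
      using i s by (intro expected_load_cong) auto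
    also have "\<dots> = expected_load (((!) s)(i := x)) ?m ((!) ps) ?n i"
    proof -
      have "level (((!) s)(i := x)) ?m (reals ?st ''p'') l = level (((!) s)(i := x)) ?m ((!) ps) l" if "l < ?n" for l
        using that p by (intro level_cong) auto
      then show ?thesis unfolding expected_load_def using p by (intro sum.cong) auto
    qed
    finally show ?thesis .
  qed
  have "wp pay_prog (\<lambda>t st'. t \<le> pay_cost (?m + ?n) \<and> (\<forall>i<?m. reals st' ''out'' i = pay draw_mechanism s ps a \<omega> i)) ?st"
    by (rule wp_conseq[OF wp_pay[where m = ?m and n = ?n and M = "?m + ?n"]])
      (use history_pos(1)[OF h] in \<open>simp_all add: L E s draw_mechanism_def, simp_all add: input_def\<close>)
  moreover have "poly (pay_cost [:0, 1:]) M = pay_cost M" for M :: nat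
    by (simp add: pay_cost_def expected_load_cost_def level_cost_def algebra_simps)
  ultimately show "\<exists>t st. exec pay_prog ?st t st \<and> t \<le> poly (pay_cost [:0, 1:]) (?m + ?n) \<and>
      (\<forall>i<?m. pay draw_mechanism s ps a \<omega> i = reals st ''out'' i)"
    by (auto simp: wp_def) metis
qed

theorem theorem1:
  "\<exists>M. valid_mechanism M \<and> polynomial_time M \<and> two_sided_truthful M \<and>
     (\<exists>c \<in> O(\<lambda>m. ln (real m)). \<forall>m\<ge>1. competitive_in_expectation M m (c m)) \<and>
     (\<forall>k::nat. \<exists>c \<in> O(\<lambda>m. ln (real m)). \<forall>m\<ge>1. competitive_with_prob M m (c m) (1 - 1 / real m ^ k))"
proof (intro exI[of _ draw_mechanism] conjI allI)
  show "polynomial_time draw_mechanism"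
    unfolding polynomial_time_def using computes_alloc computes_pay by blast
  show "two_sided_truthful draw_mechanism"
    by (simp add: two_sided_truthful_def machine_truthful_draw_mechanism job_truthful_draw_mechanism)
  show "\<exists>c \<in> O(\<lambda>m. ln (real m)). \<forall>m\<ge>1. competitive_in_expectation draw_mechanism m (c m)"
    using competitive_expectation affine_ln_bigo[of 4 6] by (intro bexI) auto
  show "\<exists>c \<in> O(\<lambda>m. ln (real m)). \<forall>m\<ge>1. competitive_with_prob draw_mechanism m (c m) (1 - 1 / real m ^ k)" for k
    using competitive_prob affine_ln_bigo[of 4 "6 + 2 * real k"] by (intro bexI) auto
qed (rule valid_draw_mechanism)

end
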